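(* Let $\mathcal M=\{g(x;\theta)\mid\theta\in\Theta\}$ be a parametric model with $p$-dimensional parameter, let $X_1,\dots,X_n$ be an i.i.d. sample from the true density $g(x)$, let $\theta_*$ be the parameter of the information projection of $g$ on $\mathcal M$, and let $\hat\theta$ be the maximum likelihood estimator. With the notation, Einstein summation convention and standing assumptions given in the context, the estimation risk $R[g(x;\theta_* )\,|\,g(x;\hat\theta)]=E\bigl[D[g(x;\theta_* )\,|\,g(x;\hat\theta)]\bigr]$ of the MLE with respect to the Kullback–Leibler divergence satisfies, as $n\to\infty$ (model fixed), $$ \begin{aligned} &R[g(x;\theta_* )\,|\,g(x;\hat{\theta}) ] = (2n)^{-1}\, \mathrm{tr} \bigl(\tilde{G}^{-1}G\tilde{G}^{-1}G^* \bigr) \\ &\quad+n^{-2} \Bigl[2^{-1}g^*_{ij}\Bigl( \tilde{g}^{sj}\tilde{g}^{it}\tilde{g}^{lm}(L_{(sl)tm}+\tilde{g}_{ls}g_{tm}) +\tilde{g}^{si}\tilde{g}^{jt}\tilde{g}^{lm}(L_{(sl)tm}+\tilde{g}_{ls}g_{tm})\\ &\qquad+ 2^{-1}\tilde{g}^{uj}\tilde{g}^{ik}\tilde{g}^{ls}\tilde{g}^{mt}L_{kst}L_{(lmu)} +2^{-1}\tilde{g}^{ui}\tilde{g}^{jk}\tilde{g}^{ls}\tilde{g}^{mt}L_{kst}L_{(lmu)}\\ &\qquad+\tilde{g}^{jk}\tilde{g}^{lu}\tilde{g}^{is}\tilde{g}^{mt} (L_{(kl)(um)}g_{st}-\tilde{g}_{kl}\tilde{g}_{um}g_{st}+L_{(kl)s}L_{(um)t}+L_{(kl)t}L_{(um)s})\\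 &\qquad+\tilde{g}^{ik}\tilde{g}^{lu}\tilde{g}^{js}\tilde{g}^{mt} (L_{(kl)(um)}g_{st}-\tilde{g}_{kl}\tilde{g}_{um}g_{st}+L_{(kl)s}L_{(um)t}+L_{(kl)t}L_{(um)s})\\ &\qquad+2^{-1}\tilde{g}^{jk}\tilde{g}^{it}\tilde{g}^{mu}\tilde{g}^{sv}\tilde{g}^{wl}L_{(msw)}(L_{(lk)t}g_{uv}+L_{(lk)u}g_{tv}+L_{(lk)v}g_{tu})\\ &\qquad+2^{-1}\tilde{g}^{ik}\tilde{g}^{jt}\tilde{g}^{mu}\tilde{g}^{sv}\tilde{g}^{wl}L_{(msw)}(L_{(lk)t}g_{uv}+L_{(lk)u}g_{tv}+L_{(lk)v}g_{tu})\\ &\qquad+2^{-1}\tilde{g}^{js}\tilde{g}^{it}\tilde{g}^{lu}\tilde{g}^{mv} (L_{(slm)t}g_{uv}+L_{(slm)u}g_{tv}+L_{(slm)v}g_{tu})\\ &\qquad+2^{-1}\tilde{g}^{is}\tilde{g}^{jt}\tilde{g}^{lu}\tilde{g}^{mv} (L_{(slm)t}g_{uv}+L_{(slm)u}g_{tv}+L_{(slm)v}g_{tu})\\ &\qquad+\tilde{g}^{mt}\tilde{g}^{iu}\tilde{g}^{lv}\tilde{g}^{sw}\tilde{g}^{kj}L_{(lmk)}(L_{(ts)u}g_{vw} +L_{(ts)v}g_{uw}+L_{(ts)w}g_{uv})\\ &\qquad+\tilde{g}^{mt}\tilde{g}^{ju}\tilde{g}^{lv}\tilde{g}^{sw}\tilde{g}^{ki}L_{(lmk)}(L_{(ts)u}g_{vw}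 +L_{(ts)v}g_{uw}+L_{(ts)w}g_{uv})\\ &\qquad+2^{-1}\tilde{g}^{ik}\tilde{g}^{lu}\tilde{g}^{sv}\tilde{g}^{tw}\tilde{g}^{oj}\tilde{g}^{hm}L_{(lmo)}L_{(sth)} (g_{ku}g_{vw}+g_{kv}g_{uw}+g_{kw}g_{uv})\\ &\qquad+2^{-1}\tilde{g}^{jk}\tilde{g}^{lu}\tilde{g}^{sv}\tilde{g}^{tw}\tilde{g}^{oi}\tilde{g}^{hm}L_{(lmo)}L_{(sth)} (g_{ku}g_{vw}+g_{kv}g_{uw}+g_{kw}g_{uv})\\ &\qquad+6^{-1}\tilde{g}^{ik}\tilde{g}^{ls}\tilde{g}^{mu}\tilde{g}^{tv}\tilde{g}^{wj}L_{(lmtw)} (g_{ks}g_{uv}+g_{ku}g_{sv}+g_{kv}g_{su})\\ &\qquad+6^{-1}\tilde{g}^{jk}\tilde{g}^{ls}\tilde{g}^{mu}\tilde{g}^{tv}\tilde{g}^{wi}L_{(lmtw)} (g_{ks}g_{uv}+g_{ku}g_{sv}+g_{kv}g_{su})\\ &\qquad+\tilde{g}^{ik}\tilde{g}^{js}\tilde{g}^{lt}\tilde{g}^{mu} (L_{(kl)(sm)}g_{tu}-\tilde{g}_{kl}\tilde{g}_{sm}g_{tu}+L_{(kl)t}L_{(sm)u}+L_{(kl)u}L_{(sm)t})\\ &\qquad+2^{-1}\tilde{g}^{ik}\tilde{g}^{lu}\tilde{g}^{sv}\tilde{g}^{tw}\tilde{g}^{jm}L_{(stm)} (L_{(kl)u}g_{vw}+L_{(kl)v}g_{uw}+L_{(kl)w}g_{uv})\\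 &\qquad+2^{-1}\tilde{g}^{jk}\tilde{g}^{lu}\tilde{g}^{sv}\tilde{g}^{tw}\tilde{g}^{im}L_{(stm)} (L_{(kl)u}g_{vw}+L_{(kl)v}g_{uw}+L_{(kl)w}g_{uv})\\ &\qquad+4^{-1}\tilde{g}^{lk}\tilde{g}^{mu}\tilde{g}^{sv}\tilde{g}^{tw}\tilde{g}^{io}\tilde{g}^{jh}L_{(lmo)}L_{(sth)} (g_{ku}g_{vw}+g_{kv}g_{uw}+g_{kw}g_{uv}) \Bigr)\\ &\qquad-6^{-1}\tau_{ijk}\Bigl(\tilde{g}^{is}\tilde{g}^{jt}\tilde{g}^{ku}L_{stu} \\ &\qquad+\tilde{g}^{it}\tilde{g}^{su}\tilde{g}^{jv}\tilde{g}^{kw}(L_{(st)u}g_{vw}+L_{(st)v}g_{uw}+L_{(st)w}g_{uv})\\ &\qquad+\tilde{g}^{jt}\tilde{g}^{su}\tilde{g}^{iv}\tilde{g}^{kw}(L_{(st)u}g_{vw}+L_{(st)v}g_{uw}+L_{(st)w}g_{uv})\\ &\qquad+\tilde{g}^{kt}\tilde{g}^{su}\tilde{g}^{iv}\tilde{g}^{jw}(L_{(st)u}g_{vw}+L_{(st)v}g_{uw}+L_{(st)w}g_{uv})\\ &\qquad+2^{-1} \tilde{g}^{su}\tilde{g}^{tv}\tilde{g}^{jw}\tilde{g}^{km}\tilde{g}^{il}L_{(stl)}(g_{uv}g_{wm}+g_{uw}g_{vm}+g_{um}g_{vw})\\ &\qquad+2^{-1} \tilde{g}^{su}\tilde{g}^{tv}\tilde{g}^{iw}\tilde{g}^{km}\tilde{g}^{jl}L_{(stl)}(g_{uv}g_{wm}+g_{uw}g_{vm}+g_{um}g_{vw})\\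 &\qquad+2^{-1}\tilde{g}^{su}\tilde{g}^{tv}\tilde{g}^{iw}\tilde{g}^{jm}\tilde{g}^{kl}L_{(stl)}(g_{uv}g_{wm}+g_{uw}g_{vm}+g_{um}g_{vw})\Bigr)\\ &\qquad-24^{-1}\tau_{ijkl}\,\tilde{g}^{is}\tilde{g}^{jt}\tilde{g}^{ku}\tilde{g}^{lv}(g_{st}g_{uv}+g_{su}g_{tv}+g_{sv}g_{tu}) \Bigr] + O(n^{-3}). \end{aligned} $$
   Context: **Setting.** $\mathcal M=\{g(x;\theta)\mid \theta=(\theta^1,\dots,\theta^p)\in\Theta\}$ is a family of probability densities with respect to a reference measure $d\mu$ on a measurable space, smooth in $\theta$. The true distribution has density $g(x)$ with respect to $d\mu$ (not necessarily in $\mathcal M$). $X_1,\dots,X_n$ are i.i.d. from $g(x)$, and $X$ denotes a generic such variable. $E[\cdot]$ is expectation under $g(x)$; $E_{\theta_*}[\cdot]$ is expectation under $g(x;\theta_* )$. The Kullback–Leibler divergence is $D[g_1(x)\,|\,g_2(x)]=\int g_1(x)\log\bigl(g_1(x)/g_2(x)\bigr)d\mu$. The information projection $g(x;\theta_* )$ is given by $\theta_*=\arg\min_{\theta\in\Theta}D[g(x)\,|\,g(x;\theta)]$, which solves $E[\partial_{\theta^i}\log g(X;\theta)]=0$, $i=1,\dots,p$. The MLE $\hat\theta$ maximizes $\sum_{a=1}^n\log g(X_a;\theta)$ and solves $\sum_{a=1}^n\partial_{\theta^i}\log g(X_a;\theta)=0$, $i=1,\dots,p$. **Notation** (all indices run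 over $1,\dots,p$; repeated indices are summed, Einstein convention; everything is evaluated at $\theta_*$; $\partial_i=\partial/\partial\theta^i$, $\ell=\log g(X;\theta)$ at $\theta=\theta_*$): - $G=(g_{ij})$, $g_{ij}=E[\partial_i\ell\,\partial_j\ell]$; - $\tilde G=(\tilde g_{ij})$, $\tilde g_{ij}=-E[\partial_i\partial_j\ell]$, assumed invertible, with $\tilde G^{-1}=(\tilde g^{ij})$; - $G^*=(g^*_{ij})$, $g^*_{ij}=E_{\theta_*}[\partial_i\ell\,\partial_j\ell]=-E_{\theta_*}[\partial_i\partial_j\ell]$; - $L_{(ijk)}=E[\partial_i\partial_j\partial_k\ell]$, $L_{(ij)k}=E[\partial_i\partial_j\ell\;\partial_k\ell]$, $L_{ijk}=E[\partial_i\ell\,\partial_j\ell\,\partial_k\ell]$, $L_{(ijkl)}=E[\partial_i\partial_j\partial_k\partial_l\ell]$, $L_{(ij)(kl)}=E[\partial_i\partial_j\ell\;\partial_k\partial_l\ell]$, $L_{(ijk)l}=E[\partial_i\partial_j\partial_k\ell\;\partial_l\ell]$, $L_{(ij)kl}=E[\partial_i\partial_j\ell\;\partial_k\ell\;\partial_l\ell]$; - $\tau_{i_1\dots i_t}=E_{\theta_*}[\partial_{i_1}\cdots\partial_{i_t}\ell]$. **Standing assumptions.** (1) Differentiation under the integral: $\int\partial_i g(x;\theta)d\mu=0$ and $\int\partial_i\partial_j g(x;\theta)d\mu=0$ for all $\theta\in\Theta$. (2) The divergence $D[g(x;\theta_* )\,|\,g(x;\hat\theta)]$ may be Taylor-expanded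 in $\hat\theta$ around $\theta_*$ and the expectation taken termwise: $$R[g(x;\theta_* )|g(x;\hat\theta)]=\tfrac12 g^*_{ij}E[(\hat\theta^i-\theta_*^i)(\hat\theta^j-\theta_*^j)]-\sum_{t\ge3}\tfrac1{t!}\tau_{i_1\dots i_t}E[(\hat\theta^{i_1}-\theta_*^{i_1})\cdots(\hat\theta^{i_t}-\theta_*^{i_t})].$$ (3) Moment condition. Put $\bar e_i(\theta)=\frac1n\sum_{a=1}^n\partial_i\log g(X_a;\theta)$, $\bar e_i=\bar e_i(\theta_* )$, and $\bar\theta^s=\hat\theta^s-\theta_*^s$, $\bar e^s=\tilde g^{sj}\bar e_j$, $A^s_j=\tilde g^{is}(\partial_j\bar e_i+\tilde g_{ij})$, $B^s_{jk}=\frac12\tilde g^{is}(\partial_j\partial_k\bar e_i-E[\partial_j\partial_k\bar e_i])$, $C^s_{jkl}=\frac16\tilde g^{is}(\partial_j\partial_k\partial_l\bar e_i-E[\partial_j\partial_k\partial_l\bar e_i])$ (all evaluated at $\theta_*$), and $D^s_{jklm}=\frac1{24}\sum_i\tilde g^{is}\,\partial_j\partial_k\partial_l\partial_m\bar e_i(\tilde\theta_{ijklm})$, where $\tilde\theta_{ijklm}$ is the point on the segment from $\theta_*$ to $\hat\theta$ appearing in the fourth-order Taylor remainder of $\bar e_i(\hat\theta)$ around $\theta_*$. The joint moments, of every order needed ("suitably high order"), of the variables $\sqrt n\,\bar\theta^s,\ \sqrt n\,\bar e^s,\ \sqrt n\,A^s_j,\ \sqrt n\,B^s_{jk},\ \sqrt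 n\,C^s_{jkl},\ D^s_{jklm}$ ($1\le j,k,l,m,s\le p$) are bounded in $n$.
   Formalization: Adds to the moment condition that √n(D − D₀) is bounded in mean square, D₀ being the population value of D at θ_* (without it an n^{-(5+ε)/2} term can occur); the termwise risk expansion is read as asymptotic, with truncation error of the order of the first omitted term. *)

theory Defs
  imports "HOL-Probability.Probability" "HOL-Library.Landau_Symbols"
begin

section \<open>Iterated partial derivatives\<close>

definition pderiv1 :: "'p \<Rightarrow> (real ^ 'p \<Rightarrow> real) \<Rightarrow> real ^ 'p \<Rightarrow> real" where
  "pderiv1 i h \<theta> = deriv (\<lambda>t. h (\<theta> + t *\<^sub>R axis i 1)) 0"

definition pderivs :: "'p list \<Rightarrow> (real ^ 'p \<Rightarrow> real) \<Rightarrow> real ^ 'p \<Rightarrow> real" where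
  "pderivs is h = foldr pderiv1 is h"

text \<open>All iterated partial derivatives are (Frechet) differentiable, i.e. the function is
  infinitely often differentiable on the open set \<open>S\<close>.\<close>

definition smooth_in :: "(real ^ 'p::finite) set \<Rightarrow> (real ^ 'p \<Rightarrow> real) \<Rightarrow> bool" where
  "smooth_in S h \<longleftrightarrow> (\<forall>is. \<forall>\<theta>\<in>S. pderivs is h differentiable (at \<theta>))"


section \<open>Model, divergence, information projection\<close>

definition prob_density :: "'x measure \<Rightarrow> ('x \<Rightarrow> real) \<Rightarrow> bool" where
  "prob_density \<mu> h \<longleftrightarrow> h \<in> borel_measurable \<mu> \<and> (\<forall>x\<in>space \<mu>. 0 \<le> h x)
     \<and> prob_space (density \<mu> (\<lambda>x. ennreal (h x)))"

text \<open>Positivity is what makes \<open>ln (f \<theta> x)\<close> meaningful; \<open>\<mu>\<close> is thought of as living on the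
  common support of the model.\<close>

definition smooth_model :: "'x measure \<Rightarrow> (real ^ 'p::finite) set \<Rightarrow> (real ^ 'p \<Rightarrow> 'x \<Rightarrow> real) \<Rightarrow> bool" where
  "smooth_model \<mu> \<Theta> f \<longleftrightarrow> open \<Theta>
     \<and> (\<forall>\<theta>\<in>\<Theta>. prob_density \<mu> (f \<theta>) \<and> (\<forall>x\<in>space \<mu>. 0 < f \<theta> x))
     \<and> (\<forall>x\<in>space \<mu>. smooth_in \<Theta> (\<lambda>\<theta>. f \<theta> x))"

definition diff_under_integral ::
  "'x measure \<Rightarrow> (real ^ 'p::finite) set \<Rightarrow> (real ^ 'p \<Rightarrow> 'x \<Rightarrow> real) \<Rightarrow> bool" where
  "diff_under_integral \<mu> \<Theta> f \<longleftrightarrow> (\<forall>\<theta>\<in>\<Theta>.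
      (\<forall>i. has_bochner_integral \<mu> (\<lambda>x. pderivs [i] (\<lambda>\<theta>. f \<theta> x) \<theta>) 0)
    \<and> (\<forall>i j. has_bochner_integral \<mu> (\<lambda>x. pderivs [i, j] (\<lambda>\<theta>. f \<theta> x) \<theta>) 0))"

text \<open>For probability densities with \<open>g\<^sub>2\<close> positive, the negative part of the integrand is
  integrable, so a non-integrable integrand means that the divergence is \<open>\<infinity>\<close>.\<close>

definition kl_div :: "'x measure \<Rightarrow> ('x \<Rightarrow> real) \<Rightarrow> ('x \<Rightarrow> real) \<Rightarrow> ereal" where
  "kl_div \<mu> g\<^sub>1 g\<^sub>2 =
     (if integrable \<mu> (\<lambda>x. g\<^sub>1 x * ln (g\<^sub>1 x / g\<^sub>2 x))
      then ereal (\<integral>x. g\<^sub>1 x * ln (g\<^sub>1 x / g\<^sub>2 x) \<partial>\<mu>) else \<infinity>)"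

text \<open>\<open>Lmom \<mu> h f \<theta> [I\<^sub>1, \<dots>, I\<^sub>r]\<close> is the expectation under the density \<open>h\<close> of the product
  of the log-likelihood derivatives \<open>\<partial>\<^bsub>I\<^sub>1\<^esub>\<ell> \<cdots> \<partial>\<^bsub>I\<^sub>r\<^esub>\<ell>\<close>; for instance
  \<open>[[i, j], [k]]\<close> gives \<open>L\<^bsub>(ij)k\<^esub>\<close> and \<open>[[i], [j], [k]]\<close> gives \<open>L\<^bsub>ijk\<^esub>\<close>.\<close>

definition Lmom :: "'x measure \<Rightarrow> ('x \<Rightarrow> real) \<Rightarrow> (real ^ 'p \<Rightarrow> 'x \<Rightarrow> real) \<Rightarrow> real ^ 'p
    \<Rightarrow> 'p list list \<Rightarrow> real" where
  "Lmom \<mu> h f \<theta> Is = (\<integral>x. h x * (\<Prod>I\<leftarrow>Is. pderivs I (\<lambda>\<theta>'. ln (f \<theta>' x)) \<theta>) \<partial>\<mu>)"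

definition Gmat :: "'x measure \<Rightarrow> ('x \<Rightarrow> real) \<Rightarrow> (real ^ 'p \<Rightarrow> 'x \<Rightarrow> real) \<Rightarrow> real ^ 'p
    \<Rightarrow> real ^ 'p ^ 'p" where
  "Gmat \<mu> h f \<theta> = (\<chi> i j. Lmom \<mu> h f \<theta> [[i], [j]])"

definition Gtilde :: "'x measure \<Rightarrow> ('x \<Rightarrow> real) \<Rightarrow> (real ^ 'p \<Rightarrow> 'x \<Rightarrow> real) \<Rightarrow> real ^ 'p
    \<Rightarrow> real ^ 'p ^ 'p" where
  "Gtilde \<mu> h f \<theta> = (\<chi> i j. - Lmom \<mu> h f \<theta> [[i, j]])"

abbreviation Gstar :: "'x measure \<Rightarrow> (real ^ 'p \<Rightarrow> 'x \<Rightarrow> real) \<Rightarrow> real ^ 'p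
    \<Rightarrow> real ^ 'p ^ 'p" where
  "Gstar \<mu> f \<theta> \<equiv> Gmat \<mu> (f \<theta>) f \<theta>"

definition information_projection :: "'x measure \<Rightarrow> ('x \<Rightarrow> real) \<Rightarrow> (real ^ 'p::finite) set
    \<Rightarrow> (real ^ 'p \<Rightarrow> 'x \<Rightarrow> real) \<Rightarrow> real ^ 'p \<Rightarrow> bool" where
  "information_projection \<mu> g \<Theta> f \<theta>s \<longleftrightarrow>
     is_arg_min (\<lambda>\<theta>. kl_div \<mu> g (f \<theta>)) (\<lambda>\<theta>. \<theta> \<in> \<Theta>) \<theta>s
   \<and> kl_div \<mu> g (f \<theta>s) < \<infinity>
   \<and> (\<forall>i. has_bochner_integral \<mu> (\<lambda>x. g x * pderivs [i] (\<lambda>\<theta>. ln (f \<theta> x)) \<theta>s) 0)"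


section \<open>Sample, maximum likelihood estimator, risk\<close>

text \<open>The sample of size \<open>n\<close> is \<open>X 0, \<dots>, X (n - 1)\<close>.\<close>

definition iid_sample :: "'w measure \<Rightarrow> 'x measure \<Rightarrow> ('x \<Rightarrow> real) \<Rightarrow> (nat \<Rightarrow> 'w \<Rightarrow> 'x) \<Rightarrow> bool" where
  "iid_sample P \<mu> g X \<longleftrightarrow> prob_space P
     \<and> prob_space.indep_vars P (\<lambda>_. \<mu>) X UNIV
     \<and> (\<forall>a. distributed P \<mu> (X a) (\<lambda>x. ennreal (g x)))"

text \<open>The estimator need only exist almost surely and for large samples.\<close>

definition is_mle :: "'w measure \<Rightarrow> (nat \<Rightarrow> 'w \<Rightarrow> 'x) \<Rightarrow> (real ^ 'p::finite) set
    \<Rightarrow> (real ^ 'p \<Rightarrow> 'x \<Rightarrow> real) \<Rightarrow> (nat \<Rightarrow> 'w \<Rightarrow> real ^ 'p) \<Rightarrow> bool" where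
  "is_mle P X \<Theta> f \<theta>hat \<longleftrightarrow>
     (\<forall>n. \<theta>hat n \<in> borel_measurable P)
   \<and> (\<forall>\<^sub>F n in sequentially. AE \<omega> in P.
        is_arg_max (\<lambda>\<theta>. \<Sum>a<n. ln (f \<theta> (X a \<omega>))) (\<lambda>\<theta>. \<theta> \<in> \<Theta>) (\<theta>hat n \<omega>)
      \<and> (\<forall>i. (\<Sum>a<n. pderivs [i] (\<lambda>\<theta>. ln (f \<theta> (X a \<omega>))) (\<theta>hat n \<omega>)) = 0))"

definition mle_risk :: "'w measure \<Rightarrow> 'x measure \<Rightarrow> (real ^ 'p \<Rightarrow> 'x \<Rightarrow> real) \<Rightarrow> real ^ 'p
    \<Rightarrow> (nat \<Rightarrow> 'w \<Rightarrow> real ^ 'p) \<Rightarrow> nat \<Rightarrow> real" where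
  "mle_risk P \<mu> f \<theta>s \<theta>hat n = (\<integral>\<omega>. real_of_ereal (kl_div \<mu> (f \<theta>s) (f (\<theta>hat n \<omega>))) \<partial>P)"

text \<open>The summand of degree \<open>t\<close> of the expanded risk, without its minus sign.\<close>

definition risk_term :: "'w measure \<Rightarrow> 'x measure \<Rightarrow> (real ^ 'p::finite \<Rightarrow> 'x \<Rightarrow> real) \<Rightarrow> real ^ 'p
    \<Rightarrow> (nat \<Rightarrow> 'w \<Rightarrow> real ^ 'p) \<Rightarrow> nat \<Rightarrow> nat \<Rightarrow> real" where
  "risk_term P \<mu> f \<theta>s \<theta>hat t n =
     1 / fact t * (\<Sum>is | length is = t. Lmom \<mu> (f \<theta>s) f \<theta>s [is] *
        (\<integral>\<omega>. (\<Prod>i\<leftarrow>is. \<theta>hat n \<omega> $ i - \<theta>s $ i) \<partial>P))"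

text \<open>Termwise Taylor expansion of the risk, read as an asymptotic expansion: since
  \<open>\<theta>hat n - \<theta>s\<close> is of order \<open>n\<^bsup>-1/2\<^esup>\<close>, the term of degree \<open>t\<close> is of order \<open>n\<^bsup>-t/2\<^esup>\<close>, and
  truncation after degree \<open>T\<close> leaves an error of the order of the first omitted term.
  Convergence of the full series for each fixed \<open>n\<close> is not demanded.\<close>

definition risk_expandable :: "'w measure \<Rightarrow> 'x measure \<Rightarrow> (real ^ 'p::finite \<Rightarrow> 'x \<Rightarrow> real) \<Rightarrow> real ^ 'p
    \<Rightarrow> (nat \<Rightarrow> 'w \<Rightarrow> real ^ 'p) \<Rightarrow> bool" where
  "risk_expandable P \<mu> f \<theta>s \<theta>hat \<longleftrightarrow>
     (\<forall>i j. integrable \<mu> (\<lambda>x. f \<theta>s x * (pderivs [i] (\<lambda>\<theta>. ln (f \<theta> x)) \<theta>s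
                                          * pderivs [j] (\<lambda>\<theta>. ln (f \<theta> x)) \<theta>s)))
   \<and> (\<forall>is. 2 \<le> length is \<longrightarrow> integrable \<mu> (\<lambda>x. f \<theta>s x * pderivs is (\<lambda>\<theta>. ln (f \<theta> x)) \<theta>s))
   \<and> (\<forall>\<^sub>F n in sequentially.
        (AE \<omega> in P. kl_div \<mu> (f \<theta>s) (f (\<theta>hat n \<omega>)) < \<infinity>)
      \<and> integrable P (\<lambda>\<omega>. real_of_ereal (kl_div \<mu> (f \<theta>s) (f (\<theta>hat n \<omega>)))))
   \<and> (\<forall>T\<ge>2. (\<lambda>n. mle_risk P \<mu> f \<theta>s \<theta>hat n
          - (1/2 * (\<Sum>(i,j)\<in>UNIV. Gstar \<mu> f \<theta>s $ i $ j *
                (\<integral>\<omega>. (\<theta>hat n \<omega> $ i - \<theta>s $ i) * (\<theta>hat n \<omega> $ j - \<theta>s $ j) \<partial>P))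
             - (\<Sum>t=3..T. risk_term P \<mu> f \<theta>s \<theta>hat t n)))
        \<in> O(\<lambda>n. real n powr (- (real T + 1) / 2)))"


section \<open>Taylor expansion of the likelihood equation and the moment condition\<close>

definition mean_score :: "(real ^ 'p \<Rightarrow> 'x \<Rightarrow> real) \<Rightarrow> (nat \<Rightarrow> 'w \<Rightarrow> 'x) \<Rightarrow> nat \<Rightarrow> 'w
    \<Rightarrow> 'p \<Rightarrow> real ^ 'p \<Rightarrow> real" where
  "mean_score f X n \<omega> i \<theta> = (\<Sum>a<n. pderivs [i] (\<lambda>\<theta>'. ln (f \<theta>' (X a \<omega>))) \<theta>) / real n"

text \<open>\<open>\<theta>til n \<omega> i j k l m\<close> are intermediate points in the fourth-order Taylor remainder
  of \<open>mean_score f X n \<omega> i\<close> around \<open>\<theta>s\<close>.\<close>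

definition taylor_points :: "'w measure \<Rightarrow> (nat \<Rightarrow> 'w \<Rightarrow> 'x) \<Rightarrow> (real ^ 'p::finite) set
    \<Rightarrow> (real ^ 'p \<Rightarrow> 'x \<Rightarrow> real) \<Rightarrow> real ^ 'p \<Rightarrow> (nat \<Rightarrow> 'w \<Rightarrow> real ^ 'p)
    \<Rightarrow> (nat \<Rightarrow> 'w \<Rightarrow> 'p \<Rightarrow> 'p \<Rightarrow> 'p \<Rightarrow> 'p \<Rightarrow> 'p \<Rightarrow> real ^ 'p) \<Rightarrow> bool" where
  "taylor_points P X \<Theta> f \<theta>s \<theta>hat \<theta>til \<longleftrightarrow>
     (\<forall>\<^sub>F n in sequentially. AE \<omega> in P. \<forall>i.
        (\<forall>j k l m. \<theta>til n \<omega> i j k l m \<in> closed_segment \<theta>s (\<theta>hat n \<omega>) \<inter> \<Theta>) \<and>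
        (let e = mean_score f X n \<omega> i; d = (\<lambda>j. \<theta>hat n \<omega> $ j - \<theta>s $ j) in
          e (\<theta>hat n \<omega>) = e \<theta>s
            + (\<Sum>j\<in>UNIV. pderivs [j] e \<theta>s * d j)
            + 1/2 * (\<Sum>(j,k)\<in>UNIV. pderivs [j,k] e \<theta>s * d j * d k)
            + 1/6 * (\<Sum>(j,k,l)\<in>UNIV. pderivs [j,k,l] e \<theta>s * d j * d k * d l)
            + 1/24 * (\<Sum>(j,k,l,m)\<in>UNIV.
                 pderivs [j,k,l,m] e (\<theta>til n \<omega> i j k l m) * d j * d k * d l * d m)))"

text \<open>Names of the scalar variables whose joint moments are controlled:
  \<open>\<surd>n \<theta>\<^sup>s\<close>, \<open>\<surd>n e\<^sup>s\<close>, \<open>\<surd>n A\<^sup>s\<^sub>j\<close>, \<open>\<surd>n B\<^sup>s\<^sub>j\<^sub>k\<close>, \<open>\<surd>n C\<^sup>s\<^sub>j\<^sub>k\<^sub>l\<close>, \<open>D\<^sup>s\<^sub>j\<^sub>k\<^sub>l\<^sub>m\<close> (upper index first).\<close>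

datatype 'p mvar = Theta_var 'p | E_var 'p | A_var 'p 'p | B_var 'p 'p 'p
  | C_var 'p 'p 'p 'p | D_var 'p 'p 'p 'p 'p

definition centred_score_deriv :: "'w measure \<Rightarrow> (nat \<Rightarrow> 'w \<Rightarrow> 'x) \<Rightarrow> (real ^ 'p \<Rightarrow> 'x \<Rightarrow> real)
    \<Rightarrow> real ^ 'p \<Rightarrow> nat \<Rightarrow> 'w \<Rightarrow> 'p list \<Rightarrow> 'p \<Rightarrow> real" where
  "centred_score_deriv P X f \<theta>s n \<omega> js i =
     pderivs js (mean_score f X n \<omega> i) \<theta>s - (\<integral>\<omega>'. pderivs js (mean_score f X n \<omega>' i) \<theta>s \<partial>P)"

text \<open>\<open>Gt\<close> is the matrix with entries \<open>g\<^sub>i\<^sub>j\<close> (tilde), and \<open>gi\<close> are the entries of its inverse.\<close>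

definition remainder_D :: "(nat \<Rightarrow> 'w \<Rightarrow> 'x) \<Rightarrow> (real ^ 'p::finite \<Rightarrow> 'x \<Rightarrow> real)
    \<Rightarrow> (nat \<Rightarrow> 'w \<Rightarrow> 'p \<Rightarrow> 'p \<Rightarrow> 'p \<Rightarrow> 'p \<Rightarrow> 'p \<Rightarrow> real ^ 'p) \<Rightarrow> real ^ 'p ^ 'p
    \<Rightarrow> nat \<Rightarrow> 'w \<Rightarrow> 'p \<Rightarrow> 'p \<Rightarrow> 'p \<Rightarrow> 'p \<Rightarrow> 'p \<Rightarrow> real" where
  "remainder_D X f \<theta>til Gt n \<omega> s j k l m = 1/24 * (\<Sum>i\<in>UNIV. matrix_inv Gt $ i $ s *
      pderivs [j,k,l,m] (mean_score f X n \<omega> i) (\<theta>til n \<omega> i j k l m))"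

fun mvar_val :: "'w measure \<Rightarrow> (nat \<Rightarrow> 'w \<Rightarrow> 'x) \<Rightarrow> (real ^ 'p::finite \<Rightarrow> 'x \<Rightarrow> real) \<Rightarrow> real ^ 'p
    \<Rightarrow> (nat \<Rightarrow> 'w \<Rightarrow> real ^ 'p) \<Rightarrow> (nat \<Rightarrow> 'w \<Rightarrow> 'p \<Rightarrow> 'p \<Rightarrow> 'p \<Rightarrow> 'p \<Rightarrow> 'p \<Rightarrow> real ^ 'p)
    \<Rightarrow> real ^ 'p ^ 'p \<Rightarrow> nat \<Rightarrow> 'w \<Rightarrow> 'p mvar \<Rightarrow> real" where
  "mvar_val P X f \<theta>s \<theta>hat \<theta>til Gt n \<omega> (Theta_var s) =
     sqrt (real n) * (\<theta>hat n \<omega> $ s - \<theta>s $ s)"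
| "mvar_val P X f \<theta>s \<theta>hat \<theta>til Gt n \<omega> (E_var s) =
     sqrt (real n) * (\<Sum>j\<in>UNIV. matrix_inv Gt $ s $ j * mean_score f X n \<omega> j \<theta>s)"
| "mvar_val P X f \<theta>s \<theta>hat \<theta>til Gt n \<omega> (A_var s j) =
     sqrt (real n) * (\<Sum>i\<in>UNIV. matrix_inv Gt $ i $ s *
        (pderivs [j] (mean_score f X n \<omega> i) \<theta>s + Gt $ i $ j))"
| "mvar_val P X f \<theta>s \<theta>hat \<theta>til Gt n \<omega> (B_var s j k) =
     sqrt (real n) * (1/2 * (\<Sum>i\<in>UNIV. matrix_inv Gt $ i $ s *
        centred_score_deriv P X f \<theta>s n \<omega> [j,k] i))"
| "mvar_val P X f \<theta>s \<theta>hat \<theta>til Gt n \<omega> (C_var s j k l) =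
     sqrt (real n) * (1/6 * (\<Sum>i\<in>UNIV. matrix_inv Gt $ i $ s *
        centred_score_deriv P X f \<theta>s n \<omega> [j,k,l] i))"
| "mvar_val P X f \<theta>s \<theta>hat \<theta>til Gt n \<omega> (D_var s j k l m) =
     remainder_D X f \<theta>til Gt n \<omega> s j k l m"

text \<open>Every joint moment (a list of variables, with repetitions, stands for a monomial)
  exists for large \<open>n\<close> and is bounded in \<open>n\<close>.\<close>

definition moments_bounded :: "'w measure \<Rightarrow> (nat \<Rightarrow> 'w \<Rightarrow> 'x) \<Rightarrow> (real ^ 'p::finite \<Rightarrow> 'x \<Rightarrow> real)
    \<Rightarrow> real ^ 'p \<Rightarrow> (nat \<Rightarrow> 'w \<Rightarrow> real ^ 'p)
    \<Rightarrow> (nat \<Rightarrow> 'w \<Rightarrow> 'p \<Rightarrow> 'p \<Rightarrow> 'p \<Rightarrow> 'p \<Rightarrow> 'p \<Rightarrow> real ^ 'p) \<Rightarrow> real ^ 'p ^ 'p \<Rightarrow> bool" where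
  "moments_bounded P X f \<theta>s \<theta>hat \<theta>til Gt \<longleftrightarrow>
     (\<forall>vs :: 'p mvar list. \<exists>K. \<forall>\<^sub>F n in sequentially.
        integrable P (\<lambda>\<omega>. \<Prod>v\<leftarrow>vs. mvar_val P X f \<theta>s \<theta>hat \<theta>til Gt n \<omega> v)
      \<and> \<bar>\<integral>\<omega>. (\<Prod>v\<leftarrow>vs. mvar_val P X f \<theta>s \<theta>hat \<theta>til Gt n \<omega> v) \<partial>P\<bar> \<le> K)"

text \<open>The remainder coefficients deviate from their population value at \<open>\<theta>s\<close> by
  \<open>O(n\<^bsup>-1/2\<^esup>)\<close> in mean square.  Bounded moments of the remainder coefficients alone control the
  contribution of the fourth-order remainder to the second moments of \<open>\<theta>hat n - \<theta>s\<close> only up to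
  \<open>O(n\<^bsup>-5/2\<^esup>)\<close>: they do not rule out a sign correlation of the remainder coefficient with the
  odd-degree product of score averages it is multiplied with.\<close>

definition remainder_stable :: "'w measure \<Rightarrow> 'x measure \<Rightarrow> ('x \<Rightarrow> real) \<Rightarrow> (nat \<Rightarrow> 'w \<Rightarrow> 'x)
    \<Rightarrow> (real ^ 'p::finite \<Rightarrow> 'x \<Rightarrow> real) \<Rightarrow> real ^ 'p
    \<Rightarrow> (nat \<Rightarrow> 'w \<Rightarrow> 'p \<Rightarrow> 'p \<Rightarrow> 'p \<Rightarrow> 'p \<Rightarrow> 'p \<Rightarrow> real ^ 'p) \<Rightarrow> real ^ 'p ^ 'p \<Rightarrow> bool" where
  "remainder_stable P \<mu> g X f \<theta>s \<theta>til Gt \<longleftrightarrow>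
     (\<forall>s j k l m. let D0 = 1/24 * (\<Sum>i\<in>UNIV. matrix_inv Gt $ i $ s * Lmom \<mu> g f \<theta>s [[j,k,l,m,i]]) in
        \<exists>K. \<forall>\<^sub>F n in sequentially.
          integrable P (\<lambda>\<omega>. (sqrt (real n) * (remainder_D X f \<theta>til Gt n \<omega> s j k l m - D0))\<^sup>2)
        \<and> (\<integral>\<omega>. (sqrt (real n) * (remainder_D X f \<theta>til Gt n \<omega> s j k l m - D0))\<^sup>2 \<partial>P) \<le> K)"


section \<open>The coefficients of order \<open>n\<^bsup>-2\<^esup>\<close>\<close>

text \<open>In this section \<open>L\<close> stands for \<open>Lmom \<mu> g f \<theta>s\<close>, and \<open>h i j\<close> for the entries of the
  inverse of \<open>Gtilde \<mu> g f \<theta>s\<close>.  The lower-index entries \<open>g\<^sub>i\<^sub>j\<close> and \<open>g\<^sub>i\<^sub>j\<close> (tilde) are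
  \<open>L [[i], [j]]\<close> and \<open>- L [[i, j]]\<close>.\<close>

definition second_moment_coef :: "('p::finite list list \<Rightarrow> real) \<Rightarrow> ('p \<Rightarrow> 'p \<Rightarrow> real) \<Rightarrow> 'p \<Rightarrow> 'p \<Rightarrow> real" where
  "second_moment_coef L h i j =
    (let g = (\<lambda>a b. L [[a],[b]]); gt = (\<lambda>a b. - L [[a,b]]) in
      (\<Sum>(s,t,l,m)\<in>UNIV. h s j * h i t * h l m * (L [[s,l],[t],[m]] + gt l s * g t m))
    + (\<Sum>(s,t,l,m)\<in>UNIV. h s i * h j t * h l m * (L [[s,l],[t],[m]] + gt l s * g t m))
    + 1/2 * (\<Sum>(k,l,m,s,t,u)\<in>UNIV. h u j * h i k * h l s * h m t * L [[k],[s],[t]] * L [[l,m,u]])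
    + 1/2 * (\<Sum>(k,l,m,s,t,u)\<in>UNIV. h u i * h j k * h l s * h m t * L [[k],[s],[t]] * L [[l,m,u]])
    + (\<Sum>(k,l,m,s,t,u)\<in>UNIV. h j k * h l u * h i s * h m t *
        (L [[k,l],[u,m]] * g s t - gt k l * gt u m * g s t
          + L [[k,l],[s]] * L [[u,m],[t]] + L [[k,l],[t]] * L [[u,m],[s]]))
    + (\<Sum>(k,l,m,s,t,u)\<in>UNIV. h i k * h l u * h j s * h m t *
        (L [[k,l],[u,m]] * g s t - gt k l * gt u m * g s t
          + L [[k,l],[s]] * L [[u,m],[t]] + L [[k,l],[t]] * L [[u,m],[s]]))
    + 1/2 * (\<Sum>(k,l,m,s,t,u,v,w)\<in>UNIV. h j k * h i t * h m u * h s v * h w l * L [[m,s,w]] *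
        (L [[l,k],[t]] * g u v + L [[l,k],[u]] * g t v + L [[l,k],[v]] * g t u))
    + 1/2 * (\<Sum>(k,l,m,s,t,u,v,w)\<in>UNIV. h i k * h j t * h m u * h s v * h w l * L [[m,s,w]] *
        (L [[l,k],[t]] * g u v + L [[l,k],[u]] * g t v + L [[l,k],[v]] * g t u))
    + 1/2 * (\<Sum>(l,m,s,t,u,v)\<in>UNIV. h j s * h i t * h l u * h m v *
        (L [[s,l,m],[t]] * g u v + L [[s,l,m],[u]] * g t v + L [[s,l,m],[v]] * g t u))
    + 1/2 * (\<Sum>(l,m,s,t,u,v)\<in>UNIV. h i s * h j t * h l u * h m v *
        (L [[s,l,m],[t]] * g u v + L [[s,l,m],[u]] * g t v + L [[s,l,m],[v]] * g t u))
    + (\<Sum>(k,l,m,s,t,u,v,w)\<in>UNIV. h m t * h i u * h l v * h s w * h k j * L [[l,m,k]] *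
        (L [[t,s],[u]] * g v w + L [[t,s],[v]] * g u w + L [[t,s],[w]] * g u v))
    + (\<Sum>(k,l,m,s,t,u,v,w)\<in>UNIV. h m t * h j u * h l v * h s w * h k i * L [[l,m,k]] *
        (L [[t,s],[u]] * g v w + L [[t,s],[v]] * g u w + L [[t,s],[w]] * g u v))
    + 1/2 * (\<Sum>(k,l,m,q,r,s,t,u,v,w)\<in>UNIV.
        h i k * h l u * h s v * h t w * h r j * h q m * L [[l,m,r]] * L [[s,t,q]] *
        (g k u * g v w + g k v * g u w + g k w * g u v))
    + 1/2 * (\<Sum>(k,l,m,q,r,s,t,u,v,w)\<in>UNIV.
        h j k * h l u * h s v * h t w * h r i * h q m * L [[l,m,r]] * L [[s,t,q]] *
        (g k u * g v w + g k v * g u w + g k w * g u v))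
    + 1/6 * (\<Sum>(k,l,m,s,t,u,v,w)\<in>UNIV. h i k * h l s * h m u * h t v * h w j * L [[l,m,t,w]] *
        (g k s * g u v + g k u * g s v + g k v * g s u))
    + 1/6 * (\<Sum>(k,l,m,s,t,u,v,w)\<in>UNIV. h j k * h l s * h m u * h t v * h w i * L [[l,m,t,w]] *
        (g k s * g u v + g k u * g s v + g k v * g s u))
    + (\<Sum>(k,l,m,s,t,u)\<in>UNIV. h i k * h j s * h l t * h m u *
        (L [[k,l],[s,m]] * g t u - gt k l * gt s m * g t u
          + L [[k,l],[t]] * L [[s,m],[u]] + L [[k,l],[u]] * L [[s,m],[t]]))
    + 1/2 * (\<Sum>(k,l,m,s,t,u,v,w)\<in>UNIV. h i k * h l u * h s v * h t w * h j m * L [[s,t,m]] *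
        (L [[k,l],[u]] * g v w + L [[k,l],[v]] * g u w + L [[k,l],[w]] * g u v))
    + 1/2 * (\<Sum>(k,l,m,s,t,u,v,w)\<in>UNIV. h j k * h l u * h s v * h t w * h i m * L [[s,t,m]] *
        (L [[k,l],[u]] * g v w + L [[k,l],[v]] * g u w + L [[k,l],[w]] * g u v))
    + 1/4 * (\<Sum>(k,l,m,q,r,s,t,u,v,w)\<in>UNIV.
        h l k * h m u * h s v * h t w * h i r * h j q * L [[l,m,r]] * L [[s,t,q]] *
        (g k u * g v w + g k v * g u w + g k w * g u v)))"

definition third_moment_coef :: "('p::finite list list \<Rightarrow> real) \<Rightarrow> ('p \<Rightarrow> 'p \<Rightarrow> real)
    \<Rightarrow> 'p \<Rightarrow> 'p \<Rightarrow> 'p \<Rightarrow> real" where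
  "third_moment_coef L h i j k =
    (let g = (\<lambda>a b. L [[a],[b]]) in
      (\<Sum>(s,t,u)\<in>UNIV. h i s * h j t * h k u * L [[s],[t],[u]])
    + (\<Sum>(s,t,u,v,w)\<in>UNIV. h i t * h s u * h j v * h k w *
        (L [[s,t],[u]] * g v w + L [[s,t],[v]] * g u w + L [[s,t],[w]] * g u v))
    + (\<Sum>(s,t,u,v,w)\<in>UNIV. h j t * h s u * h i v * h k w *
        (L [[s,t],[u]] * g v w + L [[s,t],[v]] * g u w + L [[s,t],[w]] * g u v))
    + (\<Sum>(s,t,u,v,w)\<in>UNIV. h k t * h s u * h i v * h j w *
        (L [[s,t],[u]] * g v w + L [[s,t],[v]] * g u w + L [[s,t],[w]] * g u v))
    + 1/2 * (\<Sum>(l,m,s,t,u,v,w)\<in>UNIV. h s u * h t v * h j w * h k m * h i l * L [[s,t,l]] *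
        (g u v * g w m + g u w * g v m + g u m * g v w))
    + 1/2 * (\<Sum>(l,m,s,t,u,v,w)\<in>UNIV. h s u * h t v * h i w * h k m * h j l * L [[s,t,l]] *
        (g u v * g w m + g u w * g v m + g u m * g v w))
    + 1/2 * (\<Sum>(l,m,s,t,u,v,w)\<in>UNIV. h s u * h t v * h i w * h j m * h k l * L [[s,t,l]] *
        (g u v * g w m + g u w * g v m + g u m * g v w)))"

definition fourth_moment_coef :: "('p::finite list list \<Rightarrow> real) \<Rightarrow> ('p \<Rightarrow> 'p \<Rightarrow> real)
    \<Rightarrow> 'p \<Rightarrow> 'p \<Rightarrow> 'p \<Rightarrow> 'p \<Rightarrow> real" where
  "fourth_moment_coef L h i j k l =
    (let g = (\<lambda>a b. L [[a],[b]]) in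
      (\<Sum>(s,t,u,v)\<in>UNIV. h i s * h j t * h k u * h l v *
        (g s t * g u v + g s u * g t v + g s v * g t u)))"

end

theory Submission
  imports Defs
begin

text \<open>Let \<open>d\<close> be the estimation error of the maximum likelihood estimator.  Contracting the Taylor
  expansion of the likelihood equation with the inverse of \<open>Gt\<close> turns it into a fixed point equation
  \<open>d = e + A d + (B + B0) d d + (C + C0) d d d + D d d d d\<close> (lemma \<open>likelihood_equation\<close>).
  Here \<open>e, A, B, C\<close> are averages of \<open>n\<close> independent centred variables, hence of order
  \<open>n\<^bsup>-1/2\<^esup>\<close> in every \<open>L\<^sup>q\<close> (lemma \<open>moment_order_avg\<close>), while \<open>B0, C0\<close> are constants.
  Substituting the equation into itself gives \<open>d = e + d2 + d3 + d4 + \<dots>\<close>, where \<open>dk\<close> is a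
  homogeneous polynomial of degree \<open>k\<close> in the averages, up to an error of order \<open>n\<^bsup>-5/2\<^esup>\<close>.
  The coefficient \<open>D\<close>, taken at an intermediate point, is the only one that is not an average.  It
  is replaced by a constant \<open>D0\<close> at the expense of an error of order \<open>n\<^bsup>-1/2\<^esup>\<close> in \<open>L\<^sup>2\<close>; this
  is enough because all its cofactors have moments of every order (lemma \<open>mean_order_mult\<close>).

  A centred observation that occurs only once in a product has mean zero.  The mean of a product of
  \<open>k\<close> averages is therefore governed by the ways to group the factors into blocks of at least two
  (lemma \<open>total_moment_bound\<close>): it is exactly of the form \<open>c/n\<close> for \<open>k = 2\<close> and \<open>c/n\<^sup>2\<close> for
  \<open>k = 3\<close>, it is \<open>n\<^sup>-\<^sup>2\<close> times the sum over the three pairings of the factors up to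
  \<open>O(n\<^sup>-\<^sup>3)\<close> for \<open>k = 4\<close>, and it is \<open>O(n\<^sup>-\<^sup>3)\<close> for \<open>k = 5\<close>.  So only the parts of
  total degree at most four matter in the moments of \<open>d\<close>, and writing out their pairings in terms of
  the joint moments of the derivatives of the log-likelihood yields the coefficients of order
  \<open>n\<^sup>-\<^sup>2\<close> (lemma \<open>moments_of_estimation_error\<close>).  Inserted into the expansion of the risk up to
  degree five, these moments give the theorem.

  Two technical points carry the rest.  The moment hypothesis concerns contracted sample averages; the
  difference of two consecutive sums isolates one observation, which shows that the derivatives of
  the log-likelihood themselves have all moments (lemmas \<open>all_moments_if_sums\<close> and
  \<open>all_moments_from_contractions\<close>).  And the order of the indices in a partial derivative is
  immaterial, which is needed to match the terms of the expansion (lemma \<open>pderivs_perm\<close>).\<close>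

section \<open>Partial derivatives of smooth functions\<close>

lemma pderivs_Nil [simp]: "pderivs [] h = h"
  and pderivs_Cons: "pderivs (i # is) h = pderiv1 i (pderivs is h)"
  and pderivs_append: "pderivs (is @ js) h = pderivs is (pderivs js h)"
  by (simp_all add: pderivs_def)

lemma pderiv1_has_derivative:
  assumes "(h has_derivative h') (at \<theta>)"
  shows "((\<lambda>t. h (\<theta> + t *\<^sub>R axis i 1)) has_real_derivative h' (axis i 1)) (at 0)"
    and "pderiv1 i h \<theta> = h' (axis i 1)"
proof -
  have "((\<lambda>t. \<theta> + t *\<^sub>R axis i 1) has_derivative (\<lambda>t. t *\<^sub>R axis i 1)) (at (0::real))"
    by (auto intro!: derivative_eq_intros)
  from diff_chain_at[OF this] assms
  have "((\<lambda>t. h (\<theta> + t *\<^sub>R axis i 1)) has_derivative (\<lambda>t. h' (t *\<^sub>R axis i 1))) (at 0)"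
    by (simp add: o_def)
  moreover have "(\<lambda>t. h' (t *\<^sub>R axis i 1)) = (*) (h' (axis i 1))"
    using linear_scale[OF has_derivative_linear[OF assms]] by (auto simp: fun_eq_iff)
  ultimately show D: "((\<lambda>t. h (\<theta> + t *\<^sub>R axis i 1)) has_real_derivative h' (axis i 1)) (at 0)"
    by (simp add: has_field_derivative_def)
  then show "pderiv1 i h \<theta> = h' (axis i 1)"
    unfolding pderiv1_def by (rule DERIV_imp_deriv)
qed

lemma differentiable_imp_partial:
  assumes "h differentiable (at (\<theta> + s *\<^sub>R axis i 1))"
  shows "((\<lambda>t. h (\<theta> + t *\<^sub>R axis i 1)) has_real_derivative pderiv1 i h (\<theta> + s *\<^sub>R axis i 1)) (at s)"
proof -
  obtain h' where h': "(h has_derivative h') (at (\<theta> + s *\<^sub>R axis i 1))"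
    using assms unfolding differentiable_def by blast
  have "((\<lambda>t. h (\<theta> + s *\<^sub>R axis i 1 + t *\<^sub>R axis i 1)) has_real_derivative
      pderiv1 i h (\<theta> + s *\<^sub>R axis i 1)) (at 0)"
    using pderiv1_has_derivative[OF h'] by simp
  then have "((\<lambda>t. h (\<theta> + (t + s) *\<^sub>R axis i 1)) has_real_derivative
      pderiv1 i h (\<theta> + s *\<^sub>R axis i 1)) (at 0)"
    by (simp add: algebra_simps)
  then show ?thesis
    using DERIV_shift[of "\<lambda>t. h (\<theta> + t *\<^sub>R axis i 1)" _ 0 s] by simp
qed

lemma pderiv1_cong:
  assumes "open S" "\<theta> \<in> S" "\<And>\<eta>. \<eta> \<in> S \<Longrightarrow> h \<eta> = k \<eta>"
  shows "pderiv1 i h \<theta> = pderiv1 i k \<theta>"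
proof -
  have "((\<lambda>t. \<theta> + t *\<^sub>R axis i 1) \<longlongrightarrow> \<theta> + 0 *\<^sub>R axis i 1) (nhds (0::real))"
    by (intro tendsto_intros) (simp_all add: filterlim_ident)
  then have "\<forall>\<^sub>F t in nhds 0. \<theta> + t *\<^sub>R axis i 1 \<in> S"
    using topological_tendstoD[OF _ assms(1)] assms(2) by simp
  then have "\<forall>\<^sub>F t in nhds 0. h (\<theta> + t *\<^sub>R axis i 1) = k (\<theta> + t *\<^sub>R axis i 1)"
    by eventually_elim (rule assms(3))
  then show ?thesis unfolding pderiv1_def by (rule deriv_cong_ev) simp
qed

lemma pderivs_cong:
  assumes "open S" "\<And>\<eta>. \<eta> \<in> S \<Longrightarrow> h \<eta> = k \<eta>" "\<theta> \<in> S"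
  shows "pderivs is h \<theta> = pderivs is k \<theta>"
  using assms(3)
proof (induction "is" arbitrary: \<theta>)
  case (Cons i "is")
  show ?case unfolding pderivs_Cons by (rule pderiv1_cong[OF assms(1) Cons.prems Cons.IH])
qed (simp add: assms)

text \<open>Smoothness is proved order by order, since the derivative of a product or a reciprocal
  is built from the functions themselves and their derivatives of lower order.\<close>

definition diff_upto :: "nat \<Rightarrow> (real ^ 'p::finite) set \<Rightarrow> (real ^ 'p \<Rightarrow> real) \<Rightarrow> bool" where
  "diff_upto k S h \<longleftrightarrow> (\<forall>is. length is \<le> k \<longrightarrow> (\<forall>\<theta>\<in>S. pderivs is h differentiable (at \<theta>)))"

lemma smooth_in_iff_diff_upto: "smooth_in S h \<longleftrightarrow> (\<forall>k. diff_upto k S h)"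
  unfolding smooth_in_def diff_upto_def by blast

lemma diff_upto_0: "diff_upto 0 S h \<longleftrightarrow> (\<forall>\<theta>\<in>S. h differentiable (at \<theta>))"
  by (simp add: diff_upto_def)

lemma diff_upto_Suc:
  "diff_upto (Suc k) S h \<longleftrightarrow> (\<forall>\<theta>\<in>S. h differentiable (at \<theta>)) \<and> (\<forall>i. diff_upto k S (pderiv1 i h))"
proof (intro iffI conjI)
  assume *: "diff_upto (Suc k) S h"
  from *[unfolded diff_upto_def, rule_format, of "[]"] show "\<forall>\<theta>\<in>S. h differentiable (at \<theta>)" by simp
  show "\<forall>i. diff_upto k S (pderiv1 i h)"
    unfolding diff_upto_def
  proof (intro allI impI)
    fix i and js :: "'a list" assume "length js \<le> k"
    then show "\<forall>\<theta>\<in>S. pderivs js (pderiv1 i h) differentiable (at \<theta>)"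
      using *[unfolded diff_upto_def, rule_format, of "js @ [i]"]
      by (simp add: pderivs_append pderivs_Cons)
  qed
next
  assume *: "(\<forall>\<theta>\<in>S. h differentiable (at \<theta>)) \<and> (\<forall>i. diff_upto k S (pderiv1 i h))"
  show "diff_upto (Suc k) S h"
    unfolding diff_upto_def
  proof (intro allI impI)
    fix js :: "'a list" assume "length js \<le> Suc k"
    then show "\<forall>\<theta>\<in>S. pderivs js h differentiable (at \<theta>)"
      using * by (cases js rule: rev_cases) (auto simp: pderivs_append pderivs_Cons diff_upto_def)
  qed
qed

lemma diff_upto_mono: "diff_upto k S h \<Longrightarrow> j \<le> k \<Longrightarrow> diff_upto j S h"
  unfolding diff_upto_def using le_trans by blast

lemma differentiable_cong_open:
  assumes "open S" "\<theta> \<in> S" "\<And>\<eta>. \<eta> \<in> S \<Longrightarrow> h \<eta> = k \<eta>" "k differentiable (at \<theta>)"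
  shows "h differentiable (at \<theta>)"
proof -
  obtain k' where "(k has_derivative k') (at \<theta>)" using assms(4) unfolding differentiable_def by blast
  then have "(h has_derivative k') (at \<theta>)"
    by (rule has_derivative_transform_within_open[OF _ assms(1,2)]) (simp add: assms(3))
  then show ?thesis unfolding differentiable_def by blast
qed

lemma diff_upto_cong:
  assumes "open S" "\<And>\<eta>. \<eta> \<in> S \<Longrightarrow> h \<eta> = k \<eta>" "diff_upto n S k"
  shows "diff_upto n S h"
  unfolding diff_upto_def
proof (intro allI impI ballI)
  fix js :: "'a list" and \<theta> assume *: "length js \<le> n" "\<theta> \<in> S"
  have "pderivs js k differentiable (at \<theta>)"
    using assms(3) * unfolding diff_upto_def by blast
  then show "pderivs js h differentiable (at \<theta>)"
    by (intro differentiable_cong_open[OF assms(1) *(2) pderivs_cong[OF assms(1,2)]])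
qed

lemma
  assumes "u differentiable (at \<theta>)" "v differentiable (at \<theta>)"
  shows pderiv1_add: "pderiv1 i (\<lambda>\<eta>. u \<eta> + v \<eta>) \<theta> = pderiv1 i u \<theta> + pderiv1 i v \<theta>"
    and pderiv1_mult: "pderiv1 i (\<lambda>\<eta>. u \<eta> * v \<eta>) \<theta> = u \<theta> * pderiv1 i v \<theta> + pderiv1 i u \<theta> * v \<theta>"
proof -
  obtain u' v' where *: "(u has_derivative u') (at \<theta>)" "(v has_derivative v') (at \<theta>)"
    using assms unfolding differentiable_def by blast
  show "pderiv1 i (\<lambda>\<eta>. u \<eta> + v \<eta>) \<theta> = pderiv1 i u \<theta> + pderiv1 i v \<theta>"
    unfolding pderiv1_has_derivative(2)[OF has_derivative_add[OF *]]
      pderiv1_has_derivative(2)[OF *(1)] pderiv1_has_derivative(2)[OF *(2)] by (rule refl)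
  show "pderiv1 i (\<lambda>\<eta>. u \<eta> * v \<eta>) \<theta> = u \<theta> * pderiv1 i v \<theta> + pderiv1 i u \<theta> * v \<theta>"
    unfolding pderiv1_has_derivative(2)[OF has_derivative_mult[OF *]]
      pderiv1_has_derivative(2)[OF *(1)] pderiv1_has_derivative(2)[OF *(2)] by (rule refl)
qed

lemma pderiv1_cmult:
  assumes "u differentiable (at \<theta>)"
  shows "pderiv1 i (\<lambda>\<eta>. c * u \<eta>) \<theta> = c * pderiv1 i u \<theta>"
proof -
  obtain u' where *: "(u has_derivative u') (at \<theta>)" using assms unfolding differentiable_def by blast
  show ?thesis
    unfolding pderiv1_has_derivative(2)[OF has_derivative_mult_right[OF *]]
      pderiv1_has_derivative(2)[OF *(1)] by (rule refl)
qed

lemma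
  assumes "u differentiable (at \<theta>)" "0 < u \<theta>"
  shows pderiv1_inverse: "pderiv1 i (\<lambda>\<eta>. inverse (u \<eta>)) \<theta> = - 1 * (pderiv1 i u \<theta> * (inverse (u \<theta>) * inverse (u \<theta>)))"
    and pderiv1_ln: "pderiv1 i (\<lambda>\<eta>. ln (u \<eta>)) \<theta> = pderiv1 i u \<theta> * inverse (u \<theta>)"
    and differentiable_ln_comp: "(\<lambda>\<eta>. ln (u \<eta>)) differentiable (at \<theta>)"
proof -
  obtain u' where *: "(u has_derivative u') (at \<theta>)" using assms unfolding differentiable_def by blast
  show "pderiv1 i (\<lambda>\<eta>. inverse (u \<eta>)) \<theta> = - 1 * (pderiv1 i u \<theta> * (inverse (u \<theta>) * inverse (u \<theta>)))"
    using pderiv1_has_derivative(2)[OF Deriv.has_derivative_inverse[OF _ *], of i]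
      pderiv1_has_derivative(2)[OF *(1), of i] assms(2) by simp
  have "((\<lambda>\<eta>. ln (u \<eta>)) has_derivative (\<lambda>x. u' x * inverse (u \<theta>))) (at \<theta>)"
    using has_derivative_ln[OF assms(2) *] by simp
  from this pderiv1_has_derivative(2)[OF this, of i] pderiv1_has_derivative(2)[OF *, of i]
  show "(\<lambda>\<eta>. ln (u \<eta>)) differentiable (at \<theta>)"
    and "pderiv1 i (\<lambda>\<eta>. ln (u \<eta>)) \<theta> = pderiv1 i u \<theta> * inverse (u \<theta>)"
    unfolding differentiable_def by (blast, simp)
qed

lemma diff_upto_add:
  assumes "open S" "diff_upto k S u" "diff_upto k S v"
  shows "diff_upto k S (\<lambda>\<eta>. u \<eta> + v \<eta>)"
  using assms(2,3)
proof (induction k arbitrary: u v)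
  case (Suc k)
  then have "diff_upto k S (\<lambda>\<eta>. pderiv1 i u \<eta> + pderiv1 i v \<eta>)" for i
    by (auto simp: diff_upto_Suc)
  then have "diff_upto k S (pderiv1 i (\<lambda>\<eta>. u \<eta> + v \<eta>))" for i
    using Suc.prems by (intro diff_upto_cong[OF assms(1) pderiv1_add]) (auto simp: diff_upto_Suc)
  then show ?case using Suc.prems by (auto simp: diff_upto_Suc)
qed (auto simp: diff_upto_0)

lemma diff_upto_mult:
  assumes "open S" "diff_upto k S u" "diff_upto k S v"
  shows "diff_upto k S (\<lambda>\<eta>. u \<eta> * v \<eta>)"
  using assms(2,3)
proof (induction k arbitrary: u v)
  case (Suc k)
  then have "diff_upto k S (\<lambda>\<eta>. u \<eta> * pderiv1 i v \<eta> + pderiv1 i u \<eta> * v \<eta>)" for i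
    using diff_upto_mono[of "Suc k" S _ k]
    by (intro diff_upto_add[OF assms(1)] Suc.IH) (auto simp: diff_upto_Suc)
  then have "diff_upto k S (pderiv1 i (\<lambda>\<eta>. u \<eta> * v \<eta>))" for i
    using Suc.prems by (intro diff_upto_cong[OF assms(1) pderiv1_mult]) (auto simp: diff_upto_Suc)
  then show ?case using Suc.prems by (auto simp: diff_upto_Suc)
qed (auto simp: diff_upto_0)

lemma diff_upto_const: "diff_upto k S (\<lambda>_. c)"
proof -
  have "pderiv1 i (\<lambda>_. c) = (\<lambda>_. 0)" for i :: 'a and c :: real
    by (simp add: pderiv1_def fun_eq_iff)
  then show ?thesis by (induction k arbitrary: c) (simp_all add: diff_upto_0 diff_upto_Suc)
qed

lemma diff_upto_inverse:
  assumes "open S" "diff_upto k S u" "\<And>\<theta>. \<theta> \<in> S \<Longrightarrow> 0 < u \<theta>"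
  shows "diff_upto k S (\<lambda>\<eta>. inverse (u \<eta>))"
  using assms(2)
proof (induction k)
  case 0
  then show ?case using assms(3) by (force simp: diff_upto_0 intro!: differentiable_inverse)
next
  case (Suc k)
  then have "diff_upto k S (\<lambda>\<eta>. inverse (u \<eta>))"
    using diff_upto_mono[of "Suc k" S _ k] by auto
  then have "diff_upto k S (\<lambda>\<eta>. - 1 * (pderiv1 i u \<eta> * (inverse (u \<eta>) * inverse (u \<eta>))))" for i
    using Suc.prems by (intro diff_upto_mult[OF assms(1)] diff_upto_const) (auto simp: diff_upto_Suc)
  then have "diff_upto k S (pderiv1 i (\<lambda>\<eta>. inverse (u \<eta>)))" for i
    using Suc.prems assms(3)
    by (intro diff_upto_cong[OF assms(1) pderiv1_inverse]) (auto simp: diff_upto_Suc)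
  then show ?case
    using Suc.prems assms(3) by (force simp: diff_upto_Suc intro!: differentiable_inverse)
qed

lemma smooth_in_ln:
  assumes "open S" "smooth_in S u" "\<And>\<theta>. \<theta> \<in> S \<Longrightarrow> 0 < u \<theta>"
  shows "smooth_in S (\<lambda>\<eta>. ln (u \<eta>))"
  unfolding smooth_in_iff_diff_upto
proof
  fix k
  have u: "diff_upto j S u" for j using assms(2) by (simp add: smooth_in_iff_diff_upto)
  have d: "u differentiable (at \<theta>)" if "\<theta> \<in> S" for \<theta> using u[of 0] that by (simp add: diff_upto_0)
  have "diff_upto k S (\<lambda>\<eta>. pderiv1 i u \<eta> * inverse (u \<eta>))" for i
    using u[of "Suc k"] u[of k]
    by (intro diff_upto_mult diff_upto_inverse assms) (auto simp: diff_upto_Suc)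
  then have "diff_upto k S (pderiv1 i (\<lambda>\<eta>. ln (u \<eta>)))" for i
    using d assms(3) by (intro diff_upto_cong[OF assms(1) pderiv1_ln]) auto
  then have "diff_upto (Suc k) S (\<lambda>\<eta>. ln (u \<eta>))"
    using d assms(3) by (auto simp: diff_upto_Suc intro!: differentiable_ln_comp)
  then show "diff_upto k S (\<lambda>\<eta>. ln (u \<eta>))" by (rule diff_upto_mono) simp
qed

lemma smooth_in_pderivs: "smooth_in S h \<Longrightarrow> smooth_in S (pderivs is h)"
  by (auto simp: smooth_in_def simp flip: pderivs_append)

lemma smooth_in_differentiable: "smooth_in S h \<Longrightarrow> \<theta> \<in> S \<Longrightarrow> pderivs is h differentiable (at \<theta>)"
  by (auto simp: smooth_in_def)

lemma pderivs_linear_comb: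
  assumes "open S" "finite A" "\<And>a. a \<in> A \<Longrightarrow> smooth_in S (h a)" "\<theta> \<in> S"
  shows "pderivs is (\<lambda>\<eta>. c * (\<Sum>a\<in>A. h a \<eta>)) \<theta> = c * (\<Sum>a\<in>A. pderivs is (h a) \<theta>)"
  using assms(4)
proof (induction "is" arbitrary: \<theta>)
  case (Cons i js)
  have d: "pderivs js (h a) differentiable (at \<theta>)" if "a \<in> A" for a
    using smooth_in_differentiable[OF assms(3)] that Cons.prems by blast
  have s: "(\<lambda>\<eta>. \<Sum>a\<in>B. pderivs js (h a) \<eta>) differentiable (at \<theta>) \<and>
      pderiv1 i (\<lambda>\<eta>. \<Sum>a\<in>B. pderivs js (h a) \<eta>) \<theta> = (\<Sum>a\<in>B. pderiv1 i (pderivs js (h a)) \<theta>)"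
    if "B \<subseteq> A" for B
    using finite_subset[OF that assms(2)] that
  proof (induction B)
    case empty
    then show ?case by (simp add: pderiv1_def)
  next
    case (insert b B)
    then show ?case using d[of b] by (simp add: pderiv1_add)
  qed
  have "pderivs (i # js) (\<lambda>\<eta>. c * (\<Sum>a\<in>A. h a \<eta>)) \<theta> =
      pderiv1 i (\<lambda>\<eta>. c * (\<Sum>a\<in>A. pderivs js (h a) \<eta>)) \<theta>"
    unfolding pderivs_Cons by (rule pderiv1_cong[OF assms(1) Cons.prems Cons.IH])
  also have "\<dots> = c * (\<Sum>a\<in>A. pderivs (i # js) (h a) \<theta>)"
    using s[of A] by (simp add: pderiv1_cmult pderivs_Cons)
  finally show ?case .
qed simp

text \<open>Mixed partial derivatives commute: two applications of the mean value theorem write the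
  second difference of \<open>h\<close> over a square of side \<open>r\<close> as \<open>r\<^sup>2\<close> times a mixed derivative
  at a point of the square, in whichever order the two directions are treated.\<close>

lemma second_difference:
  fixes \<theta> :: "real ^ 'p::finite"
  assumes "smooth_in S h" "0 < r"
    and S: "\<And>s t. 0 \<le> s \<Longrightarrow> s \<le> r \<Longrightarrow> 0 \<le> t \<Longrightarrow> t \<le> r \<Longrightarrow> \<theta> + s *\<^sub>R axis i 1 + t *\<^sub>R axis j 1 \<in> S"
  shows "\<exists>s t. 0 < s \<and> s < r \<and> 0 < t \<and> t < r \<and>
    h (\<theta> + r *\<^sub>R axis i 1 + r *\<^sub>R axis j 1) - h (\<theta> + r *\<^sub>R axis i 1) - h (\<theta> + r *\<^sub>R axis j 1) + h \<theta>
      = r\<^sup>2 * pderivs [j, i] h (\<theta> + s *\<^sub>R axis i 1 + t *\<^sub>R axis j 1)"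
proof -
  define \<phi> where "\<phi> s = h ((\<theta> + r *\<^sub>R axis j 1) + s *\<^sub>R axis i 1) - h (\<theta> + s *\<^sub>R axis i 1)" for s
  have d: "pderivs is h differentiable (at (\<theta> + s *\<^sub>R axis i 1 + t *\<^sub>R axis j 1))"
    if "0 \<le> s" "s \<le> r" "0 \<le> t" "t \<le> r" for "is" s t
    using assms(1) S[OF that] by (auto simp: smooth_in_def)
  have d1: "(\<phi> has_real_derivative pderivs [i] h (\<theta> + s *\<^sub>R axis i 1 + r *\<^sub>R axis j 1)
      - pderivs [i] h (\<theta> + s *\<^sub>R axis i 1)) (at s)" if "0 \<le> s" "s \<le> r" for s
    using differentiable_imp_partial[of h "\<theta> + r *\<^sub>R axis j 1" s i]
      differentiable_imp_partial[of h "\<theta>" s i] d[of s r "[]"] d[of s 0 "[]"] that assms(2)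
    unfolding \<phi>_def by (intro DERIV_diff) (auto simp: pderivs_Cons algebra_simps)
  obtain s where s: "0 < s" "s < r" and "\<phi> r - \<phi> 0 = (r - 0) *
     (pderivs [i] h (\<theta> + s *\<^sub>R axis i 1 + r *\<^sub>R axis j 1) - pderivs [i] h (\<theta> + s *\<^sub>R axis i 1))"
    using MVT2[OF assms(2) d1] by blast
  moreover have "((\<lambda>t. pderivs [i] h (\<theta> + s *\<^sub>R axis i 1 + t *\<^sub>R axis j 1)) has_real_derivative
      pderivs [j, i] h (\<theta> + s *\<^sub>R axis i 1 + t *\<^sub>R axis j 1)) (at t)" if "0 \<le> t" "t \<le> r" for t
    using differentiable_imp_partial[of "pderivs [i] h" "\<theta> + s *\<^sub>R axis i 1" t j] d[of s t "[i]"] that s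
    by (simp add: pderivs_Cons)
  from MVT2[OF assms(2) this] obtain t where t: "0 < t" "t < r"
    and "pderivs [i] h (\<theta> + s *\<^sub>R axis i 1 + r *\<^sub>R axis j 1) - pderivs [i] h (\<theta> + s *\<^sub>R axis i 1)
      = r * pderivs [j, i] h (\<theta> + s *\<^sub>R axis i 1 + t *\<^sub>R axis j 1)" by auto
  ultimately show ?thesis
    by (intro exI[of _ s] exI[of _ t]) (auto simp: \<phi>_def power2_eq_square algebra_simps)
qed

text \<open>The second difference does not depend on the order of the two directions, so the two mixed
  derivatives agree at points arbitrarily close to \<open>\<theta>\<close>, and they are continuous.\<close>

lemma pderivs_commute:
  fixes \<theta> :: "real ^ 'p::finite"
  assumes "open S" "smooth_in S h" "\<theta> \<in> S"
  shows "pderivs [i, j] h \<theta> = pderivs [j, i] h \<theta>"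
proof (rule ccontr)
  assume ne: "pderivs [i, j] h \<theta> \<noteq> pderivs [j, i] h \<theta>"
  define \<epsilon> where "\<epsilon> = dist (pderivs [i, j] h \<theta>) (pderivs [j, i] h \<theta>)"
  have \<epsilon>: "0 < \<epsilon> / 2" using ne by (simp add: \<epsilon>_def)
  have cont: "isCont (pderivs is h) \<theta>" for "is"
    by (rule differentiable_imp_continuous_within[OF smooth_in_differentiable[OF assms(2,3)]])
  obtain \<delta>1 where \<delta>1: "0 < \<delta>1" "\<And>\<eta>. dist \<eta> \<theta> < \<delta>1 \<Longrightarrow> dist (pderivs [i, j] h \<eta>) (pderivs [i, j] h \<theta>) < \<epsilon>/2"
    using cont[of "[i, j]"] \<epsilon> unfolding continuous_at_eps_delta by blast
  obtain \<delta>2 where \<delta>2: "0 < \<delta>2" "\<And>\<eta>. dist \<eta> \<theta> < \<delta>2 \<Longrightarrow> dist (pderivs [j, i] h \<eta>) (pderivs [j, i] h \<theta>) < \<epsilon>/2"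
    using cont[of "[j, i]"] \<epsilon> unfolding continuous_at_eps_delta by blast
  obtain \<delta>3 where \<delta>3: "0 < \<delta>3" "ball \<theta> \<delta>3 \<subseteq> S" using assms(1,3) openE by blast
  define \<delta> where "\<delta> = min \<delta>1 (min \<delta>2 \<delta>3)"
  \<comment> \<open>A square of side \<open>\<delta>/3\<close> at \<open>\<theta>\<close> lies within distance \<open>\<delta>\<close> of \<open>\<theta>\<close>.\<close>
  define r where "r = \<delta> / 3"
  have r: "0 < r" using \<delta>1 \<delta>2 \<delta>3 by (simp add: r_def \<delta>_def)
  have near: "dist (\<theta> + s *\<^sub>R axis k 1 + t *\<^sub>R axis l 1) \<theta> < \<delta>"
    if "0 \<le> s" "s \<le> r" "0 \<le> t" "t \<le> r" for s t and k l :: 'p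
  proof -
    have "norm (s *\<^sub>R axis k (1::real) + t *\<^sub>R axis l 1) \<le> norm (s *\<^sub>R axis k (1::real)) + norm (t *\<^sub>R axis l (1::real))"
      by (rule norm_triangle_ineq)
    also have "\<dots> \<le> r + r" using that by simp
    also have "\<dots> < \<delta>" using r by (simp add: r_def)
    finally show ?thesis by (simp add: dist_norm add.assoc)
  qed
  have inS: "\<theta> + s *\<^sub>R axis k 1 + t *\<^sub>R axis l 1 \<in> S"
    if "0 \<le> s" "s \<le> r" "0 \<le> t" "t \<le> r" for s t and k l :: 'p
    using near[OF that] \<delta>3(2) by (auto simp: \<delta>_def dist_commute)
  obtain s t where st: "0 < s" "s < r" "0 < t" "t < r" and 1:
    "h (\<theta> + r *\<^sub>R axis i 1 + r *\<^sub>R axis j 1) - h (\<theta> + r *\<^sub>R axis i 1) - h (\<theta> + r *\<^sub>R axis j 1) + h \<theta>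
      = r\<^sup>2 * pderivs [j, i] h (\<theta> + s *\<^sub>R axis i 1 + t *\<^sub>R axis j 1)"
    using second_difference[OF assms(2) r inS, of i j] by blast
  obtain s' t' where st': "0 < s'" "s' < r" "0 < t'" "t' < r" and 2:
    "h (\<theta> + r *\<^sub>R axis j 1 + r *\<^sub>R axis i 1) - h (\<theta> + r *\<^sub>R axis j 1) - h (\<theta> + r *\<^sub>R axis i 1) + h \<theta>
      = r\<^sup>2 * pderivs [i, j] h (\<theta> + s' *\<^sub>R axis j 1 + t' *\<^sub>R axis i 1)"
    using second_difference[OF assms(2) r inS, of j i] by blast
  have "r\<^sup>2 * pderivs [j, i] h (\<theta> + s *\<^sub>R axis i 1 + t *\<^sub>R axis j 1) =
      r\<^sup>2 * pderivs [i, j] h (\<theta> + s' *\<^sub>R axis j 1 + t' *\<^sub>R axis i 1)"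
    unfolding 1[symmetric] 2[symmetric] by (simp add: algebra_simps)
  then have eq: "pderivs [j, i] h (\<theta> + s *\<^sub>R axis i 1 + t *\<^sub>R axis j 1) =
      pderivs [i, j] h (\<theta> + s' *\<^sub>R axis j 1 + t' *\<^sub>R axis i 1)"
    using r by simp
  have "dist (pderivs [j, i] h (\<theta> + s *\<^sub>R axis i 1 + t *\<^sub>R axis j 1)) (pderivs [j, i] h \<theta>) < \<epsilon>/2"
    using near[of s t i j] st by (intro \<delta>2) (simp add: \<delta>_def)
  moreover have "dist (pderivs [i, j] h (\<theta> + s' *\<^sub>R axis j 1 + t' *\<^sub>R axis i 1)) (pderivs [i, j] h \<theta>) < \<epsilon>/2"
    using near[of s' t' j i] st' by (intro \<delta>1) (simp add: \<delta>_def)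
  ultimately show False unfolding eq \<epsilon>_def
    using dist_triangle[of "pderivs [i, j] h \<theta>" "pderivs [j, i] h \<theta>"
        "pderivs [i, j] h (\<theta> + s' *\<^sub>R axis j 1 + t' *\<^sub>R axis i 1)"]
    by (simp add: dist_commute)
qed

text \<open>The outer derivatives see the function only near a point, so that a transposition of inner
  indices, which holds on all of the open set, can be carried out below them.\<close>

lemma pderivs_move:
  assumes "open S" "smooth_in S h" "\<theta> \<in> S"
  shows "pderivs (a # xs @ ys) h \<theta> = pderivs (xs @ a # ys) h \<theta>"
  using assms(3)
proof (induction xs arbitrary: \<theta>)
  case (Cons x xs)
  have "pderivs (a # (x # xs) @ ys) h \<theta> = pderivs [a, x] (pderivs (xs @ ys) h) \<theta>"
    by (simp add: pderivs_Cons)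
  also have "\<dots> = pderivs [x, a] (pderivs (xs @ ys) h) \<theta>"
    by (rule pderivs_commute[OF assms(1) smooth_in_pderivs[OF assms(2)] Cons.prems])
  also have "\<dots> = pderiv1 x (pderivs (a # xs @ ys) h) \<theta>" by (simp add: pderivs_Cons)
  also have "\<dots> = pderiv1 x (pderivs (xs @ a # ys) h) \<theta>"
    by (rule pderiv1_cong[OF assms(1) Cons.prems Cons.IH])
  finally show ?case by (simp add: pderivs_Cons)
qed simp

lemma pderivs_perm:
  assumes "open S" "smooth_in S h" "\<theta> \<in> S" "mset is = mset js"
  shows "pderivs is h \<theta> = pderivs js h \<theta>"
  using assms(3,4)
proof (induction "is" arbitrary: js \<theta>)
  case (Cons a "is")
  then obtain xs ys where js: "js = xs @ a # ys"
    by (metis list.set_intros(1) mset_eq_setD split_list)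
  have "pderivs (a # is) h \<theta> = pderiv1 a (pderivs (xs @ ys) h) \<theta>"
    unfolding pderivs_Cons using Cons.prems js
    by (intro pderiv1_cong[OF assms(1) Cons.prems(1)] Cons.IH) auto
  also have "\<dots> = pderivs js h \<theta>"
    using pderivs_move[OF assms(1,2) Cons.prems(1), of a xs ys] by (simp add: js pderivs_Cons)
  finally show ?case .
qed simp

text \<open>A partial derivative is a limit of difference quotients along a sequence, so
  measurability in \<open>x\<close> survives differentiation in \<open>\<theta>\<close>.\<close>

lemma measurable_pderivs:
  fixes F :: "real ^ 'p::finite \<Rightarrow> 'x \<Rightarrow> real"
  assumes "open S" "\<And>x. x \<in> space M \<Longrightarrow> smooth_in S (\<lambda>\<theta>. F \<theta> x)"
    and meas: "\<And>\<theta>. \<theta> \<in> S \<Longrightarrow> F \<theta> \<in> borel_measurable M" and "\<theta> \<in> S"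
  shows "(\<lambda>x. pderivs is (\<lambda>\<theta>. F \<theta> x) \<theta>) \<in> borel_measurable M"
  using assms(4)
proof (induction "is" arbitrary: \<theta>)
  case (Cons i "is")
  obtain r where r: "0 < r" "ball \<theta> r \<subseteq> S" using assms(1) Cons.prems openE by blast
  \<comment> \<open>The shift by two keeps all points strictly inside the ball.\<close>
  define t where "t n = r / real (n + 2)" for n
  have t_pos: "t n \<noteq> 0" for n using r by (simp add: t_def)
  have "t n < r" for n using r by (simp add: t_def field_simps add_pos_nonneg)
  then have "\<bar>t n\<bar> < r" for n using r by (simp add: t_def)
  then have in_S: "\<theta> + t n *\<^sub>R axis i 1 \<in> S" for n
    using r(2) by (auto simp: dist_norm subset_eq)
  have t_lim: "t \<longlonglongrightarrow> 0" unfolding t_def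
    using LIMSEQ_ignore_initial_segment[OF lim_const_over_n[of r], of 2] by simp
  define Q where "Q n x = (pderivs is (\<lambda>\<theta>. F \<theta> x) (\<theta> + t n *\<^sub>R axis i 1) - pderivs is (\<lambda>\<theta>. F \<theta> x) \<theta>) / t n" for n x
  have "Q n \<in> borel_measurable M" for n
    unfolding Q_def by (intro borel_measurable_divide borel_measurable_diff Cons.IH Cons.prems in_S) simp
  moreover have "(\<lambda>n. Q n x) \<longlonglongrightarrow> pderivs (i # is) (\<lambda>\<theta>. F \<theta> x) \<theta>" if "x \<in> space M" for x
  proof -
    have "((\<lambda>s. pderivs is (\<lambda>\<theta>. F \<theta> x) (\<theta> + s *\<^sub>R axis i 1)) has_real_derivative
       pderivs (i # is) (\<lambda>\<theta>. F \<theta> x) \<theta>) (at 0)"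
      using differentiable_imp_partial[of "pderivs is (\<lambda>\<theta>. F \<theta> x)" \<theta> 0 i]
        smooth_in_differentiable[OF assms(2)[OF that] Cons.prems, of "is"] by (simp add: pderivs_Cons)
    then have "((\<lambda>s. (pderivs is (\<lambda>\<theta>. F \<theta> x) (\<theta> + s *\<^sub>R axis i 1) - pderivs is (\<lambda>\<theta>. F \<theta> x) \<theta>) / s)
        \<longlongrightarrow> pderivs (i # is) (\<lambda>\<theta>. F \<theta> x) \<theta>) (at 0)"
      by (simp add: DERIV_def)
    moreover have "filterlim t (at 0) sequentially"
      using t_lim t_pos by (auto intro!: filterlim_atI)
    ultimately show ?thesis unfolding Q_def by (rule filterlim_compose)
  qed
  ultimately show ?case by (rule borel_measurable_LIMSEQ_real[rotated])
qed (simp add: meas)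

section \<open>Random variables with all moments\<close>

text \<open>With all powers at once the class is closed under products: the exponent may be doubled freely,
  and the arithmetic-geometric mean inequality takes the place of Hoelder's inequality.\<close>

definition all_moments :: "'a measure \<Rightarrow> ('a \<Rightarrow> real) \<Rightarrow> bool" where
  "all_moments M y \<longleftrightarrow> y \<in> borel_measurable M \<and> (\<forall>q::nat. integrable M (\<lambda>x. \<bar>y x\<bar> ^ q))"

lemma all_moments_measurable: "all_moments M y \<Longrightarrow> y \<in> borel_measurable M"
  by (simp add: all_moments_def)

lemma all_moments_integrable:
  assumes "all_moments M y" shows "integrable M y"
proof -
  have "y \<in> borel_measurable M" "integrable M (\<lambda>x. \<bar>y x\<bar> ^ 1)"
    using assms unfolding all_moments_def by blast+
  then show ?thesis using integrable_abs_cancel[of M y] by simp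
qed

lemma power_add_le:
  fixes a b :: real assumes "0 \<le> a" "0 \<le> b"
  shows "(a + b) ^ q \<le> 2 ^ q * (a ^ q + b ^ q)"
proof -
  have "(a + b) ^ q \<le> (2 * max a b) ^ q" using assms by (intro power_mono) auto
  also have "\<dots> = 2 ^ q * (max a b) ^ q" by (simp add: power_mult_distrib)
  also have "\<dots> \<le> 2 ^ q * (a ^ q + b ^ q)" using assms by (intro mult_left_mono) (auto simp: max_def)
  finally show ?thesis .
qed

lemma mult_le_sum_squares: "(a::real) * b \<le> a\<^sup>2 + b\<^sup>2"
proof -
  have "2 * (a * b) \<le> a\<^sup>2 + b\<^sup>2" using sum_squares_bound[of a b] by simp
  moreover have "0 \<le> a\<^sup>2 + b\<^sup>2" by simp
  ultimately show ?thesis by linarith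
qed

lemma power_mult_le:
  fixes a b :: real
  shows "\<bar>a * b\<bar> ^ q \<le> \<bar>a\<bar> ^ (2 * q) + \<bar>b\<bar> ^ (2 * q)"
  using mult_le_sum_squares[of "\<bar>a\<bar> ^ q" "\<bar>b\<bar> ^ q"]
  by (simp add: abs_mult power_mult_distrib power_even_eq)

lemma all_moments_add:
  assumes "all_moments M y" "all_moments M z"
  shows "all_moments M (\<lambda>x. y x + z x)"
proof -
  have m: "y \<in> borel_measurable M" "z \<in> borel_measurable M"
    and i: "integrable M (\<lambda>x. \<bar>y x\<bar> ^ q)" "integrable M (\<lambda>x. \<bar>z x\<bar> ^ q)" for q
    using assms unfolding all_moments_def by blast+
  have "integrable M (\<lambda>x. \<bar>y x + z x\<bar> ^ q)" for q
  proof (rule Bochner_Integration.integrable_bound)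
    show "integrable M (\<lambda>x. 2 ^ q * (\<bar>y x\<bar> ^ q + \<bar>z x\<bar> ^ q))" using i by simp
    have "\<bar>y x + z x\<bar> ^ q \<le> 2 ^ q * (\<bar>y x\<bar> ^ q + \<bar>z x\<bar> ^ q)" for x
      by (rule order_trans[OF power_mono[OF abs_triangle_ineq] power_add_le]) auto
    then show "AE x in M. norm (\<bar>y x + z x\<bar> ^ q) \<le> norm (2 ^ q * (\<bar>y x\<bar> ^ q + \<bar>z x\<bar> ^ q))"
      by (auto simp: power_abs[symmetric])
  qed (use m in measurable)
  then show ?thesis using m by (simp add: all_moments_def)
qed

lemma all_moments_mult:
  assumes "all_moments M y" "all_moments M z"
  shows "all_moments M (\<lambda>x. y x * z x)"
proof -
  have m: "y \<in> borel_measurable M" "z \<in> borel_measurable M"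
    and i: "integrable M (\<lambda>x. \<bar>y x\<bar> ^ q)" "integrable M (\<lambda>x. \<bar>z x\<bar> ^ q)" for q
    using assms unfolding all_moments_def by blast+
  have "integrable M (\<lambda>x. \<bar>y x * z x\<bar> ^ q)" for q
  proof (rule Bochner_Integration.integrable_bound)
    show "integrable M (\<lambda>x. \<bar>y x\<bar> ^ (2 * q) + \<bar>z x\<bar> ^ (2 * q))" using i by simp
    show "AE x in M. norm (\<bar>y x * z x\<bar> ^ q) \<le> norm (\<bar>y x\<bar> ^ (2 * q) + \<bar>z x\<bar> ^ (2 * q))"
      using power_mult_le[of "y _" "z _" q] by (auto simp: abs_mult power_abs)
  qed (use m in measurable)
  then show ?thesis using m by (simp add: all_moments_def)
qed

context prob_space begin

lemma all_moments_const: "all_moments M (\<lambda>_. c)"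
  by (simp add: all_moments_def)

lemma all_moments_cmult: "all_moments M y \<Longrightarrow> all_moments M (\<lambda>x. c * y x)"
  by (rule all_moments_mult[OF all_moments_const])

lemma all_moments_sum:
  "(\<And>a. a \<in> A \<Longrightarrow> all_moments M (y a)) \<Longrightarrow> all_moments M (\<lambda>x. \<Sum>a\<in>A. y a x)"
  by (induction A rule: infinite_finite_induct) (auto intro: all_moments_const all_moments_add)

lemma all_moments_prod_list:
  "(\<And>y. y \<in> set ys \<Longrightarrow> all_moments M (f y)) \<Longrightarrow> all_moments M (\<lambda>x. \<Prod>y\<leftarrow>ys. f y x)"
  by (induction ys) (auto intro: all_moments_const all_moments_mult)

end

section \<open>Moments of sums of independent observations\<close>

text \<open>The ways to divide a list of factors into two groups.  Lists rather than sets of factors are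
  needed because the same factor may occur repeatedly.\<close>

fun splits :: "'a list \<Rightarrow> ('a list \<times> 'a list) list" where
  "splits [] = [([], [])]"
| "splits (x # xs) = map (\<lambda>(as, bs). (x # as, bs)) (splits xs) @ map (\<lambda>(as, bs). (as, x # bs)) (splits xs)"

lemma prod_list_add_splits:
  fixes u v :: "'a \<Rightarrow> 'b::comm_semiring_1"
  shows "(\<Prod>y\<leftarrow>ys. u y + v y) = (\<Sum>(as, bs)\<leftarrow>splits ys. (\<Prod>y\<leftarrow>as. u y) * (\<Prod>y\<leftarrow>bs. v y))"
proof (induction ys)
  case (Cons y ys)
  show ?case
    by (simp add: Cons.IH o_def case_prod_unfold distrib_right mult_ac sum_list_addf
        sum_list_const_mult[symmetric] del: sum_list_const_mult)
qed simp

text \<open>The division that leaves all factors in the first group is separated from the others, because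
  it contributes the previous value in the recursion over the sample size.\<close>

lemma splits_head:
  "\<exists>rest. splits ys = (ys, []) # rest \<and>
    (\<forall>(as, bs)\<in>set rest. bs \<noteq> [] \<and> length as + length bs = length ys \<and> set as \<union> set bs \<subseteq> set ys)"
proof (induction ys)
  case (Cons y ys)
  then obtain rest where r: "splits ys = (ys, []) # rest"
    "\<forall>(as, bs)\<in>set rest. bs \<noteq> [] \<and> length as + length bs = length ys \<and> set as \<union> set bs \<subseteq> set ys"
    by blast
  show ?case
  proof (intro exI conjI)
    show "splits (y # ys) = (y # ys, []) # (map (\<lambda>(as, bs). (y # as, bs)) rest
        @ map (\<lambda>(as, bs). (as, y # bs)) ((ys, []) # rest))" (is "_ = _ # ?r")
      using r(1) by simp
    show "\<forall>(as, bs)\<in>set ?r. bs \<noteq> [] \<and> length as + length bs = length (y # ys) \<and> set as \<union> set bs \<subseteq> set (y # ys)"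
      using r(2) by (fastforce simp: case_prod_unfold)
  qed
qed simp

text \<open>\<open>N\<close> is the common distribution of the observations.\<close>

locale iid_sample_space = prob_space P for P :: "'w measure" +
  fixes N :: "'x measure" and X :: "nat \<Rightarrow> 'w \<Rightarrow> 'x"
  assumes indep: "indep_vars (\<lambda>_. N) X UNIV"
    and distr_X: "\<And>a. distr P N (X a) = N"
begin

lemma measurable_X [measurable]: "X a \<in> measurable P N"
  using indep by (auto simp: indep_vars_def)

lemma prob_space_N: "prob_space N"
  using prob_space_distr[OF measurable_X[of 0]] by (simp add: distr_X)

lemma integral_X: "y \<in> borel_measurable N \<Longrightarrow> (\<integral>\<omega>. (y (X a \<omega>) :: real) \<partial>P) = (\<integral>x. y x \<partial>N)"
  using integral_distr[OF measurable_X[of a], of y] by (simp add: distr_X)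

lemma integrable_X: "y \<in> borel_measurable N \<Longrightarrow>
    integrable P (\<lambda>\<omega>. (y (X a \<omega>) :: real)) \<longleftrightarrow> integrable N y"
  using integrable_distr_eq[OF measurable_X[of a], of y] by (simp add: distr_X)

lemma all_moments_X: "y \<in> borel_measurable N \<Longrightarrow> all_moments P (\<lambda>\<omega>. y (X a \<omega>)) \<longleftrightarrow> all_moments N y"
  using integrable_X[of "\<lambda>x. \<bar>y x\<bar> ^ _" a] by (auto simp: all_moments_def)

definition obs_sum :: "('x \<Rightarrow> real) \<Rightarrow> nat \<Rightarrow> 'w \<Rightarrow> real" where
  "obs_sum y n \<omega> = (\<Sum>a<n. y (X a \<omega>))"

definition avg :: "('x \<Rightarrow> real) \<Rightarrow> nat \<Rightarrow> 'w \<Rightarrow> real" where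
  "avg y n \<omega> = obs_sum y n \<omega> / real n"

definition joint :: "('x \<Rightarrow> real) list \<Rightarrow> real" where
  "joint ys = (\<integral>x. (\<Prod>y\<leftarrow>ys. y x) \<partial>N)"

definition total_moment :: "nat \<Rightarrow> ('x \<Rightarrow> real) list \<Rightarrow> real" where
  "total_moment n ys = (\<integral>\<omega>. (\<Prod>y\<leftarrow>ys. obs_sum y n \<omega>) \<partial>P)"

definition centred :: "('x \<Rightarrow> real) \<Rightarrow> bool" where
  "centred y \<longleftrightarrow> all_moments N y \<and> (\<integral>x. y x \<partial>N) = 0"

lemma all_moments_obs_sum: "all_moments N y \<Longrightarrow> all_moments P (obs_sum y n)"
  unfolding obs_sum_def
  by (intro all_moments_sum) (simp add: all_moments_X all_moments_measurable)

text \<open>The new observation is independent of the previous ones, so expanding each factor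
  \<open>obs_sum y (Suc n) = obs_sum y n + y (X n)\<close> and distributing turns a moment of
  sums into a sum over the ways of splitting the factors between past and present.\<close>

lemma total_moment_Suc:
  assumes "\<And>y. y \<in> set ys \<Longrightarrow> all_moments N y"
  shows "total_moment (Suc n) ys = (\<Sum>(as, bs)\<leftarrow>splits ys. total_moment n as * joint bs)"
proof -
  have indep_parts: "integrable P (\<lambda>\<omega>. (\<Prod>y\<leftarrow>as. obs_sum y n \<omega>) * (\<Prod>y\<leftarrow>bs. y (X n \<omega>))) \<and>
    (\<integral>\<omega>. (\<Prod>y\<leftarrow>as. obs_sum y n \<omega>) * (\<Prod>y\<leftarrow>bs. y (X n \<omega>)) \<partial>P) = total_moment n as * joint bs"
    if as: "set as \<subseteq> set ys" and bs: "set bs \<subseteq> set ys" for as bs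
  proof -
    have meas: "y \<in> borel_measurable N" if "y \<in> set ys" for y
      using assms[OF that] by (rule all_moments_measurable)
    have as_meas: "y \<in> borel_measurable N" if "y \<in> set as" for y using meas as that by auto
    have bs_meas: "y \<in> borel_measurable N" if "y \<in> set bs" for y using meas bs that by auto
    let ?F = "\<lambda>x. \<Prod>y\<leftarrow>as. \<Sum>a<n. y (x a)"
    let ?G = "\<lambda>x. \<Prod>y\<leftarrow>bs. y (x n)"
    have F: "?F \<in> borel_measurable (PiM {..<n} (\<lambda>_. N))"
      using as_meas by (induction as) (auto intro!: borel_measurable_times borel_measurable_sum)
    have G: "?G \<in> borel_measurable (PiM {n} (\<lambda>_. N))"
      using bs_meas by (induction bs) (auto intro!: borel_measurable_times)
    have "indep_var (PiM {..<n} (\<lambda>_. N)) (\<lambda>\<omega>. restrict (\<lambda>i. X i \<omega>) {..<n})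
        (PiM {n} (\<lambda>_. N)) (\<lambda>\<omega>. restrict (\<lambda>i. X i \<omega>) {n})"
      by (rule indep_var_restrict[OF indep]) auto
    from indep_var_compose[OF this F G]
    have "indep_var borel (\<lambda>\<omega>. \<Prod>y\<leftarrow>as. obs_sum y n \<omega>) borel (\<lambda>\<omega>. \<Prod>y\<leftarrow>bs. y (X n \<omega>))"
      by (simp add: o_def obs_sum_def)
    moreover have "integrable P (\<lambda>\<omega>. \<Prod>y\<leftarrow>as. obs_sum y n \<omega>)"
      using as assms by (intro all_moments_integrable all_moments_prod_list all_moments_obs_sum) auto
    moreover have "integrable P (\<lambda>\<omega>. \<Prod>y\<leftarrow>bs. y (X n \<omega>))"
      using bs assms bs_meas
      by (intro all_moments_integrable all_moments_prod_list all_moments_X[THEN iffD2]) auto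
    moreover have "(\<integral>\<omega>. (\<Prod>y\<leftarrow>bs. y (X n \<omega>)) \<partial>P) = joint bs"
      unfolding joint_def
      by (rule integral_X) (use bs_meas in \<open>induction bs; auto intro!: borel_measurable_times\<close>)
    ultimately show ?thesis
      using indep_var_integrable[of "\<lambda>\<omega>. \<Prod>y\<leftarrow>as. obs_sum y n \<omega>" "\<lambda>\<omega>. \<Prod>y\<leftarrow>bs. y (X n \<omega>)"]
        indep_var_lebesgue_integral[of "\<lambda>\<omega>. \<Prod>y\<leftarrow>as. obs_sum y n \<omega>" "\<lambda>\<omega>. \<Prod>y\<leftarrow>bs. y (X n \<omega>)"]
      by (simp add: total_moment_def)
  qed
  have sub: "set as \<subseteq> set ys \<and> set bs \<subseteq> set ys" if "(as, bs) \<in> set (splits ys)" for as bs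
    using splits_head[of ys] that by fastforce
  have int_list: "integrable P (\<lambda>\<omega>. \<Sum>(as, bs)\<leftarrow>ps. (\<Prod>y\<leftarrow>as. obs_sum y n \<omega>) * (\<Prod>y\<leftarrow>bs. y (X n \<omega>))) \<and>
     (\<integral>\<omega>. (\<Sum>(as, bs)\<leftarrow>ps. (\<Prod>y\<leftarrow>as. obs_sum y n \<omega>) * (\<Prod>y\<leftarrow>bs. y (X n \<omega>))) \<partial>P) =
        (\<Sum>(as, bs)\<leftarrow>ps. total_moment n as * joint bs)"
    if "set ps \<subseteq> set (splits ys)" for ps
    using that
  proof (induction ps)
    case (Cons p ps)
    obtain as bs where p: "p = (as, bs)" by force
    show ?case using Cons sub[of as bs] indep_parts[of as bs] by (simp add: p)
  qed simp
  have "total_moment (Suc n) ys = (\<integral>\<omega>. (\<Prod>y\<leftarrow>ys. obs_sum y n \<omega> + y (X n \<omega>)) \<partial>P)"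
    by (simp add: total_moment_def obs_sum_def)
  also have "\<dots> = (\<Sum>(as, bs)\<leftarrow>splits ys. total_moment n as * joint bs)"
    using int_list[of "splits ys"] by (simp add: prod_list_add_splits)
  finally show ?thesis .
qed

lemma total_moment_0: "total_moment 0 ys = (if ys = [] then 1 else 0)"
  by (cases ys) (simp_all add: total_moment_def obs_sum_def prob_space)

lemma total_moment_Nil [simp]: "total_moment n [] = 1"
  by (simp add: total_moment_def prob_space)

lemma joint_Nil [simp]: "joint [] = 1"
  by (simp add: joint_def prob_space.prob_space[OF prob_space_N])

lemma joint_single: "centred y \<Longrightarrow> joint [y] = 0"
  by (simp add: joint_def centred_def)

lemma total_moment_Suc_centred:
  "list_all centred ys \<Longrightarrow> total_moment (Suc n) ys = (\<Sum>(as, bs)\<leftarrow>splits ys. total_moment n as * joint bs)"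
  by (rule total_moment_Suc) (auto simp: list_all_iff centred_def)

lemma total_moment_1: "centred y \<Longrightarrow> total_moment n [y] = 0"
  by (induction n) (simp_all add: total_moment_0 total_moment_Suc_centred joint_single)

lemma centred_all_moments: "centred y \<Longrightarrow> all_moments N y" by (simp add: centred_def)

lemma total_moment_2:
  assumes "centred a" "centred b"
  shows "total_moment n [a, b] = real n * joint [a, b]"
  using assms by (induction n)
   (simp_all add: total_moment_0 total_moment_Suc_centred total_moment_1 joint_single algebra_simps)

lemma total_moment_3:
  assumes "centred a" "centred b" "centred c"
  shows "total_moment n [a, b, c] = real n * joint [a, b, c]"
  using assms by (induction n)
   (simp_all add: total_moment_0 total_moment_Suc_centred total_moment_1 joint_single algebra_simps)

text \<open>The sum over the pairings of four factors, as in Wick's formula for Gaussian variables.\<close>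

definition wick :: "('x \<Rightarrow> real) \<Rightarrow> ('x \<Rightarrow> real) \<Rightarrow> ('x \<Rightarrow> real) \<Rightarrow> ('x \<Rightarrow> real) \<Rightarrow> real" where
  "wick a b c d = joint [a, b] * joint [c, d] + joint [a, c] * joint [b, d] + joint [a, d] * joint [b, c]"

text \<open>Divisions that leave the last observation in a single factor vanish, so the moment of degree four
  grows by the six products of two moments of degree two, and by one joint moment.\<close>

lemma total_moment_4:
  assumes "centred a" "centred b" "centred c" "centred d"
  shows "total_moment n [a, b, c, d] = (real n)\<^sup>2 * wick a b c d + real n * (joint [a, b, c, d] - wick a b c d)"
  using assms by (induction n)
   (simp_all add: total_moment_0 total_moment_Suc_centred total_moment_2 total_moment_1 joint_single
     algebra_simps wick_def power2_eq_square)

text \<open>A factor observed only once averages out, so each moment grows at most like \<open>n\<close> to the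
  number of disjoint pairs of factors.  Odd moments therefore lose half an order.\<close>

lemma total_moment_bound:
  assumes "\<And>y. y \<in> set ys \<Longrightarrow> centred y"
  shows "\<exists>K\<ge>0. \<forall>n. \<bar>total_moment n ys\<bar> \<le> K * real n ^ (length ys div 2)"
  using assms
proof (induction ys rule: length_induct)
  case (1 ys)
  obtain rest where rest: "splits ys = (ys, []) # rest" and
    r: "\<And>as bs. (as, bs) \<in> set rest \<Longrightarrow> bs \<noteq> [] \<and> length as + length bs = length ys \<and> set as \<union> set bs \<subseteq> set ys"
    using splits_head[of ys] by blast
  have IH: "\<exists>K\<ge>0. \<forall>n. \<bar>total_moment n as\<bar> \<le> K * real n ^ (length as div 2)" if "(as, bs) \<in> set rest" for as bs
  proof (rule 1(1)[rule_format])
    show "length as < length ys" using r[OF that] by (cases bs) auto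
    show "centred y" if "y \<in> set as" for y using r[OF \<open>(as, bs) \<in> set rest\<close>] 1(2) that by blast
  qed
  define l where "l = length ys div 2"
  \<comment> \<open>For \<open>l = 0\<close> the exponent \<open>l - 1\<close> is truncated, so that the increments have to vanish.\<close>
  have step: "\<exists>C\<ge>0. \<forall>n. \<bar>\<Sum>(as, bs)\<leftarrow>ps. total_moment n as * joint bs\<bar> \<le> C * (real n + 1) ^ (l - 1) \<and> (l = 0 \<longrightarrow> C = 0)"
    if "set ps \<subseteq> set rest" for ps
    using that
  proof (induction ps)
    case Nil
    show ?case by (rule exI[of _ 0]) simp
  next
    case (Cons p ps)
    obtain as bs where p: "p = (as, bs)" by force
    from Cons obtain C where C: "C \<ge> 0" "l = 0 \<Longrightarrow> C = 0"
      "\<And>n. \<bar>\<Sum>(as, bs)\<leftarrow>ps. total_moment n as * joint bs\<bar> \<le> C * (real n + 1) ^ (l - 1)" by auto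
    have in_rest: "(as, bs) \<in> set rest" using Cons.prems p by auto
    show ?case
    proof (cases "length bs = 1")
      case True
      then obtain b where "bs = [b]" by (auto simp: length_Suc_conv)
      then have "joint bs = 0" using r[OF in_rest] 1(2) joint_single by auto
      then show ?thesis using C by (intro exI[of _ C]) (simp add: p)
    next
      case False
      then have "length bs \<ge> 2" using r[OF in_rest] by (cases bs; cases "tl bs") auto
      moreover have "length as + length bs = length ys" using r[OF in_rest] by blast
      ultimately have len: "length as div 2 \<le> l - 1" "l \<noteq> 0" unfolding l_def by linarith+
      from IH[OF in_rest] obtain K where K: "K \<ge> 0" "\<And>n. \<bar>total_moment n as\<bar> \<le> K * real n ^ (length as div 2)" by auto
      show ?thesis
      proof (intro exI[of _ "C + K * \<bar>joint bs\<bar>"] conjI allI)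
        show "0 \<le> C + K * \<bar>joint bs\<bar>" using C K by simp
        show "l = 0 \<longrightarrow> C + K * \<bar>joint bs\<bar> = 0" using len by simp
        fix n
        have "real n ^ (length as div 2) \<le> (real n + 1) ^ (length as div 2)" by (intro power_mono) auto
        also have "\<dots> \<le> (real n + 1) ^ (l - 1)" using len by (intro power_increasing) auto
        finally have "\<bar>total_moment n as\<bar> \<le> K * (real n + 1) ^ (l - 1)"
          using K(2)[of n] K(1) by (meson mult_left_mono order_trans)
        then have "\<bar>total_moment n as * joint bs\<bar> \<le> K * (real n + 1) ^ (l - 1) * \<bar>joint bs\<bar>"
          unfolding abs_mult by (rule mult_right_mono) simp
        then show "\<bar>\<Sum>(as, bs)\<leftarrow>p # ps. total_moment n as * joint bs\<bar> \<le> (C + K * \<bar>joint bs\<bar>) * (real n + 1) ^ (l - 1)"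
          using C(3)[of n] by (simp add: p algebra_simps) 
      qed
    qed
  qed
  from step[of rest] obtain C where C: "C \<ge> 0" "l = 0 \<Longrightarrow> C = 0"
    "\<And>n. \<bar>\<Sum>(as, bs)\<leftarrow>rest. total_moment n as * joint bs\<bar> \<le> C * (real n + 1) ^ (l - 1)" by auto
  show ?case
  proof (cases "ys = []")
    case True
    then show ?thesis by (intro exI[of _ 1]) simp
  next
    case False
    have "\<bar>total_moment n ys\<bar> \<le> C * real n ^ l" for n
    proof (induction n)
      case 0
      then show ?case using False C by (simp add: total_moment_0)
    next
      case (Suc n)
      have "total_moment (Suc n) ys = total_moment n ys + (\<Sum>(as, bs)\<leftarrow>rest. total_moment n as * joint bs)"
        using total_moment_Suc[of ys n] 1(2) by (simp add: rest centred_def)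
      then have "\<bar>total_moment (Suc n) ys\<bar> \<le> C * real n ^ l + C * (real n + 1) ^ (l - 1)"
        using Suc C(3)[of n] by linarith
      also have "\<dots> \<le> C * (real n + 1) ^ l"
      proof (cases l)
        case (Suc k)
        have "real n ^ l + (real n + 1) ^ (l - 1) \<le> (real n + 1) ^ l"
          using power_mono[of "real n" "real n + 1" k] by (simp add: Suc algebra_simps mult_left_mono)
        then show ?thesis using C(1) by (simp flip: distrib_left add: mult_left_mono)
      qed (use C in simp)
      finally show ?case by (simp add: add.commute)
    qed
    then show ?thesis using C by (intro exI[of _ C]) (simp add: l_def)
  qed
qed

end

section \<open>Orders of magnitude of random sequences\<close>

context prob_space begin

text \<open>Only large \<open>n\<close> count, since the moment hypotheses on the estimator say nothing about small
  samples.\<close>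

definition bounded_mean :: "(nat \<Rightarrow> 'a \<Rightarrow> real) \<Rightarrow> bool" where
  "bounded_mean f \<longleftrightarrow> (\<exists>K. \<forall>\<^sub>F n in sequentially. integrable M (f n) \<and> (\<integral>\<omega>. f n \<omega> \<partial>M) \<le> K)"

lemma bounded_meanI:
  "\<forall>\<^sub>F n in sequentially. integrable M (f n) \<and> (\<integral>\<omega>. f n \<omega> \<partial>M) \<le> K \<Longrightarrow> bounded_mean f"
  unfolding bounded_mean_def by (rule exI)

lemma bounded_meanE:
  assumes "bounded_mean f"
  obtains K where "\<forall>\<^sub>F n in sequentially. integrable M (f n) \<and> (\<integral>\<omega>. f n \<omega> \<partial>M) \<le> K"
  using assms that unfolding bounded_mean_def by (elim exE)

lemma bounded_mean_add:
  assumes "bounded_mean f" "bounded_mean h" shows "bounded_mean (\<lambda>n \<omega>. f n \<omega> + h n \<omega>)"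
proof -
  obtain K1 where "\<forall>\<^sub>F n in sequentially. integrable M (f n) \<and> (\<integral>\<omega>. f n \<omega> \<partial>M) \<le> K1"
    by (rule bounded_meanE[OF assms(1)])
  moreover obtain K2 where "\<forall>\<^sub>F n in sequentially. integrable M (h n) \<and> (\<integral>\<omega>. h n \<omega> \<partial>M) \<le> K2"
    by (rule bounded_meanE[OF assms(2)])
  ultimately have "\<forall>\<^sub>F n in sequentially. integrable M (\<lambda>\<omega>. f n \<omega> + h n \<omega>) \<and> (\<integral>\<omega>. f n \<omega> + h n \<omega> \<partial>M) \<le> K1 + K2"
    by eventually_elim auto
  then show ?thesis by (rule bounded_meanI)
qed

lemma bounded_mean_cmult:
  assumes "bounded_mean f" "0 \<le> c" shows "bounded_mean (\<lambda>n \<omega>. c * f n \<omega>)"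
proof -
  obtain K where "\<forall>\<^sub>F n in sequentially. integrable M (f n) \<and> (\<integral>\<omega>. f n \<omega> \<partial>M) \<le> K"
    by (rule bounded_meanE[OF assms(1)])
  then have "\<forall>\<^sub>F n in sequentially. integrable M (\<lambda>\<omega>. c * f n \<omega>) \<and> (\<integral>\<omega>. c * f n \<omega> \<partial>M) \<le> c * K"
    by eventually_elim (use mult_left_mono[OF _ assms(2)] in simp)
  then show ?thesis by (rule bounded_meanI)
qed

lemma bounded_mean_const: "bounded_mean (\<lambda>_ _. c)"
  unfolding bounded_mean_def by (rule exI[of _ c]) (simp add: prob_space)

lemma bounded_mean_dominated:
  assumes "bounded_mean h" "\<forall>\<^sub>F n in sequentially. f n \<in> borel_measurable M"
    "\<forall>\<^sub>F n in sequentially. \<forall>\<omega>. \<bar>f n \<omega>\<bar> \<le> h n \<omega>"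
  shows "bounded_mean f"
proof -
  obtain K where "\<forall>\<^sub>F n in sequentially. integrable M (h n) \<and> (\<integral>\<omega>. h n \<omega> \<partial>M) \<le> K"
    by (rule bounded_meanE[OF assms(1)])
  with assms(2,3) have "\<forall>\<^sub>F n in sequentially. integrable M (f n) \<and> (\<integral>\<omega>. f n \<omega> \<partial>M) \<le> K"
  proof eventually_elim
    case (elim n)
    have le: "norm (f n \<omega>) \<le> norm (h n \<omega>)" "f n \<omega> \<le> h n \<omega>" for \<omega>
      using elim(2)[rule_format, of \<omega>] by simp_all
    have int: "integrable M (f n)"
      by (rule Bochner_Integration.integrable_bound[OF conjunct1[OF elim(3)] elim(1)]) (use le(1) in simp)
    have "(\<integral>\<omega>. f n \<omega> \<partial>M) \<le> (\<integral>\<omega>. h n \<omega> \<partial>M)"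
      by (rule integral_mono[OF int conjunct1[OF elim(3)] le(2)])
    then show ?case using int conjunct2[OF elim(3)] by simp
  qed
  then show ?thesis by (rule bounded_meanI)
qed

text \<open>\<open>moment_order k Z\<close> is the statement that \<open>Z\<close> is of order \<open>n\<^bsup>-k/2\<^esup>\<close> in every \<open>L\<^sup>q\<close>.\<close>

definition moment_order :: "nat \<Rightarrow> (nat \<Rightarrow> 'a \<Rightarrow> real) \<Rightarrow> bool" where
  "moment_order k Z \<longleftrightarrow> (\<forall>\<^sub>F n in sequentially. Z n \<in> borel_measurable M) \<and>
     (\<forall>q. bounded_mean (\<lambda>n \<omega>. \<bar>sqrt (real n) ^ k * Z n \<omega>\<bar> ^ q))"

text \<open>The weaker notion with \<open>q = 1\<close>, for products with a factor that has only two moments.\<close>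

definition mean_order :: "nat \<Rightarrow> (nat \<Rightarrow> 'a \<Rightarrow> real) \<Rightarrow> bool" where
  "mean_order k Z \<longleftrightarrow> (\<forall>\<^sub>F n in sequentially. Z n \<in> borel_measurable M) \<and>
     bounded_mean (\<lambda>n \<omega>. \<bar>sqrt (real n) ^ k * Z n \<omega>\<bar>)"

lemma moment_order_even:
  assumes "\<forall>\<^sub>F n in sequentially. Z n \<in> borel_measurable M"
    "\<And>q. bounded_mean (\<lambda>n \<omega>. (sqrt (real n) ^ k * Z n \<omega>) ^ (2 * q))"
  shows "moment_order k Z"
  unfolding moment_order_def
proof (intro conjI allI)
  fix q
  show "bounded_mean (\<lambda>n \<omega>. \<bar>sqrt (real n) ^ k * Z n \<omega>\<bar> ^ q)"
  proof (rule bounded_mean_dominated[OF bounded_mean_add[OF bounded_mean_const[of 1] assms(2)[of q]]])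
    show "\<forall>\<^sub>F n in sequentially. (\<lambda>\<omega>. \<bar>sqrt (real n) ^ k * Z n \<omega>\<bar> ^ q) \<in> borel_measurable M"
      using assms(1) by eventually_elim measurable
    have "\<bar>\<bar>x\<bar> ^ q\<bar> \<le> 1 + x ^ (2 * q)" for x :: real
      using mult_le_sum_squares[of "\<bar>x ^ q\<bar>" 1] by (simp add: power_even_eq flip: power_abs)
    then show "\<forall>\<^sub>F n in sequentially. \<forall>\<omega>. \<bar>\<bar>sqrt (real n) ^ k * Z n \<omega>\<bar> ^ q\<bar> \<le> 1 + (sqrt (real n) ^ k * Z n \<omega>) ^ (2 * q)"
      by simp
  qed
qed (rule assms)

lemma moment_order_add:
  assumes "moment_order k Y" "moment_order k Z"
  shows "moment_order k (\<lambda>n \<omega>. Y n \<omega> + Z n \<omega>)"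
  unfolding moment_order_def
proof (intro conjI allI)
  have m: "\<forall>\<^sub>F n in sequentially. Y n \<in> borel_measurable M" "\<forall>\<^sub>F n in sequentially. Z n \<in> borel_measurable M"
    using assms by (auto simp: moment_order_def)
  then show "\<forall>\<^sub>F n in sequentially. (\<lambda>\<omega>. Y n \<omega> + Z n \<omega>) \<in> borel_measurable M"
    by eventually_elim measurable
  fix q
  have b: "bounded_mean (\<lambda>n \<omega>. \<bar>sqrt (real n) ^ k * Y n \<omega>\<bar> ^ q)" "bounded_mean (\<lambda>n \<omega>. \<bar>sqrt (real n) ^ k * Z n \<omega>\<bar> ^ q)"
    using assms unfolding moment_order_def by blast+
  have "\<bar>\<bar>c * (y + z)\<bar> ^ q\<bar> \<le> 2 ^ q * (\<bar>c * y\<bar> ^ q + \<bar>c * z\<bar> ^ q)" for c y z :: real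
  proof -
    have "\<bar>c * (y + z)\<bar> ^ q \<le> (\<bar>c * y\<bar> + \<bar>c * z\<bar>) ^ q"
      by (intro power_mono) (simp_all add: distrib_left abs_triangle_ineq)
    then show ?thesis using power_add_le[of "\<bar>c * y\<bar>" "\<bar>c * z\<bar>" q] by simp
  qed
  moreover have "\<forall>\<^sub>F n in sequentially. (\<lambda>\<omega>. \<bar>sqrt (real n) ^ k * (Y n \<omega> + Z n \<omega>)\<bar> ^ q) \<in> borel_measurable M"
    using m by eventually_elim measurable
  ultimately show "bounded_mean (\<lambda>n \<omega>. \<bar>sqrt (real n) ^ k * (Y n \<omega> + Z n \<omega>)\<bar> ^ q)"
    by (intro bounded_mean_dominated[OF bounded_mean_cmult[OF bounded_mean_add[OF b]], of "2 ^ q"]) auto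
qed

lemma moment_order_mult:
  assumes "moment_order j Y" "moment_order k Z"
  shows "moment_order (j + k) (\<lambda>n \<omega>. Y n \<omega> * Z n \<omega>)"
  unfolding moment_order_def
proof (intro conjI allI)
  have m: "\<forall>\<^sub>F n in sequentially. Y n \<in> borel_measurable M" "\<forall>\<^sub>F n in sequentially. Z n \<in> borel_measurable M"
    using assms by (auto simp: moment_order_def)
  then show "\<forall>\<^sub>F n in sequentially. (\<lambda>\<omega>. Y n \<omega> * Z n \<omega>) \<in> borel_measurable M"
    by eventually_elim measurable
  fix q
  have b: "bounded_mean (\<lambda>n \<omega>. \<bar>sqrt (real n) ^ j * Y n \<omega>\<bar> ^ (2 * q))"
    "bounded_mean (\<lambda>n \<omega>. \<bar>sqrt (real n) ^ k * Z n \<omega>\<bar> ^ (2 * q))"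
    using assms unfolding moment_order_def by blast+
  have "\<bar>\<bar>r ^ (j + k) * (y * z)\<bar> ^ q\<bar> \<le> \<bar>r ^ j * y\<bar> ^ (2 * q) + \<bar>r ^ k * z\<bar> ^ (2 * q)" for r y z :: real
    using power_mult_le[of "r ^ j * y" "r ^ k * z" q] by (simp add: power_add mult_ac)
  moreover have "\<forall>\<^sub>F n in sequentially. (\<lambda>\<omega>. \<bar>sqrt (real n) ^ (j + k) * (Y n \<omega> * Z n \<omega>)\<bar> ^ q) \<in> borel_measurable M"
    using m by eventually_elim measurable
  ultimately show "bounded_mean (\<lambda>n \<omega>. \<bar>sqrt (real n) ^ (j + k) * (Y n \<omega> * Z n \<omega>)\<bar> ^ q)"
    by (intro bounded_mean_dominated[OF bounded_mean_add[OF b]]) auto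
qed

lemma moment_order_mono:
  assumes "moment_order k Z" "j \<le> k"
  shows "moment_order j Z"
  unfolding moment_order_def
proof (intro conjI allI)
  show m: "\<forall>\<^sub>F n in sequentially. Z n \<in> borel_measurable M"
    using assms by (auto simp: moment_order_def)
  fix q
  have b: "bounded_mean (\<lambda>n \<omega>. \<bar>sqrt (real n) ^ k * Z n \<omega>\<bar> ^ q)"
    using assms unfolding moment_order_def by blast
  show "bounded_mean (\<lambda>n \<omega>. \<bar>sqrt (real n) ^ j * Z n \<omega>\<bar> ^ q)"
  proof (rule bounded_mean_dominated[OF b])
    show "\<forall>\<^sub>F n in sequentially. (\<lambda>\<omega>. \<bar>sqrt (real n) ^ j * Z n \<omega>\<bar> ^ q) \<in> borel_measurable M"
      using m by eventually_elim measurable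
    show "\<forall>\<^sub>F n in sequentially. \<forall>\<omega>. \<bar>\<bar>sqrt (real n) ^ j * Z n \<omega>\<bar> ^ q\<bar> \<le> \<bar>sqrt (real n) ^ k * Z n \<omega>\<bar> ^ q"
      using eventually_ge_at_top[of 1]
    proof eventually_elim
      case (elim n)
      then have "sqrt (real n) ^ j \<le> sqrt (real n) ^ k" by (intro power_increasing assms) auto
      then have "\<bar>sqrt (real n) ^ j * Z n \<omega>\<bar> \<le> \<bar>sqrt (real n) ^ k * Z n \<omega>\<bar>" for \<omega>
        unfolding abs_mult by (intro mult_right_mono) simp_all
      from power_mono[OF this abs_ge_zero] show ?case by simp
    qed
  qed
qed

lemma moment_order_const: "moment_order 0 (\<lambda>_ _. c)"
  by (simp add: moment_order_def bounded_mean_const)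

lemma moment_order_cmult: "moment_order k Z \<Longrightarrow> moment_order k (\<lambda>n \<omega>. c * Z n \<omega>)"
  using moment_order_mult[OF moment_order_const[of c]] by simp

lemma moment_order_diff:
  "moment_order k Y \<Longrightarrow> moment_order k Z \<Longrightarrow> moment_order k (\<lambda>n \<omega>. Y n \<omega> - Z n \<omega>)"
  using moment_order_add[OF _ moment_order_cmult[of k Z "-1"]] by simp

lemma moment_order_zero: "moment_order k (\<lambda>_ _. 0)"
proof -
  have "bounded_mean (\<lambda>n \<omega>. \<bar>sqrt (real n) ^ k * 0\<bar> ^ q)" for q
    using bounded_mean_const[of "\<bar>0\<bar> ^ q"] by simp
  then show ?thesis by (simp add: moment_order_def)
qed

lemma moment_order_sum:
  "(\<And>a. a \<in> A \<Longrightarrow> moment_order k (Z a)) \<Longrightarrow> moment_order k (\<lambda>n \<omega>. \<Sum>a\<in>A. Z a n \<omega>)"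
  by (induction A rule: infinite_finite_induct) (auto intro: moment_order_zero moment_order_add)

lemma moment_order_AE_cong:
  assumes "moment_order k Y" "\<forall>\<^sub>F n in sequentially. Z n \<in> borel_measurable M"
    and AE: "\<forall>\<^sub>F n in sequentially. AE \<omega> in M. Z n \<omega> = Y n \<omega>"
  shows "moment_order k Z"
  unfolding moment_order_def
proof (intro conjI allI)
  fix q
  obtain K where "\<forall>\<^sub>F n in sequentially. integrable M (\<lambda>\<omega>. \<bar>sqrt (real n) ^ k * Y n \<omega>\<bar> ^ q)
     \<and> (\<integral>\<omega>. \<bar>sqrt (real n) ^ k * Y n \<omega>\<bar> ^ q \<partial>M) \<le> K"
    using assms(1) unfolding moment_order_def by (blast elim: bounded_meanE)
  moreover have "\<forall>\<^sub>F n in sequentially. Y n \<in> borel_measurable M" using assms(1) by (simp add: moment_order_def)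
  ultimately have "\<forall>\<^sub>F n in sequentially. integrable M (\<lambda>\<omega>. \<bar>sqrt (real n) ^ k * Z n \<omega>\<bar> ^ q)
     \<and> (\<integral>\<omega>. \<bar>sqrt (real n) ^ k * Z n \<omega>\<bar> ^ q \<partial>M) \<le> K"
    using assms(2) AE
  proof eventually_elim
    case (elim n)
    note [measurable] = elim(2,3)
    have e: "AE \<omega> in M. \<bar>sqrt (real n) ^ k * Z n \<omega>\<bar> ^ q = \<bar>sqrt (real n) ^ k * Y n \<omega>\<bar> ^ q"
      using elim(4) by eventually_elim simp
    have "integrable M (\<lambda>\<omega>. \<bar>sqrt (real n) ^ k * Z n \<omega>\<bar> ^ q) \<longleftrightarrow> integrable M (\<lambda>\<omega>. \<bar>sqrt (real n) ^ k * Y n \<omega>\<bar> ^ q)"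
      using e by (intro integrable_cong_AE) measurable
    moreover have "(\<integral>\<omega>. \<bar>sqrt (real n) ^ k * Z n \<omega>\<bar> ^ q \<partial>M) = (\<integral>\<omega>. \<bar>sqrt (real n) ^ k * Y n \<omega>\<bar> ^ q \<partial>M)"
      using e by (intro integral_cong_AE) measurable
    ultimately show ?case using elim(1) by simp
  qed
  then show "bounded_mean (\<lambda>n \<omega>. \<bar>sqrt (real n) ^ k * Z n \<omega>\<bar> ^ q)"
    by (rule bounded_meanI)
qed (rule assms)

lemma mean_order_if_moment_order: "moment_order k Z \<Longrightarrow> mean_order k Z"
  using bspec[of UNIV "\<lambda>q. bounded_mean (\<lambda>n \<omega>. \<bar>sqrt (real n) ^ k * Z n \<omega>\<bar> ^ q)" 1]
  by (simp add: moment_order_def mean_order_def)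

lemma mean_order_add:
  assumes "mean_order k Y" "mean_order k Z"
  shows "mean_order k (\<lambda>n \<omega>. Y n \<omega> + Z n \<omega>)"
  unfolding mean_order_def
proof
  have m: "\<forall>\<^sub>F n in sequentially. Y n \<in> borel_measurable M" "\<forall>\<^sub>F n in sequentially. Z n \<in> borel_measurable M"
    using assms by (auto simp: mean_order_def)
  then show "\<forall>\<^sub>F n in sequentially. (\<lambda>\<omega>. Y n \<omega> + Z n \<omega>) \<in> borel_measurable M"
    by eventually_elim measurable
  have "\<forall>\<^sub>F n in sequentially. (\<lambda>\<omega>. \<bar>sqrt (real n) ^ k * (Y n \<omega> + Z n \<omega>)\<bar>) \<in> borel_measurable M"
    using m by eventually_elim measurable
  moreover have "\<bar>\<bar>c * (y + z)\<bar>\<bar> \<le> \<bar>c * y\<bar> + \<bar>c * z\<bar>" for c y z :: real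
    by (simp add: distrib_left)
  ultimately show "bounded_mean (\<lambda>n \<omega>. \<bar>sqrt (real n) ^ k * (Y n \<omega> + Z n \<omega>)\<bar>)"
    by (intro bounded_mean_dominated[OF bounded_mean_add[OF assms(1)[unfolded mean_order_def, THEN conjunct2]
      assms(2)[unfolded mean_order_def, THEN conjunct2]]]) simp_all
qed

lemma mean_order_sum:
  "(\<And>a. a \<in> A \<Longrightarrow> mean_order k (Z a)) \<Longrightarrow> mean_order k (\<lambda>n \<omega>. \<Sum>a\<in>A. Z a n \<omega>)"
  by (induction A rule: infinite_finite_induct)
    (auto intro: mean_order_if_moment_order[OF moment_order_zero] mean_order_add)

text \<open>The product of the scaled factors is at most the sum of their squares, so one factor may have just
  two moments, provided all others have them all.\<close>

lemma mean_order_mult: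
  assumes W: "\<forall>\<^sub>F n in sequentially. W n \<in> borel_measurable M"
    "bounded_mean (\<lambda>n \<omega>. (sqrt (real n) ^ j * W n \<omega>)\<^sup>2)"
    and Z: "moment_order k Z"
  shows "mean_order (j + k) (\<lambda>n \<omega>. W n \<omega> * Z n \<omega>)"
  unfolding mean_order_def
proof
  have m: "\<forall>\<^sub>F n in sequentially. Z n \<in> borel_measurable M"
    using Z by (auto simp: moment_order_def)
  show "\<forall>\<^sub>F n in sequentially. (\<lambda>\<omega>. W n \<omega> * Z n \<omega>) \<in> borel_measurable M"
    using W(1) m by eventually_elim measurable
  have b: "bounded_mean (\<lambda>n \<omega>. \<bar>sqrt (real n) ^ k * Z n \<omega>\<bar> ^ 2)"
    using Z unfolding moment_order_def by blast
  have "\<bar>\<bar>r ^ (j + k) * (w * z)\<bar>\<bar> \<le> (r ^ j * w)\<^sup>2 + \<bar>r ^ k * z\<bar> ^ 2" for r w z :: real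
  proof -
    have "\<bar>\<bar>r ^ (j + k) * (w * z)\<bar>\<bar> = \<bar>r ^ j * w\<bar> * \<bar>r ^ k * z\<bar>" by (simp add: power_add abs_mult mult_ac)
    then show ?thesis
      using mult_le_sum_squares[of "\<bar>r ^ j * w\<bar>" "\<bar>r ^ k * z\<bar>"] by (simp only: power2_abs)
  qed
  moreover have "\<forall>\<^sub>F n in sequentially. (\<lambda>\<omega>. \<bar>sqrt (real n) ^ (j + k) * (W n \<omega> * Z n \<omega>)\<bar>) \<in> borel_measurable M"
    using W(1) m by eventually_elim measurable
  ultimately show "bounded_mean (\<lambda>n \<omega>. \<bar>sqrt (real n) ^ (j + k) * (W n \<omega> * Z n \<omega>)\<bar>)"
    by (intro bounded_mean_dominated[OF bounded_mean_add[OF W(2) b]]) auto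
qed

definition second_order_mean :: "(nat \<Rightarrow> 'a \<Rightarrow> real) \<Rightarrow> real \<Rightarrow> bool" where
  "second_order_mean Z c \<longleftrightarrow> (\<forall>\<^sub>F n in sequentially. integrable M (Z n)) \<and>
     (\<lambda>n. (\<integral>\<omega>. Z n \<omega> \<partial>M) - c / (real n)\<^sup>2) \<in> O(\<lambda>n. 1 / real n ^ 3)"

abbreviation negligible_mean :: "(nat \<Rightarrow> 'a \<Rightarrow> real) \<Rightarrow> bool" where
  "negligible_mean Z \<equiv> second_order_mean Z 0"

lemma second_order_mean_add:
  assumes "second_order_mean Y b" "second_order_mean Z c"
  shows "second_order_mean (\<lambda>n \<omega>. Y n \<omega> + Z n \<omega>) (b + c)"
  unfolding second_order_mean_def
proof
  have int: "\<forall>\<^sub>F n in sequentially. integrable M (Y n)" "\<forall>\<^sub>F n in sequentially. integrable M (Z n)"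
    using assms by (simp_all add: second_order_mean_def)
  then show "\<forall>\<^sub>F n in sequentially. integrable M (\<lambda>\<omega>. Y n \<omega> + Z n \<omega>)" by eventually_elim simp
  have "(\<lambda>n. ((\<integral>\<omega>. Y n \<omega> \<partial>M) - b / (real n)\<^sup>2) + ((\<integral>\<omega>. Z n \<omega> \<partial>M) - c / (real n)\<^sup>2)) \<in> O(\<lambda>n. 1 / real n ^ 3)"
    by (rule sum_in_bigo(1)[OF conjunct2[OF assms(1)[unfolded second_order_mean_def]]
          conjunct2[OF assms(2)[unfolded second_order_mean_def]]])
  moreover have "\<forall>\<^sub>F n in sequentially. (\<integral>\<omega>. Y n \<omega> + Z n \<omega> \<partial>M) - (b + c) / (real n)\<^sup>2 =
      ((\<integral>\<omega>. Y n \<omega> \<partial>M) - b / (real n)\<^sup>2) + ((\<integral>\<omega>. Z n \<omega> \<partial>M) - c / (real n)\<^sup>2)"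
    using int by eventually_elim (simp add: add_divide_distrib)
  ultimately show "(\<lambda>n. (\<integral>\<omega>. Y n \<omega> + Z n \<omega> \<partial>M) - (b + c) / (real n)\<^sup>2) \<in> O(\<lambda>n. 1 / real n ^ 3)"
    by (subst landau_o.big.in_cong)
qed

lemma second_order_mean_zero: "second_order_mean (\<lambda>_ _. 0) 0"
  by (simp add: second_order_mean_def)

lemma second_order_mean_sum:
  "finite I \<Longrightarrow> (\<And>p. p \<in> I \<Longrightarrow> second_order_mean (T p) (c p)) \<Longrightarrow>
    second_order_mean (\<lambda>n \<omega>. \<Sum>p\<in>I. T p n \<omega>) (\<Sum>p\<in>I. c p)"
  by (induction I rule: finite_induct) (auto intro: second_order_mean_zero second_order_mean_add)

lemma mean_order_integrable:
  assumes "mean_order k Z" shows "\<forall>\<^sub>F n in sequentially. integrable M (Z n)"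
proof -
  obtain K where "\<forall>\<^sub>F n in sequentially. integrable M (\<lambda>\<omega>. \<bar>sqrt (real n) ^ k * Z n \<omega>\<bar>)
     \<and> (\<integral>\<omega>. \<bar>sqrt (real n) ^ k * Z n \<omega>\<bar> \<partial>M) \<le> K"
    using assms unfolding mean_order_def by (blast elim: bounded_meanE)
  moreover have "\<forall>\<^sub>F n in sequentially. Z n \<in> borel_measurable M" using assms by (simp add: mean_order_def)
  ultimately show ?thesis
    using eventually_gt_at_top[of 0]
  proof eventually_elim
    case (elim n)
    then have "integrable M (\<lambda>\<omega>. sqrt (real n) ^ k * Z n \<omega>)"
      by (subst (asm) integrable_abs_iff) auto
    then show ?case using elim(3) by simp
  qed
qed

lemma negligible_mean_mean_order:
  assumes "mean_order 6 Z" shows "negligible_mean Z"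
  unfolding second_order_mean_def
proof
  show int: "\<forall>\<^sub>F n in sequentially. integrable M (Z n)" by (rule mean_order_integrable[OF assms])
  obtain K where "\<forall>\<^sub>F n in sequentially. integrable M (\<lambda>\<omega>. \<bar>sqrt (real n) ^ 6 * Z n \<omega>\<bar>)
     \<and> (\<integral>\<omega>. \<bar>sqrt (real n) ^ 6 * Z n \<omega>\<bar> \<partial>M) \<le> K"
    using assms unfolding mean_order_def by (blast elim: bounded_meanE)
  then have "\<forall>\<^sub>F n in sequentially. norm (\<integral>\<omega>. Z n \<omega> \<partial>M) \<le> K * norm (1 / real n ^ 3)"
    using eventually_gt_at_top[of 0]
  proof eventually_elim
    case (elim n)
    have r: "sqrt (real n) ^ 6 = real n ^ 3"
      using power_mult[of "sqrt (real n)" 2 3] by simp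
    have "\<bar>\<integral>\<omega>. sqrt (real n) ^ 6 * Z n \<omega> \<partial>M\<bar> \<le> (\<integral>\<omega>. \<bar>sqrt (real n) ^ 6 * Z n \<omega>\<bar> \<partial>M)"
      by (rule integral_abs_bound)
    then have "\<bar>real n ^ 3 * (\<integral>\<omega>. Z n \<omega> \<partial>M)\<bar> \<le> K" using elim(1) by (simp add: r)
    then show ?case using elim(2) by (simp add: abs_mult field_simps)
  qed
  then show "(\<lambda>n. (\<integral>\<omega>. Z n \<omega> \<partial>M) - 0 / (real n)\<^sup>2) \<in> O(\<lambda>n. 1 / real n ^ 3)"
    by (intro bigoI) simp
qed

lemma negligible_mean_moment_order: "moment_order 6 Z \<Longrightarrow> negligible_mean Z"
  by (intro negligible_mean_mean_order mean_order_if_moment_order)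

lemma negligible_mean_add:
  "negligible_mean Y \<Longrightarrow> negligible_mean Z \<Longrightarrow> negligible_mean (\<lambda>n \<omega>. Y n \<omega> + Z n \<omega>)"
  using second_order_mean_add[of Y 0 Z 0] by simp

end

context iid_sample_space begin

lemma expectation_prod_avg:
  "(\<integral>\<omega>. (\<Prod>y\<leftarrow>ys. avg y n \<omega>) \<partial>P) = total_moment n ys / real n ^ length ys"
proof -
  have "(\<Prod>y\<leftarrow>ys. avg y n \<omega>) = (\<Prod>y\<leftarrow>ys. obs_sum y n \<omega>) / real n ^ length ys" for \<omega>
    by (induction ys) (simp_all add: avg_def)
  then show ?thesis by (simp add: total_moment_def)
qed

lemma all_moments_avg: "all_moments N y \<Longrightarrow> all_moments P (avg y n)"
proof -
  assume "all_moments N y"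
  moreover have "avg y n = (\<lambda>\<omega>. 1 / real n * obs_sum y n \<omega>)" by (simp add: avg_def fun_eq_iff)
  ultimately show ?thesis using all_moments_cmult[OF all_moments_obs_sum] by (simp only:)
qed

text \<open>The moment of order \<open>2q\<close> of a sum of \<open>n\<close> observations grows like \<open>n\<^sup>q\<close>, and that of the
  average is smaller by \<open>n\<^bsup>2q\<^esup>\<close>.\<close>

lemma moment_order_avg:
  assumes "centred y" shows "moment_order 1 (avg y)"
proof (rule moment_order_even)
  have am: "all_moments N y" using assms by (simp add: centred_def)
  show "\<forall>\<^sub>F n in sequentially. avg y n \<in> borel_measurable P"
    by (intro always_eventually allI all_moments_measurable all_moments_avg am)
  fix q
  obtain K where K: "K \<ge> 0" "\<And>n. \<bar>total_moment n (replicate (2 * q) y)\<bar> \<le> K * real n ^ q"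
    using total_moment_bound[of "replicate (2 * q) y"] assms by auto
  have eq: "(sqrt (real n) ^ 1 * avg y n \<omega>) ^ (2 * q) = real n ^ q * (\<Prod>y\<leftarrow>replicate (2 * q) y. avg y n \<omega>)" for n \<omega>
    by (simp add: power_mult_distrib power_mult)
  have int: "integrable P (\<lambda>\<omega>. (\<Prod>y\<leftarrow>replicate (2 * q) y. avg y n \<omega>))" for n
    by (intro all_moments_integrable all_moments_prod_list all_moments_avg) (use am in auto)
  have "\<forall>\<^sub>F n in sequentially. integrable P (\<lambda>\<omega>. (sqrt (real n) ^ 1 * avg y n \<omega>) ^ (2 * q)) \<and>
      (\<integral>\<omega>. (sqrt (real n) ^ 1 * avg y n \<omega>) ^ (2 * q) \<partial>P) \<le> K"
    using eventually_gt_at_top[of 0]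
  proof eventually_elim
    case (elim n)
    have "(\<integral>\<omega>. (sqrt (real n) ^ 1 * avg y n \<omega>) ^ (2 * q) \<partial>P) =
        real n ^ q * (total_moment n (replicate (2 * q) y) / real n ^ (2 * q))"
      unfolding eq integral_mult_right_zero expectation_prod_avg by simp
    also have "\<dots> = total_moment n (replicate (2 * q) y) / real n ^ q"
      using elim by (simp add: power_mult power2_eq_square mult_2 power_add)
    also have "\<dots> \<le> K" using K(2)[of n] elim by (simp add: divide_le_eq)
    finally show ?case unfolding eq using int by simp
  qed
  then show "bounded_mean (\<lambda>n \<omega>. (sqrt (real n) ^ 1 * avg y n \<omega>) ^ (2 * q))"
    by (rule bounded_meanI)
qed

section \<open>Polynomials in centred averages\<close>

text \<open>Homogeneous polynomials of degree \<open>k\<close> in centred averages.  They are of order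
  \<open>n\<^bsup>-k/2\<^esup>\<close>, but for odd \<open>k\<close> their means are smaller by a further factor \<open>n\<^bsup>-1/2\<^esup>\<close>, which
  their order of magnitude alone does not show.\<close>

inductive hom :: "nat \<Rightarrow> (nat \<Rightarrow> 'w \<Rightarrow> real) \<Rightarrow> bool" where
  hom_zero: "hom k (\<lambda>n \<omega>. 0)"
| hom_monomial: "(\<And>y. y \<in> set ys \<Longrightarrow> centred y) \<Longrightarrow> length ys = k \<Longrightarrow> hom k (\<lambda>n \<omega>. c * (\<Prod>y\<leftarrow>ys. avg y n \<omega>))"
| hom_add: "hom k Y \<Longrightarrow> hom k Z \<Longrightarrow> hom k (\<lambda>n \<omega>. Y n \<omega> + Z n \<omega>)"

lemma hom_const: "hom 0 (\<lambda>n \<omega>. c)"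
  using hom_monomial[of "[]" 0 c] by simp

lemma hom_avg: "centred y \<Longrightarrow> hom 1 (avg y)"
  using hom_monomial[of "[y]" 1 1] by simp

lemma hom_sum: "(\<And>a. a \<in> A \<Longrightarrow> hom k (Z a)) \<Longrightarrow> hom k (\<lambda>n \<omega>. \<Sum>a\<in>A. Z a n \<omega>)"
  by (induction A rule: infinite_finite_induct) (auto intro: hom_zero hom_add)

lemma hom_mult:
  assumes "hom j Y" "hom k Z" shows "hom (j + k) (\<lambda>n \<omega>. Y n \<omega> * Z n \<omega>)"
  using assms
proof (induction arbitrary: k Z)
  case (hom_zero j) then show ?case by (simp add: hom.hom_zero)
next
  case (hom_add j Y Y')
  then show ?case using hom.hom_add[of "j + k"] by (simp add: distrib_right)
next
  case (hom_monomial ys j c)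
  from hom_monomial(3) show ?case
  proof (induction)
    case (hom_zero k) then show ?case by (simp add: hom.hom_zero)
  next
    case (hom_add k Z Z')
    then show ?case using hom.hom_add[of "j + k"] by (simp add: distrib_left)
  next
    case (hom_monomial zs k c')
    then show ?case
      using hom.hom_monomial[of "ys @ zs" "j + k" "c * c'"] \<open>\<And>y. y \<in> set ys \<Longrightarrow> centred y\<close> \<open>length ys = j\<close>
      by (auto simp: mult_ac)
  qed
qed

lemma hom_cmult: "hom k Z \<Longrightarrow> hom k (\<lambda>n \<omega>. c * Z n \<omega>)"
  using hom_mult[OF hom_const] by simp

lemma moment_order_monomial:
  "(\<And>y. y \<in> set ys \<Longrightarrow> centred y) \<Longrightarrow> moment_order (length ys) (\<lambda>n \<omega>. \<Prod>y\<leftarrow>ys. avg y n \<omega>)"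
proof (induction ys)
  case Nil then show ?case using moment_order_const[of 1] by simp
next
  case (Cons y ys)
  then show ?case using moment_order_mult[OF moment_order_avg[of y], of "length ys"] by simp
qed

lemma moment_order_hom: "hom k Z \<Longrightarrow> moment_order k Z"
  by (induction rule: hom.induct)
    (auto intro: moment_order_zero moment_order_add moment_order_cmult[OF moment_order_monomial])

text \<open>Five factors form at most two disjoint groups of two or more, so the mean is at most of order
  \<open>n\<^sup>2/n\<^sup>5\<close>.\<close>

lemma negligible_mean_hom5: "hom 5 Z \<Longrightarrow> negligible_mean Z"
proof (induction "5::nat" Z rule: hom.induct)
  case hom_zero
  show ?case by (rule negligible_mean_moment_order[OF moment_order_zero])
next
  case (hom_add Y Z)
  then show ?case by (intro negligible_mean_add)
next
  case (hom_monomial ys c)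
  have "hom 5 (\<lambda>n \<omega>. c * (\<Prod>y\<leftarrow>ys. avg y n \<omega>))" by (rule hom.hom_monomial) (use hom_monomial in auto)
  then have int: "\<forall>\<^sub>F n in sequentially. integrable P (\<lambda>\<omega>. c * (\<Prod>y\<leftarrow>ys. avg y n \<omega>))"
    by (intro mean_order_integrable mean_order_if_moment_order moment_order_hom)
  obtain K where K: "K \<ge> 0" "\<And>n. \<bar>total_moment n ys\<bar> \<le> K * real n ^ (length ys div 2)"
    using total_moment_bound[of ys] hom_monomial by blast
  have "\<forall>\<^sub>F n in sequentially. norm (\<integral>\<omega>. c * (\<Prod>y\<leftarrow>ys. avg y n \<omega>) \<partial>P) \<le> (\<bar>c\<bar> * K) * norm (1 / real n ^ 3)"
    using eventually_gt_at_top[of 0]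
  proof eventually_elim
    case (elim n)
    have "length ys div 2 = 2" using hom_monomial(2) by simp
    then have "\<bar>total_moment n ys\<bar> \<le> K * real n ^ 2" using K(2)[of n] by simp
    then have "\<bar>total_moment n ys\<bar> / real n ^ 5 \<le> K * real n ^ 2 / real n ^ 5"
      by (rule divide_right_mono) simp
    also have "\<dots> = K * (1 / real n ^ 3)" using elim by (simp add: field_simps eval_nat_numeral)
    finally have "\<bar>c\<bar> * (\<bar>total_moment n ys\<bar> / real n ^ 5) \<le> \<bar>c\<bar> * (K * (1 / real n ^ 3))"
      by (rule mult_left_mono) simp
    then show ?case
      by (simp add: expectation_prod_avg hom_monomial(2)[symmetric] abs_mult)
  qed
  then have "(\<lambda>n. \<integral>\<omega>. c * (\<Prod>y\<leftarrow>ys. avg y n \<omega>) \<partial>P) \<in> O(\<lambda>n. 1 / real n ^ 3)"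
    by (rule bigoI)
  then show ?case using int by (simp add: second_order_mean_def)
qed

lemma integrable_prod_avg:
  "(\<And>y. y \<in> set ys \<Longrightarrow> centred y) \<Longrightarrow> integrable P (\<lambda>\<omega>. \<Prod>y\<leftarrow>ys. avg y n \<omega>)"
  by (intro all_moments_integrable all_moments_prod_list all_moments_avg) (auto simp: centred_def)

lemma expectation_sum_avg2:
  fixes a b :: "'i \<Rightarrow> 'x \<Rightarrow> real"
  assumes "\<And>p. p \<in> I \<Longrightarrow> centred (a p)" "\<And>p. p \<in> I \<Longrightarrow> centred (b p)" "n > 0"
  shows "(\<integral>\<omega>. (\<Sum>p\<in>I. c p * (avg (a p) n \<omega> * avg (b p) n \<omega>)) \<partial>P) = (\<Sum>p\<in>I. c p * joint [a p, b p]) / real n"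
proof -
  have "integrable P (\<lambda>\<omega>. c p * (avg (a p) n \<omega> * avg (b p) n \<omega>))" if "p \<in> I" for p
    using integrable_prod_avg[of "[a p, b p]" n] assms that by auto
  then have "(\<integral>\<omega>. (\<Sum>p\<in>I. c p * (avg (a p) n \<omega> * avg (b p) n \<omega>)) \<partial>P) =
      (\<Sum>p\<in>I. \<integral>\<omega>. c p * (avg (a p) n \<omega> * avg (b p) n \<omega>) \<partial>P)"
    by (rule Bochner_Integration.integral_sum)
  also have "\<dots> = (\<Sum>p\<in>I. c p * joint [a p, b p] / real n)"
  proof (rule sum.cong)
    fix p assume "p \<in> I"
    then show "(\<integral>\<omega>. c p * (avg (a p) n \<omega> * avg (b p) n \<omega>) \<partial>P) = c p * joint [a p, b p] / real n"
      using expectation_prod_avg[of n "[a p, b p]"] assms by (simp add: total_moment_2)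
  qed simp
  finally show ?thesis by (simp add: sum_divide_distrib)
qed

end

section \<open>Inverting the likelihood equation\<close>

context prob_space begin

lemma moment_order_mult_le:
  "moment_order j Y \<Longrightarrow> moment_order k Z \<Longrightarrow> m \<le> j + k \<Longrightarrow> moment_order m (\<lambda>n \<omega>. Y n \<omega> * Z n \<omega>)"
  by (rule moment_order_mono[OF moment_order_mult])

end

context iid_sample_space begin

lemma hom_mult_eq:
  "hom j Y \<Longrightarrow> hom k Z \<Longrightarrow> m = j + k \<Longrightarrow> hom m (\<lambda>n \<omega>. Y n \<omega> * Z n \<omega>)"
  using hom_mult by simp

end

text \<open>The fixed point equation for the error \<open>d\<close>, with the upper index first.  The constants \<open>B0\<close>
  and \<open>C0\<close> are the means of the quadratic and cubic coefficients, and \<open>D0\<close> approximates the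
  coefficient of the remainder.\<close>

locale likelihood_expansion = iid_sample_space P N X
  for P :: "'w measure" and N :: "'x measure" and X :: "nat \<Rightarrow> 'w \<Rightarrow> 'x" +
  fixes e :: "'i::finite \<Rightarrow> nat \<Rightarrow> 'w \<Rightarrow> real" and A :: "'i \<Rightarrow> 'i \<Rightarrow> nat \<Rightarrow> 'w \<Rightarrow> real"
    and B :: "'i \<Rightarrow> 'i \<Rightarrow> 'i \<Rightarrow> nat \<Rightarrow> 'w \<Rightarrow> real" and C :: "'i \<Rightarrow> 'i \<Rightarrow> 'i \<Rightarrow> 'i \<Rightarrow> nat \<Rightarrow> 'w \<Rightarrow> real"
    and D :: "'i \<Rightarrow> 'i \<Rightarrow> 'i \<Rightarrow> 'i \<Rightarrow> 'i \<Rightarrow> nat \<Rightarrow> 'w \<Rightarrow> real"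
    and B0 :: "'i \<Rightarrow> 'i \<Rightarrow> 'i \<Rightarrow> real" and C0 :: "'i \<Rightarrow> 'i \<Rightarrow> 'i \<Rightarrow> 'i \<Rightarrow> real"
    and D0 :: "'i \<Rightarrow> 'i \<Rightarrow> 'i \<Rightarrow> 'i \<Rightarrow> 'i \<Rightarrow> real"
    and d :: "'i \<Rightarrow> nat \<Rightarrow> 'w \<Rightarrow> real"
  assumes hom_e: "hom 1 (e s)" and hom_A: "hom 1 (A s j)" and hom_B: "hom 1 (B s j k)"
    and hom_C: "hom 1 (C s j k l)"
    and order_d: "moment_order 1 (d s)" and order_D: "moment_order 0 (D s j k l m)"
    and order_D_dev: "bounded_mean (\<lambda>n \<omega>. (sqrt (real n) * (D s j k l m n \<omega> - D0 s j k l m))\<^sup>2)"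
    and equation: "\<forall>\<^sub>F n in sequentially. AE \<omega> in P. \<forall>s. d s n \<omega> = e s n \<omega>
      + (\<Sum>j\<in>UNIV. A s j n \<omega> * d j n \<omega>)
      + (\<Sum>j\<in>UNIV. \<Sum>k\<in>UNIV. (B s j k n \<omega> + B0 s j k) * (d j n \<omega> * d k n \<omega>))
      + (\<Sum>j\<in>UNIV. \<Sum>k\<in>UNIV. \<Sum>l\<in>UNIV. (C s j k l n \<omega> + C0 s j k l) * (d j n \<omega> * (d k n \<omega> * d l n \<omega>)))
      + (\<Sum>j\<in>UNIV. \<Sum>k\<in>UNIV. \<Sum>l\<in>UNIV. \<Sum>m\<in>UNIV.
          D s j k l m n \<omega> * (d j n \<omega> * (d k n \<omega> * (d l n \<omega> * d m n \<omega>))))"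
begin

abbreviation "dd j k n \<omega> \<equiv> d j n \<omega> * d k n \<omega>"
abbreviation "ddd j k l n \<omega> \<equiv> d j n \<omega> * dd k l n \<omega>"
abbreviation "dddd j k l m n \<omega> \<equiv> d j n \<omega> * ddd k l m n \<omega>"
abbreviation "ee j k n \<omega> \<equiv> e j n \<omega> * e k n \<omega>"
abbreviation "eee j k l n \<omega> \<equiv> e j n \<omega> * ee k l n \<omega>"
abbreviation "eeee j k l m n \<omega> \<equiv> e j n \<omega> * eee k l m n \<omega>"

text \<open>\<open>dk\<close> collects the terms of degree \<open>k\<close> that arise when \<open>e + d2 + \<dots>\<close> is substituted for \<open>d\<close>
  on the right-hand side of the equation.\<close>

definition d2 where "d2 s n \<omega> = (\<Sum>j\<in>UNIV. A s j n \<omega> * e j n \<omega>)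
  + (\<Sum>j\<in>UNIV. \<Sum>k\<in>UNIV. B0 s j k * ee j k n \<omega>)"

text \<open>The part of degree three in the product of two errors, and below those of degree four in products
  of two and of three errors.\<close>

abbreviation "pair3 j k n \<omega> \<equiv> e j n \<omega> * d2 k n \<omega> + d2 j n \<omega> * e k n \<omega>"

definition d3 where "d3 s n \<omega> = (\<Sum>j\<in>UNIV. A s j n \<omega> * d2 j n \<omega>)
  + (\<Sum>j\<in>UNIV. \<Sum>k\<in>UNIV. B s j k n \<omega> * ee j k n \<omega>)
  + (\<Sum>j\<in>UNIV. \<Sum>k\<in>UNIV. B0 s j k * pair3 j k n \<omega>)
  + (\<Sum>j\<in>UNIV. \<Sum>k\<in>UNIV. \<Sum>l\<in>UNIV. C0 s j k l * eee j k l n \<omega>)"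

abbreviation "pair4 j k n \<omega> \<equiv> e j n \<omega> * d3 k n \<omega> + d3 j n \<omega> * e k n \<omega> + d2 j n \<omega> * d2 k n \<omega>"

definition triple4 where "triple4 j k l n \<omega> = e j n \<omega> * (e k n \<omega> * d2 l n \<omega>)
  + e j n \<omega> * (d2 k n \<omega> * e l n \<omega>) + d2 j n \<omega> * ee k l n \<omega>"

definition d4 where "d4 s n \<omega> = (\<Sum>j\<in>UNIV. A s j n \<omega> * d3 j n \<omega>)
  + (\<Sum>j\<in>UNIV. \<Sum>k\<in>UNIV. B s j k n \<omega> * pair3 j k n \<omega>)
  + (\<Sum>j\<in>UNIV. \<Sum>k\<in>UNIV. B0 s j k * pair4 j k n \<omega>)
  + (\<Sum>j\<in>UNIV. \<Sum>k\<in>UNIV. \<Sum>l\<in>UNIV. C s j k l n \<omega> * eee j k l n \<omega>)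
  + (\<Sum>j\<in>UNIV. \<Sum>k\<in>UNIV. \<Sum>l\<in>UNIV. C0 s j k l * triple4 j k l n \<omega>)
  + (\<Sum>j\<in>UNIV. \<Sum>k\<in>UNIV. \<Sum>l\<in>UNIV. \<Sum>m\<in>UNIV.
      D0 s j k l m * eeee j k l m n \<omega>)"

lemma hom_d2: "hom 2 (d2 s)"
  unfolding d2_def[abs_def]
  by (intro hom_add hom_sum hom_cmult; rule hom_mult_eq, (rule hom_e hom_A)+, simp)

lemma hom_ee: "hom 2 (\<lambda>n \<omega>. ee j k n \<omega>)"
  by (rule hom_mult_eq[OF hom_e hom_e]) simp

lemma hom_eee: "hom 3 (\<lambda>n \<omega>. eee j k l n \<omega>)"
  by (rule hom_mult_eq[OF hom_e hom_ee]) simp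

lemma hom_eeee: "hom 4 (\<lambda>n \<omega>. eeee j k l m n \<omega>)"
  by (rule hom_mult_eq[OF hom_e hom_eee]) simp

lemma hom_pair3: "hom 3 (\<lambda>n \<omega>. pair3 j k n \<omega>)"
  by (intro hom_add; rule hom_mult_eq, (rule hom_e hom_d2)+, simp)

lemma hom_d3: "hom 3 (d3 s)"
  unfolding d3_def[abs_def]
  by (intro hom_add[of 3] hom_sum hom_cmult hom_pair3 hom_eee; rule hom_mult_eq, (rule hom_ee hom_A hom_B hom_d2 hom_e)+, simp)

lemma hom_pair4: "hom 4 (\<lambda>n \<omega>. pair4 j k n \<omega>)"
  by (intro hom_add; rule hom_mult_eq, (rule hom_e hom_d2 hom_d3)+, simp)

lemma hom_triple4: "hom 4 (triple4 j k l)"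
  unfolding triple4_def[abs_def]
  by (intro hom_add; rule hom_mult_eq[OF _ hom_mult_eq[OF _ _ refl]], (rule hom_e hom_d2)+, simp)

lemma hom_d4: "hom 4 (d4 s)"
proof -
  have "hom 4 (\<lambda>n \<omega>. B s j k n \<omega> * pair3 j k n \<omega>)" for j k
    by (rule hom_mult_eq[OF hom_B hom_pair3]) simp
  moreover have "hom 4 (\<lambda>n \<omega>. A s j n \<omega> * d3 j n \<omega>)" for j
    by (rule hom_mult_eq[OF hom_A hom_d3]) simp
  moreover have "hom 4 (\<lambda>n \<omega>. C s j k l n \<omega> * eee j k l n \<omega>)" for j k l
    by (rule hom_mult_eq[OF hom_C hom_eee]) simp
  ultimately show ?thesis
    unfolding d4_def[abs_def]
    by (intro hom_add[OF hom_add[OF hom_add[OF hom_add[OF hom_add]]]] hom_sum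
        hom_cmult[OF hom_pair4] hom_cmult[OF hom_triple4] hom_cmult[OF hom_eeee])
qed

text \<open>The errors after one to three terms of the expansion.  The fourth error \<open>r4\<close> leaves out the
  effect of replacing \<open>D\<close> by \<open>D0\<close>, whose order \<open>n\<^bsup>-5/2\<^esup>\<close> is known in mean only.\<close>

definition r1 where "r1 s n \<omega> = d s n \<omega> - e s n \<omega>"
definition r2 where "r2 s n \<omega> = r1 s n \<omega> - d2 s n \<omega>"
definition r3 where "r3 s n \<omega> = r2 s n \<omega> - d3 s n \<omega>"

definition residue where "residue s n \<omega> = (\<Sum>j\<in>UNIV. \<Sum>k\<in>UNIV. \<Sum>l\<in>UNIV. \<Sum>m\<in>UNIV.
  (D s j k l m n \<omega> - D0 s j k l m) * dddd j k l m n \<omega>)"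

definition r4 where "r4 s n \<omega> = r3 s n \<omega> - d4 s n \<omega> - residue s n \<omega>"

lemmas order_e = moment_order_hom[OF hom_e]
lemmas order_A = moment_order_hom[OF hom_A]
lemmas order_B = moment_order_hom[OF hom_B]
lemmas order_C = moment_order_hom[OF hom_C]
lemmas order_d2 = moment_order_hom[OF hom_d2]
lemmas order_d3 = moment_order_hom[OF hom_d3]
lemmas order_d4 = moment_order_hom[OF hom_d4]

lemma order_dd: "moment_order 2 (\<lambda>n \<omega>. dd j k n \<omega>)"
  by (rule moment_order_mult_le[OF order_d order_d]) simp

lemma order_ddd: "moment_order 3 (\<lambda>n \<omega>. ddd j k l n \<omega>)"
  by (rule moment_order_mult_le[OF order_d order_dd]) simp

lemma order_dddd: "moment_order 4 (\<lambda>n \<omega>. dddd j k l m n \<omega>)"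
  by (rule moment_order_mult_le[OF order_d order_ddd]) simp

lemma order_B': "moment_order 0 (\<lambda>n \<omega>. B s j k n \<omega> + B0 s j k)"
  by (intro moment_order_add moment_order_const moment_order_mono[OF order_B]) simp

lemma order_C': "moment_order 0 (\<lambda>n \<omega>. C s j k l n \<omega> + C0 s j k l)"
  by (intro moment_order_add moment_order_const moment_order_mono[OF order_C]) simp

lemma moment_order_measurable: "moment_order k Z \<Longrightarrow> \<forall>\<^sub>F n in sequentially. Z n \<in> borel_measurable P"
  by (simp add: moment_order_def)

lemma order_Dd: "m \<le> 4 \<Longrightarrow> moment_order m (\<lambda>n \<omega>. D s j k l p n \<omega> * dddd j k l p n \<omega>)"
  by (rule moment_order_mult_le[OF order_D order_dddd]) simp

lemma order_C'd: "m \<le> 3 \<Longrightarrow> moment_order m (\<lambda>n \<omega>. (C s j k l n \<omega> + C0 s j k l) * ddd j k l n \<omega>)"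
  by (rule moment_order_mult_le[OF order_C' order_ddd]) simp

text \<open>Subtracting the terms already found from the fixed point equation leaves products of higher degree
  and products of an earlier error with a factor of order \<open>n\<^bsup>-1/2\<^esup>\<close>.  So every substitution
  gains half an order.\<close>

lemma order_r1: "moment_order 2 (r1 s)"
proof -
  let ?Y = "\<lambda>n \<omega>. (\<Sum>j\<in>UNIV. A s j n \<omega> * d j n \<omega>)
      + (\<Sum>j\<in>UNIV. \<Sum>k\<in>UNIV. (B s j k n \<omega> + B0 s j k) * dd j k n \<omega>)
      + (\<Sum>j\<in>UNIV. \<Sum>k\<in>UNIV. \<Sum>l\<in>UNIV. (C s j k l n \<omega> + C0 s j k l) * ddd j k l n \<omega>)
      + (\<Sum>j\<in>UNIV. \<Sum>k\<in>UNIV. \<Sum>l\<in>UNIV. \<Sum>m\<in>UNIV. D s j k l m n \<omega> * dddd j k l m n \<omega>)"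
  \<comment> \<open>The nested addition rule separates just the outer summands and leaves each product intact.\<close>
  have "moment_order 2 ?Y"
    by (intro moment_order_add[OF moment_order_add[OF moment_order_add]] moment_order_sum
        order_Dd order_C'd moment_order_mult_le[OF order_A order_d] moment_order_mult_le[OF order_B' order_dd]) simp_all
  moreover have "moment_order 1 (r1 s)"
    unfolding r1_def[abs_def] by (intro moment_order_diff order_d order_e)
  moreover have "\<forall>\<^sub>F n in sequentially. AE \<omega> in P. r1 s n \<omega> = ?Y n \<omega>"
    using equation
  proof eventually_elim
    case (elim n)
    then show ?case
    proof eventually_elim
      case (elim \<omega>)
      from spec[OF elim, of s] show ?case unfolding r1_def by linarith
    qed
  qed
  ultimately show ?thesis by (rule moment_order_AE_cong[OF _ moment_order_measurable])
qed

lemma order_pair: "moment_order 3 (\<lambda>n \<omega>. dd j k n \<omega> - ee j k n \<omega>)"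
proof -
  have "moment_order 3 (\<lambda>n \<omega>. r1 j n \<omega> * d k n \<omega> + e j n \<omega> * r1 k n \<omega>)"
    by (intro moment_order_add; rule moment_order_mult_le, (rule order_e order_d order_r1)+, simp)
  then show ?thesis by (simp add: r1_def algebra_simps)
qed

lemma order_triple: "moment_order 4 (\<lambda>n \<omega>. ddd j k l n \<omega> - eee j k l n \<omega>)"
proof -
  have "moment_order 4 (\<lambda>n \<omega>. r1 j n \<omega> * dd k l n \<omega> + e j n \<omega> * (dd k l n \<omega> - ee k l n \<omega>))"
    by (intro moment_order_add moment_order_mult_le[OF order_r1 order_dd] moment_order_mult_le[OF order_e order_pair]) simp_all
  then show ?thesis by (simp add: r1_def algebra_simps)
qed

lemma order_quad: "moment_order 5 (\<lambda>n \<omega>. dddd j k l m n \<omega> - eeee j k l m n \<omega>)"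
proof -
  have "moment_order 5 (\<lambda>n \<omega>. r1 j n \<omega> * ddd k l m n \<omega>
      + e j n \<omega> * (ddd k l m n \<omega> - eee k l m n \<omega>))"
    by (intro moment_order_add moment_order_mult_le[OF order_r1 order_ddd] moment_order_mult_le[OF order_e order_triple]) simp_all
  then show ?thesis by (simp add: r1_def algebra_simps)
qed

lemma order_r2: "moment_order 3 (r2 s)"
proof -
  let ?Y = "\<lambda>n \<omega>. (\<Sum>j\<in>UNIV. A s j n \<omega> * r1 j n \<omega>)
      + (\<Sum>j\<in>UNIV. \<Sum>k\<in>UNIV. B s j k n \<omega> * dd j k n \<omega>)
      + (\<Sum>j\<in>UNIV. \<Sum>k\<in>UNIV. B0 s j k * (dd j k n \<omega> - ee j k n \<omega>))
      + (\<Sum>j\<in>UNIV. \<Sum>k\<in>UNIV. \<Sum>l\<in>UNIV. (C s j k l n \<omega> + C0 s j k l) * ddd j k l n \<omega>)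
      + (\<Sum>j\<in>UNIV. \<Sum>k\<in>UNIV. \<Sum>l\<in>UNIV. \<Sum>m\<in>UNIV. D s j k l m n \<omega> * dddd j k l m n \<omega>)"
  have "moment_order 3 ?Y"
    by (intro moment_order_add[OF moment_order_add[OF moment_order_add[OF moment_order_add]]] moment_order_sum
        order_Dd order_C'd moment_order_mult_le[OF order_A order_r1] moment_order_mult_le[OF order_B order_dd]
        moment_order_cmult[OF order_pair]) simp_all
  moreover have "moment_order 2 (r2 s)"
    unfolding r2_def[abs_def] by (intro moment_order_diff order_r1 order_d2)
  moreover have "\<forall>\<^sub>F n in sequentially. AE \<omega> in P. r2 s n \<omega> = ?Y n \<omega>"
    using equation
  proof eventually_elim
    case (elim n)
    then show ?case
    proof eventually_elim
      case (elim \<omega>)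
      from spec[OF elim, of s] show ?case
        unfolding r2_def r1_def d2_def right_diff_distrib distrib_right sum_subtractf sum.distrib by linarith
    qed
  qed
  ultimately show ?thesis by (rule moment_order_AE_cong[OF _ moment_order_measurable])
qed

lemma order_pair': "moment_order 4 (\<lambda>n \<omega>. dd j k n \<omega> - ee j k n \<omega>
  - pair3 j k n \<omega>)"
proof -
  have "moment_order 4 (\<lambda>n \<omega>. r1 j n \<omega> * r1 k n \<omega> + e j n \<omega> * r2 k n \<omega> + r2 j n \<omega> * e k n \<omega>)"
    by (intro moment_order_add; rule moment_order_mult_le, (rule order_e order_r2 order_r1)+, simp)
  then show ?thesis by (simp add: r1_def r2_def algebra_simps)
qed

lemma order_triple': "moment_order 5 (\<lambda>n \<omega>. ddd j k l n \<omega> - eee j k l n \<omega>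
  - triple4 j k l n \<omega>)"
proof -
  have "moment_order 5 (\<lambda>n \<omega>. r1 j n \<omega> * (dd k l n \<omega> - ee k l n \<omega>)
    + e j n \<omega> * (dd k l n \<omega> - ee k l n \<omega> - pair3 k l n \<omega>)
    + r2 j n \<omega> * ee k l n \<omega>)"
    by (intro moment_order_add moment_order_mult_le[OF order_r1 order_pair] moment_order_mult_le[OF order_e order_pair']
        moment_order_mult_le[OF order_r2 moment_order_hom[OF hom_ee]]) simp_all
  then show ?thesis by (simp add: r1_def r2_def triple4_def algebra_simps)
qed

lemma order_r3: "moment_order 4 (r3 s)"
proof -
  let ?Y = "\<lambda>n \<omega>. (\<Sum>j\<in>UNIV. A s j n \<omega> * r2 j n \<omega>)
      + (\<Sum>j\<in>UNIV. \<Sum>k\<in>UNIV. B s j k n \<omega> * (dd j k n \<omega> - ee j k n \<omega>))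
      + (\<Sum>j\<in>UNIV. \<Sum>k\<in>UNIV. B0 s j k * (dd j k n \<omega> - ee j k n \<omega>
          - pair3 j k n \<omega>))
      + (\<Sum>j\<in>UNIV. \<Sum>k\<in>UNIV. \<Sum>l\<in>UNIV. C s j k l n \<omega> * ddd j k l n \<omega>)
      + (\<Sum>j\<in>UNIV. \<Sum>k\<in>UNIV. \<Sum>l\<in>UNIV. C0 s j k l *
          (ddd j k l n \<omega> - eee j k l n \<omega>))
      + (\<Sum>j\<in>UNIV. \<Sum>k\<in>UNIV. \<Sum>l\<in>UNIV. \<Sum>m\<in>UNIV. D s j k l m n \<omega> * dddd j k l m n \<omega>)"
  have "moment_order 4 ?Y"
    by (intro moment_order_add[OF moment_order_add[OF moment_order_add[OF moment_order_add[OF moment_order_add]]]] moment_order_sum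
        order_Dd moment_order_mult_le[OF order_A order_r2] moment_order_mult_le[OF order_B order_pair]
        moment_order_cmult[OF order_pair'] moment_order_mult_le[OF order_C order_ddd]
        moment_order_cmult[OF order_triple]) simp_all
  moreover have "moment_order 3 (r3 s)"
    unfolding r3_def[abs_def] by (intro moment_order_diff order_r2 order_d3)
  moreover have "\<forall>\<^sub>F n in sequentially. AE \<omega> in P. r3 s n \<omega> = ?Y n \<omega>"
    using equation
  proof eventually_elim
    case (elim n)
    then show ?case
    proof eventually_elim
      case (elim \<omega>)
      have "r2 j n \<omega> = d j n \<omega> - e j n \<omega> - d2 j n \<omega>" for j by (simp add: r2_def r1_def)
      with spec[OF elim, of s] show ?case
        unfolding r3_def d3_def by (simp only: d2_def[of s] right_diff_distrib distrib_right sum_subtractf sum.distrib)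
    qed
  qed
  ultimately show ?thesis by (rule moment_order_AE_cong[OF _ moment_order_measurable])
qed

lemma order_pair'': "moment_order 5 (\<lambda>n \<omega>. dd j k n \<omega> - ee j k n \<omega>
  - pair3 j k n \<omega>
  - pair4 j k n \<omega>)"
proof -
  have "moment_order 5 (\<lambda>n \<omega>. e j n \<omega> * r3 k n \<omega> + r3 j n \<omega> * e k n \<omega> + d2 j n \<omega> * r2 k n \<omega> + r2 j n \<omega> * r1 k n \<omega>)"
    by (intro moment_order_add; rule moment_order_mult_le, (rule order_e order_d2 order_r3 order_r2 order_r1)+, simp)
  then show ?thesis by (simp add: r1_def r2_def r3_def algebra_simps)
qed

lemma order_r4: "moment_order 5 (r4 s)"
proof -
  let ?Y = "\<lambda>n \<omega>. (\<Sum>j\<in>UNIV. A s j n \<omega> * r3 j n \<omega>)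
      + (\<Sum>j\<in>UNIV. \<Sum>k\<in>UNIV. B s j k n \<omega> * (dd j k n \<omega> - ee j k n \<omega>
          - pair3 j k n \<omega>))
      + (\<Sum>j\<in>UNIV. \<Sum>k\<in>UNIV. B0 s j k * (dd j k n \<omega> - ee j k n \<omega>
          - pair3 j k n \<omega>
          - pair4 j k n \<omega>))
      + (\<Sum>j\<in>UNIV. \<Sum>k\<in>UNIV. \<Sum>l\<in>UNIV. C s j k l n \<omega> *
          (ddd j k l n \<omega> - eee j k l n \<omega>))
      + (\<Sum>j\<in>UNIV. \<Sum>k\<in>UNIV. \<Sum>l\<in>UNIV. C0 s j k l *
          (ddd j k l n \<omega> - eee j k l n \<omega> - triple4 j k l n \<omega>))
      + (\<Sum>j\<in>UNIV. \<Sum>k\<in>UNIV. \<Sum>l\<in>UNIV. \<Sum>m\<in>UNIV. D0 s j k l m *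
          (dddd j k l m n \<omega> - eeee j k l m n \<omega>))"
  have "moment_order 5 ?Y"
    by (intro moment_order_add[OF moment_order_add[OF moment_order_add[OF moment_order_add[OF moment_order_add]]]] moment_order_sum
        moment_order_mult_le[OF order_A order_r3] moment_order_mult_le[OF order_B order_pair']
        moment_order_cmult[OF order_pair''] moment_order_mult_le[OF order_C order_triple]
        moment_order_cmult[OF order_triple'] moment_order_cmult[OF order_quad]) simp_all
  moreover have "moment_order 0 (r4 s)"
    unfolding r4_def[abs_def] residue_def
    by (intro moment_order_diff moment_order_sum moment_order_mono[OF order_r3] moment_order_mono[OF order_d4]
        moment_order_mult_le[OF moment_order_diff[OF order_D moment_order_const] order_dddd]) simp_all
  moreover have "\<forall>\<^sub>F n in sequentially. AE \<omega> in P. r4 s n \<omega> = ?Y n \<omega>"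
    using equation
  proof eventually_elim
    case (elim n)
    then show ?case
    proof eventually_elim
      case (elim \<omega>)
      have "r3 j n \<omega> = d j n \<omega> - e j n \<omega> - d2 j n \<omega> - d3 j n \<omega>" for j by (simp add: r3_def r2_def r1_def)
      with spec[OF elim, of s] show ?case
        unfolding r4_def d4_def residue_def
        by (simp only: d2_def[of s] d3_def[of s] right_diff_distrib left_diff_distrib distrib_right sum_subtractf sum.distrib)
    qed
  qed
  ultimately show ?thesis by (rule moment_order_AE_cong[OF _ moment_order_measurable])
qed

lemma mean_order_residue: "mean_order 6 (\<lambda>n \<omega>. e i n \<omega> * residue s n \<omega>)"
proof -
  have o: "moment_order 5 (\<lambda>n \<omega>. d j n \<omega> * ddd k l m n \<omega> * e i n \<omega>)" for j k l m
    by (rule moment_order_mult_le[OF order_dddd order_e]) simp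
  have "mean_order (1 + 5) (\<lambda>n \<omega>. (D s j k l m n \<omega> - D0 s j k l m) *
      (d j n \<omega> * ddd k l m n \<omega> * e i n \<omega>))" for j k l m
    using order_D_dev[of s j k l m]
    by (intro mean_order_mult[OF _ _ o] moment_order_measurable[of 0] moment_order_diff order_D moment_order_const) simp
  then have "mean_order 6 (\<lambda>n \<omega>. \<Sum>j\<in>UNIV. \<Sum>k\<in>UNIV. \<Sum>l\<in>UNIV. \<Sum>m\<in>UNIV. (D s j k l m n \<omega> - D0 s j k l m) *
      (d j n \<omega> * ddd k l m n \<omega> * e i n \<omega>))"
    by (intro mean_order_sum) simp
  then show ?thesis by (simp add: residue_def sum_distrib_left mult_ac)
qed

text \<open>The only place where the order of \<open>r3\<close> does not suffice: the product is of order \<open>n\<^bsup>-5/2\<^esup>\<close>, but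
  its leading part \<open>e d4\<close> has odd degree, and the deviation of \<open>D\<close> from \<open>D0\<close> supplies another
  half order.\<close>

lemma negligible_e_r3: "negligible_mean (\<lambda>n \<omega>. e i n \<omega> * r3 s n \<omega>)"
proof -
  have "negligible_mean (\<lambda>n \<omega>. e i n \<omega> * d4 s n \<omega> + e i n \<omega> * r4 s n \<omega> + e i n \<omega> * residue s n \<omega>)"
    by (intro negligible_mean_add negligible_mean_hom5 hom_mult_eq[OF hom_e hom_d4]
        negligible_mean_moment_order moment_order_mult_le[OF order_e order_r4]
        negligible_mean_mean_order mean_order_residue) simp_all
  then show ?thesis by (simp add: r4_def algebra_simps)
qed

text \<open>In this and the next two lemmas one factor \<open>d\<close> after the other is replaced by its expansion.  What
  remains are polynomials of degree five, products of order \<open>n\<^sup>-\<^sup>3\<close>, and here also \<open>e r3\<close>.\<close>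

lemma second_moment_expansion:
  "negligible_mean (\<lambda>n \<omega>. dd i j n \<omega> - (ee i j n \<omega>
    + pair3 i j n \<omega>
    + pair4 i j n \<omega>))"
proof -
  have "negligible_mean (\<lambda>n \<omega>. e i n \<omega> * r3 j n \<omega> + e j n \<omega> * r3 i n \<omega>
      + (d2 i n \<omega> * d3 j n \<omega> + d3 i n \<omega> * d2 j n \<omega>)
      + (d2 i n \<omega> * r3 j n \<omega> + r3 i n \<omega> * d2 j n \<omega> + r2 i n \<omega> * r2 j n \<omega>))"
  proof (intro negligible_mean_add)
    show "negligible_mean (\<lambda>n \<omega>. e i n \<omega> * r3 j n \<omega>)" "negligible_mean (\<lambda>n \<omega>. e j n \<omega> * r3 i n \<omega>)"
      by (rule negligible_e_r3)+
    show "negligible_mean (\<lambda>n \<omega>. d2 i n \<omega> * d3 j n \<omega>)" "negligible_mean (\<lambda>n \<omega>. d3 i n \<omega> * d2 j n \<omega>)"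
      by (rule negligible_mean_hom5, rule hom_mult_eq, (rule hom_d2 hom_d3)+, simp)+
    show "negligible_mean (\<lambda>n \<omega>. d2 i n \<omega> * r3 j n \<omega>)" "negligible_mean (\<lambda>n \<omega>. r3 i n \<omega> * d2 j n \<omega>)"
      "negligible_mean (\<lambda>n \<omega>. r2 i n \<omega> * r2 j n \<omega>)"
      by (rule negligible_mean_moment_order, rule moment_order_mult_le, (rule order_d2 order_r2 order_r3)+, simp)+
  qed
  then show ?thesis by (simp add: r1_def r2_def r3_def algebra_simps)
qed

lemma third_moment_expansion:
  "negligible_mean (\<lambda>n \<omega>. ddd i j k n \<omega> - (eee i j k n \<omega> + triple4 i j k n \<omega>))"
proof -
  let ?s = "\<lambda>n \<omega>. dd j k n \<omega> - ee j k n \<omega> - pair3 j k n \<omega>"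
  have s: "moment_order 4 ?s" "moment_order 5 (\<lambda>n \<omega>. ?s n \<omega> - pair4 j k n \<omega>)"
    by (rule order_pair' order_pair'')+
  have "negligible_mean (\<lambda>n \<omega>. (d3 i n \<omega> * ee j k n \<omega> + d2 i n \<omega> * pair3 j k n \<omega> + e i n \<omega> * pair4 j k n \<omega>)
     + (r3 i n \<omega> * ee j k n \<omega> + r2 i n \<omega> * pair3 j k n \<omega> + r1 i n \<omega> * ?s n \<omega> + e i n \<omega> * (?s n \<omega> - pair4 j k n \<omega>)))"
    by (intro negligible_mean_add[OF negligible_mean_hom5 negligible_mean_moment_order]
        hom_add[of 5] hom_mult_eq[OF hom_d3 hom_ee] hom_mult_eq[OF hom_d2 hom_pair3] hom_mult_eq[OF hom_e hom_pair4]
        moment_order_add[of 6] moment_order_mult_le[OF order_r3 moment_order_hom[OF hom_ee]]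
        moment_order_mult_le[OF order_r2 moment_order_hom[OF hom_pair3]]
        moment_order_mult_le[OF order_r1 s(1)] moment_order_mult_le[OF order_e s(2)]) simp_all
  then show ?thesis by (simp add: r1_def r2_def r3_def triple4_def algebra_simps)
qed

lemma fourth_moment_expansion:
  "negligible_mean (\<lambda>n \<omega>. dddd i j k l n \<omega> - eeee i j k l n \<omega>)"
proof -
  let ?t = "\<lambda>n \<omega>. ddd j k l n \<omega> - eee j k l n \<omega>"
  have "negligible_mean (\<lambda>n \<omega>. (d2 i n \<omega> * eee j k l n \<omega> + e i n \<omega> * triple4 j k l n \<omega>)
    + (r2 i n \<omega> * eee j k l n \<omega> + r1 i n \<omega> * ?t n \<omega> + e i n \<omega> * (?t n \<omega> - triple4 j k l n \<omega>)))"
    by (intro negligible_mean_add[OF negligible_mean_hom5 negligible_mean_moment_order]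
        hom_add[of 5] hom_mult_eq[OF hom_d2 hom_eee] hom_mult_eq[OF hom_e hom_triple4]
        moment_order_add[of 6] moment_order_mult_le[OF order_r2 moment_order_hom[OF hom_eee]]
        moment_order_mult_le[OF order_r1 order_triple] moment_order_mult_le[OF order_e order_triple']) simp_all
  then show ?thesis by (simp add: r1_def r2_def algebra_simps)
qed

lemma fifth_moment_negligible:
  "negligible_mean (\<lambda>n \<omega>. d i n \<omega> * dddd j k l m n \<omega>)"
proof -
  let ?t = "\<lambda>n \<omega>. dddd j k l m n \<omega> - eeee j k l m n \<omega>"
  have "negligible_mean (\<lambda>n \<omega>. e i n \<omega> * eeee j k l m n \<omega>
    + (r1 i n \<omega> * eeee j k l m n \<omega> + d i n \<omega> * ?t n \<omega>))"
    by (intro negligible_mean_add[OF negligible_mean_hom5 negligible_mean_moment_order]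
        hom_mult_eq[OF hom_e hom_eeee]
        moment_order_add[of 6] moment_order_mult_le[OF order_r1 moment_order_hom[OF hom_eeee]]
        moment_order_mult_le[OF order_d order_quad]) simp_all
  then show ?thesis by (simp add: r1_def algebra_simps)
qed

end

section \<open>Means up to order \<open>n\<^sup>-\<^sup>2\<close>\<close>

context prob_space begin

lemma second_order_mean_contraction:
  fixes T :: "'i::finite \<Rightarrow> nat \<Rightarrow> 'a \<Rightarrow> real"
  assumes "\<And>n \<omega>. Z n \<omega> = (\<Sum>p\<in>UNIV. T p n \<omega>)" "\<And>p. second_order_mean (T p) (r * c p)"
  shows "second_order_mean Z (r * (\<Sum>p\<in>UNIV. c p))"
proof -
  have "Z = (\<lambda>n \<omega>. \<Sum>p\<in>UNIV. T p n \<omega>)" using assms(1) by (simp add: fun_eq_iff)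
  then show ?thesis
    using second_order_mean_sum[of UNIV T "\<lambda>p. r * c p"] assms(2) by (simp add: sum_distrib_left)
qed

end

context iid_sample_space begin

lemma second_order_mean_prod:
  assumes "\<And>y. y \<in> set ys \<Longrightarrow> centred y"
    and moment: "\<And>n. n > 0 \<Longrightarrow> total_moment n ys / real n ^ length ys = k / (real n)\<^sup>2 + K / real n ^ 3"
  shows "second_order_mean (\<lambda>n \<omega>. c * (\<Prod>y\<leftarrow>ys. avg y n \<omega>)) (c * k)"
  unfolding second_order_mean_def
proof
  show "\<forall>\<^sub>F n in sequentially. integrable P (\<lambda>\<omega>. c * (\<Prod>y\<leftarrow>ys. avg y n \<omega>))"
    using integrable_prod_avg[OF assms(1)] by simp
  have "\<forall>\<^sub>F n in sequentially. (\<integral>\<omega>. c * (\<Prod>y\<leftarrow>ys. avg y n \<omega>) \<partial>P) - c * k / (real n)\<^sup>2 = c * K * (1 / real n ^ 3)"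
    using eventually_gt_at_top[of 0]
    by eventually_elim (simp add: expectation_prod_avg moment distrib_left)
  then show "(\<lambda>n. (\<integral>\<omega>. c * (\<Prod>y\<leftarrow>ys. avg y n \<omega>) \<partial>P) - c * k / (real n)\<^sup>2) \<in> O(\<lambda>n. 1 / real n ^ 3)"
    by (subst landau_o.big.in_cong) (auto intro!: bigoI[of _ "\<bar>c * K\<bar>"] simp: abs_mult)
qed

lemma second_order_mean_avg3:
  assumes "centred a" "centred b" "centred d" "k = c * joint [a, b, d]"
  shows "second_order_mean (\<lambda>n \<omega>. c * (avg a n \<omega> * (avg b n \<omega> * avg d n \<omega>))) k"
proof -
  have "total_moment n [a, b, d] / real n ^ length [a, b, d] = joint [a, b, d] / (real n)\<^sup>2 + 0 / real n ^ 3"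
    if "n > 0" for n
    using that assms by (simp add: total_moment_3 power2_eq_square)
  from second_order_mean_prod[OF _ this, of c] show ?thesis using assms by auto
qed

lemma second_order_mean_avg4:
  assumes "centred a" "centred b" "centred d" "centred e" "k = c * wick a b d e"
  shows "second_order_mean (\<lambda>n \<omega>. c * (avg a n \<omega> * (avg b n \<omega> * (avg d n \<omega> * avg e n \<omega>)))) k"
proof -
  have "total_moment n [a, b, d, e] / real n ^ length [a, b, d, e] =
      wick a b d e / (real n)\<^sup>2 + (joint [a, b, d, e] - wick a b d e) / real n ^ 3" if "n > 0" for n
    using that assms by (simp add: total_moment_4 field_simps eval_nat_numeral)
  from second_order_mean_prod[OF _ this, of c] show ?thesis using assms by auto
qed

end

text \<open>In the application \<open>ld I\<close> is the partial derivative of the log-density along the indices \<open>I\<close> at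
  the projected parameter, and \<open>h\<close> is the inverse of the matrix of its negative mean second
  derivatives.\<close>

locale log_likelihood_moments = iid_sample_space P N X
  for P :: "'w measure" and N :: "'x measure" and X :: "nat \<Rightarrow> 'w \<Rightarrow> 'x" +
  fixes ld :: "'p::finite list \<Rightarrow> 'x \<Rightarrow> real" and h :: "'p \<Rightarrow> 'p \<Rightarrow> real"
  assumes ld_moments: "0 < length I \<Longrightarrow> length I \<le> 4 \<Longrightarrow> all_moments N (ld I)"
    and score_mean: "(\<integral>x. ld [i] x \<partial>N) = 0"
    and ld_perm: "mset I = mset J \<Longrightarrow> x \<in> space N \<Longrightarrow> ld I x = ld J x"
    and h_sym: "h i j = h j i"
begin

definition Lm :: "'p list list \<Rightarrow> real" where
  "Lm Is = (\<integral>x. (\<Prod>I\<leftarrow>Is. ld I x) \<partial>N)"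

text \<open>The coefficients list the indices inside one derivative in varying orders, which are all
  equivalent because partial derivatives commute.\<close>

lemma Lm_perm: "list_all2 (\<lambda>I J. mset I = mset J) Is Js \<Longrightarrow> Lm Is = Lm Js"
proof -
  assume *: "list_all2 (\<lambda>I J. mset I = mset J) Is Js"
  have "(\<Prod>I\<leftarrow>Is. ld I x) = (\<Prod>I\<leftarrow>Js. ld I x)" if "x \<in> space N" for x
    using * by induction (auto intro: ld_perm[OF _ that] arg_cong2[where f="(*)"])
  then show ?thesis unfolding Lm_def by (intro Bochner_Integration.integral_cong refl)
qed

abbreviation y where "y i \<equiv> ld [i]"
text \<open>The centred derivatives of second, third and fourth order.  The first index is the one that gets
  contracted with \<open>h\<close>; it belongs to the innermost derivative, that of the score.\<close>

definition z where "z i j x = ld [j, i] x - Lm [[i, j]]"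
definition w where "w i j k x = ld [j, k, i] x - Lm [[j, k, i]]"
definition v where "v i j k l x = ld [j, k, l, i] x - Lm [[j, k, l, i]]"

interpretation N: prob_space N by (rule prob_space_N)

lemma centred_y: "centred (y i)"
  by (simp add: centred_def ld_moments score_mean)

lemma centred_diff: "all_moments N u \<Longrightarrow> c = (\<integral>x. u x \<partial>N) \<Longrightarrow> centred (\<lambda>x. u x - c)"
  using N.all_moments_const[of "- c"] all_moments_add[of N u "\<lambda>_. - c"] all_moments_integrable[of N u]
  by (simp add: centred_def N.prob_space)

lemma centred_z: "centred (z i j)"
  unfolding z_def[abs_def] using Lm_perm[of "[[i, j]]" "[[j, i]]"]
  by (intro centred_diff ld_moments) (auto simp: Lm_def)

lemma centred_w: "centred (w i j k)"
  unfolding w_def[abs_def] by (intro centred_diff ld_moments) (auto simp: Lm_def)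

lemma centred_v: "centred (v i j k l)"
  unfolding v_def[abs_def] by (intro centred_diff ld_moments) (auto simp: Lm_def)

lemma Lm_score: "Lm [[i]] = 0" by (simp add: Lm_def score_mean)

lemma Lm_swap: "Lm [[a, b]] = Lm [[b, a]]" "Lm [[a, b], J] = Lm [[b, a], J]"
  "Lm [J, [a, b]] = Lm [J, [b, a]]"  "Lm [[a, b], J, K] = Lm [[b, a], J, K]"
  by (rule Lm_perm; simp add: list_all2_same)+

lemma integrable_ld: "list_all (\<lambda>I. 0 < length I \<and> length I \<le> 4) Is \<Longrightarrow> integrable N (\<lambda>x. \<Prod>I\<leftarrow>Is. ld I x)"
  by (intro all_moments_integrable N.all_moments_prod_list) (auto simp: list_all_iff intro: ld_moments)

lemma joint_y: "joint [y a, y b] = Lm [[a], [b]]" "joint [y a, y b, y c] = Lm [[a], [b], [c]]"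
  by (simp_all add: joint_def Lm_def)

lemma integral_centred:
  assumes "list_all (\<lambda>I. 0 < length I \<and> length I \<le> 4) (J # Is)" "list_all (\<lambda>I. 0 < length I \<and> length I \<le> 4) Is"
  shows "(\<integral>x. (ld J x - c) * (\<Prod>I\<leftarrow>Is. ld I x) \<partial>N) = Lm (J # Is) - c * Lm Is"
  using integrable_ld[OF assms(1)] integrable_ld[OF assms(2)] by (simp add: left_diff_distrib Lm_def)

lemma joint_zy: "joint [z a b, y c] = Lm [[a, b], [c]]"
  using integral_centred[of "[b, a]" "[[c]]"] Lm_swap(2)[of b a] by (simp add: joint_def z_def Lm_score)

lemma joint_wy: "joint [w a b c, y d] = Lm [[a, b, c], [d]]"
  using integral_centred[of "[b, c, a]" "[[d]]"] Lm_perm[of "[[b, c, a], [d]]" "[[a, b, c], [d]]"]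
  by (simp add: joint_def w_def Lm_score)

lemma joint_zyy: "joint [z a b, y c, y d] = Lm [[a, b], [c], [d]] - Lm [[a, b]] * Lm [[c], [d]]"
  using integral_centred[of "[b, a]" "[[c], [d]]"] Lm_swap(4)[of b a] by (simp add: joint_def z_def)

lemma joint_zz: "joint [z a b, z c d] = Lm [[a, b], [c, d]] - Lm [[a, b]] * Lm [[c, d]]"
proof -
  have "joint [z a b, z c d] = (\<integral>x. (\<Prod>I\<leftarrow>[[b, a], [d, c]]. ld I x) - Lm [[a, b]] * (\<Prod>I\<leftarrow>[[d, c]]. ld I x)
      - Lm [[c, d]] * (\<Prod>I\<leftarrow>[[b, a]]. ld I x) + Lm [[a, b]] * Lm [[c, d]] \<partial>N)"
    unfolding joint_def by (simp add: z_def algebra_simps)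
  also have "\<dots> = Lm [[b, a], [d, c]] - Lm [[a, b]] * Lm [[d, c]] - Lm [[c, d]] * Lm [[b, a]] + Lm [[a, b]] * Lm [[c, d]]"
    using integrable_ld[of "[[b, a], [d, c]]"] integrable_ld[of "[[d, c]]"] integrable_ld[of "[[b, a]]"]
    by (simp add: Lm_def N.prob_space)
  finally show ?thesis
    using Lm_perm[of "[[b, a], [d, c]]" "[[a, b], [c, d]]"] Lm_swap(1)[of b a] Lm_swap(1)[of d c] by simp
qed

lemmas joint_simps = joint_y joint_zy joint_wy joint_zyy joint_zz

text \<open>The coefficients of the fixed point equation.  The factors \<open>1/2\<close> and \<open>1/6\<close> are those of the
  Taylor expansion.\<close>

definition e where "e s n \<omega> = (\<Sum>a\<in>UNIV. h s a * avg (y a) n \<omega>)"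
definition A where "A s j n \<omega> = (\<Sum>a\<in>UNIV. h a s * avg (z a j) n \<omega>)"
definition B where "B s j k n \<omega> = (\<Sum>a\<in>UNIV. 1/2 * h a s * avg (w a j k) n \<omega>)"
definition C where "C s j k l n \<omega> = (\<Sum>a\<in>UNIV. 1/6 * h a s * avg (v a j k l) n \<omega>)"
definition B0 where "B0 s j k = (\<Sum>a\<in>UNIV. 1/2 * h a s * Lm [[j, k, a]])"
definition C0 where "C0 s j k l = (\<Sum>a\<in>UNIV. 1/6 * h a s * Lm [[j, k, l, a]])"
definition d2A where "d2A s n \<omega> = (\<Sum>j\<in>UNIV. A s j n \<omega> * e j n \<omega>)"
definition d2B where "d2B s n \<omega> = (\<Sum>j\<in>UNIV. \<Sum>k\<in>UNIV. B0 s j k * (e j n \<omega> * e k n \<omega>))"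

text \<open>Products and iterated sums are turned into a single sum over tuples, whose nesting follows that of
  the expression.\<close>

lemma sum_times_sum:
  fixes f :: "'a::finite \<Rightarrow> real" and g :: "'b::finite \<Rightarrow> real"
  shows "(\<Sum>a\<in>UNIV. f a) * (\<Sum>b\<in>UNIV. g b) = (\<Sum>p\<in>UNIV. f (fst p) * g (snd p))"
  by (simp add: sum_product sum.cartesian_product case_prod_unfold flip: UNIV_Times_UNIV)

lemma sum_of_sums:
  fixes f :: "'a::finite \<Rightarrow> 'b::finite \<Rightarrow> real"
  shows "(\<Sum>a\<in>UNIV. \<Sum>b\<in>UNIV. f a b) = (\<Sum>p\<in>UNIV. f (fst p) (snd p))"
  by (simp add: sum.cartesian_product case_prod_unfold flip: UNIV_Times_UNIV)

lemmas contraction = e_def A_def B_def B0_def C0_def d2A_def d2B_def sum_times_sum sum_of_sums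

text \<open>The products of total degree three and four in the expansions of the moments, one lemma for each.
  Unfolding the averages gives a sum over tuples of indices in the order in which they are
  contracted; a bijection of the tuples renames them as in the coefficients.  The mean of each
  product of averages is then its joint moment or the sum over its pairings.\<close>

lemma mean_e_d2A: "second_order_mean (\<lambda>n \<omega>. e i n \<omega> * d2A j n \<omega>)
  (\<Sum>(s, t, l, m)\<in>UNIV. h s j * h i t * h l m *
    (Lm [[s, l], [t], [m]] + (- Lm [[l, s]]) * Lm [[t], [m]]))"
proof (rule second_order_mean_contraction[where r = 1, simplified])
  show "e i n \<omega> * d2A j n \<omega> =
      (\<Sum>p\<in>UNIV. (\<lambda>(s, t, l, m) n \<omega>. (h s j * h i t * h l m) *
        (avg (z s l) n \<omega> * (avg (y t) n \<omega> * avg (y m) n \<omega>))) p n \<omega>)" for n \<omega>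
    unfolding contraction
    by (rule sum.reindex_bij_witness[where i = "\<lambda>(s, t, l, m). (t, l, s, m)"
          and j = "\<lambda>(t, l, s, m). (s, t, l, m)"])
      (auto simp: h_sym mult_ac)
qed (simp only: split_paired_all prod.case, rule second_order_mean_avg3,
    (rule centred_y centred_z centred_w)+, simp add: joint_simps wick_def Lm_swap algebra_simps)

lemma mean_e_d2B: "second_order_mean (\<lambda>n \<omega>. e i n \<omega> * d2B j n \<omega>)
  (1/2 * (\<Sum>(k, l, m, s, t, u)\<in>UNIV. h u j * h i k * h l s * h m t *
    Lm [[k], [s], [t]] * Lm [[l, m, u]]))"
proof (rule second_order_mean_contraction)
  show "e i n \<omega> * d2B j n \<omega> =
      (\<Sum>p\<in>UNIV. (\<lambda>(k, l, m, s, t, u) n \<omega>. 1/2 * (h u j * h i k * h l s * h m t * Lm [[l, m, u]]) *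
        (avg (y k) n \<omega> * (avg (y s) n \<omega> * avg (y t) n \<omega>))) p n \<omega>)" for n \<omega>
    unfolding contraction
    by (rule sum.reindex_bij_witness[where i = "\<lambda>(k, l, m, s, t, u). (k, l, m, u, s, t)"
          and j = "\<lambda>(k, l, m, u, s, t). (k, l, m, s, t, u)"])
      (auto simp: h_sym mult_ac)
qed (simp only: split_paired_all prod.case, rule second_order_mean_avg3,
    (rule centred_y centred_z centred_w)+, simp add: joint_simps wick_def Lm_swap algebra_simps)

lemma mean_e_A_d2A: "second_order_mean (\<lambda>n \<omega>. e i n \<omega> * (\<Sum>l\<in>UNIV. A j l n \<omega> * d2A l n \<omega>))
  (\<Sum>(k, l, m, s, t, u)\<in>UNIV. h j k * h l u * h i s * h m t *
    (Lm [[k, l], [u, m]] * Lm [[s], [t]] - (- Lm [[k, l]]) * (- Lm [[u, m]]) * Lm [[s], [t]] + Lm [[k, l], [s]] * Lm [[u, m], [t]] + Lm [[k, l], [t]] * Lm [[u, m], [s]]))"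
proof (rule second_order_mean_contraction[where r = 1, simplified])
  show "e i n \<omega> * (\<Sum>l\<in>UNIV. A j l n \<omega> * d2A l n \<omega>) =
      (\<Sum>p\<in>UNIV. (\<lambda>(k, l, m, s, t, u) n \<omega>. (h j k * h l u * h i s * h m t) *
        (avg (z k l) n \<omega> * (avg (z u m) n \<omega> * (avg (y s) n \<omega> * avg (y t) n \<omega>)))) p n \<omega>)" for n \<omega>
    unfolding contraction
    by (rule sum.reindex_bij_witness[where i = "\<lambda>(k, l, m, s, t, u). (s, l, k, m, u, t)"
          and j = "\<lambda>(s, l, k, m, u, t). (k, l, m, s, t, u)"])
      (auto simp: h_sym mult_ac)
qed (simp only: split_paired_all prod.case, rule second_order_mean_avg4,
    (rule centred_y centred_z centred_w)+, simp add: joint_simps wick_def Lm_swap algebra_simps)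

lemma mean_e_A_d2B: "second_order_mean (\<lambda>n \<omega>. e i n \<omega> * (\<Sum>l\<in>UNIV. A j l n \<omega> * d2B l n \<omega>))
  (1/2 * (\<Sum>(k, l, m, s, t, u, v, w)\<in>UNIV. h j k * h i t * h m u * h s v * h w l * Lm [[m, s, w]] *
    (Lm [[l, k], [t]] * Lm [[u], [v]] + Lm [[l, k], [u]] * Lm [[t], [v]] + Lm [[l, k], [v]] * Lm [[t], [u]])))"
proof (rule second_order_mean_contraction)
  show "e i n \<omega> * (\<Sum>l\<in>UNIV. A j l n \<omega> * d2B l n \<omega>) =
      (\<Sum>p\<in>UNIV. (\<lambda>(k, l, m, s, t, u, v, w) n \<omega>. 1/2 * (h j k * h i t * h m u * h s v * h w l * Lm [[m, s, w]]) *
        (avg (z k l) n \<omega> * (avg (y t) n \<omega> * (avg (y u) n \<omega> * avg (y v) n \<omega>)))) p n \<omega>)" for n \<omega>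
    unfolding contraction
    by (rule sum.reindex_bij_witness[where i = "\<lambda>(k, l, m, s, t, u, v, w). (t, l, k, m, s, w, u, v)"
          and j = "\<lambda>(t, l, k, m, s, w, u, v). (k, l, m, s, t, u, v, w)"])
      (auto simp: h_sym mult_ac)
qed (simp only: split_paired_all prod.case, rule second_order_mean_avg4,
    (rule centred_y centred_z centred_w)+, simp add: joint_simps wick_def Lm_swap algebra_simps)

lemma mean_e_B_ee: "second_order_mean (\<lambda>n \<omega>. e i n \<omega> * (\<Sum>l\<in>UNIV. (\<Sum>m\<in>UNIV. B j l m n \<omega> * (e l n \<omega> * e m n \<omega>))))
  (1/2 * (\<Sum>(l, m, s, t, u, v)\<in>UNIV. h j s * h i t * h l u * h m v *
    (Lm [[s, l, m], [t]] * Lm [[u], [v]] + Lm [[s, l, m], [u]] * Lm [[t], [v]] + Lm [[s, l, m], [v]] * Lm [[t], [u]])))"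
proof (rule second_order_mean_contraction)
  show "e i n \<omega> * (\<Sum>l\<in>UNIV. (\<Sum>m\<in>UNIV. B j l m n \<omega> * (e l n \<omega> * e m n \<omega>))) =
      (\<Sum>p\<in>UNIV. (\<lambda>(l, m, s, t, u, v) n \<omega>. 1/2 * (h j s * h i t * h l u * h m v) *
        (avg (w s l m) n \<omega> * (avg (y t) n \<omega> * (avg (y u) n \<omega> * avg (y v) n \<omega>)))) p n \<omega>)" for n \<omega>
    unfolding contraction
    by (rule sum.reindex_bij_witness[where i = "\<lambda>(l, m, s, t, u, v). (t, l, m, s, u, v)"
          and j = "\<lambda>(t, l, m, s, u, v). (l, m, s, t, u, v)"])
      (auto simp: h_sym mult_ac)
qed (simp only: split_paired_all prod.case, rule second_order_mean_avg4,
    (rule centred_y centred_z centred_w)+, simp add: joint_simps wick_def Lm_swap algebra_simps)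

lemma mean_e_B0_e_d2A: "second_order_mean (\<lambda>n \<omega>. e i n \<omega> * (\<Sum>l\<in>UNIV. (\<Sum>m\<in>UNIV. B0 j l m * (e l n \<omega> * d2A m n \<omega>))))
  (1/2 * (\<Sum>(k, l, m, s, t, u, v, w)\<in>UNIV. h m t * h i u * h l v * h s w * h k j * Lm [[l, m, k]] *
    (Lm [[t, s], [u]] * Lm [[v], [w]] + Lm [[t, s], [v]] * Lm [[u], [w]] + Lm [[t, s], [w]] * Lm [[u], [v]])))"
proof (rule second_order_mean_contraction)
  show "e i n \<omega> * (\<Sum>l\<in>UNIV. (\<Sum>m\<in>UNIV. B0 j l m * (e l n \<omega> * d2A m n \<omega>))) =
      (\<Sum>p\<in>UNIV. (\<lambda>(k, l, m, s, t, u, v, w) n \<omega>. 1/2 * (h m t * h i u * h l v * h s w * h k j * Lm [[l, m, k]]) *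
        (avg (z t s) n \<omega> * (avg (y u) n \<omega> * (avg (y v) n \<omega> * avg (y w) n \<omega>)))) p n \<omega>)" for n \<omega>
    unfolding contraction
    by (rule sum.reindex_bij_witness[where i = "\<lambda>(k, l, m, s, t, u, v, w). (u, l, m, k, v, s, t, w)"
          and j = "\<lambda>(u, l, m, k, v, s, t, w). (k, l, m, s, t, u, v, w)"])
      (auto simp: h_sym mult_ac)
qed (simp only: split_paired_all prod.case, rule second_order_mean_avg4,
    (rule centred_y centred_z centred_w)+, simp add: joint_simps wick_def Lm_swap algebra_simps)

lemma mean_e_B0_e_d2B: "second_order_mean (\<lambda>n \<omega>. e i n \<omega> * (\<Sum>l\<in>UNIV. (\<Sum>m\<in>UNIV. B0 j l m * (e l n \<omega> * d2B m n \<omega>))))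
  (1/4 * (\<Sum>(k, l, m, q, r, s, t, u, v, w)\<in>UNIV. h i k * h l u * h s v * h t w * h r j * h q m * Lm [[l, m, r]] * Lm [[s, t, q]] *
    (Lm [[k], [u]] * Lm [[v], [w]] + Lm [[k], [v]] * Lm [[u], [w]] + Lm [[k], [w]] * Lm [[u], [v]])))"
proof (rule second_order_mean_contraction)
  show "e i n \<omega> * (\<Sum>l\<in>UNIV. (\<Sum>m\<in>UNIV. B0 j l m * (e l n \<omega> * d2B m n \<omega>))) =
      (\<Sum>p\<in>UNIV. (\<lambda>(k, l, m, q, r, s, t, u, v, w) n \<omega>. 1/4 * (h i k * h l u * h s v * h t w * h r j * h q m * Lm [[l, m, r]] * Lm [[s, t, q]]) *
        (avg (y k) n \<omega> * (avg (y u) n \<omega> * (avg (y v) n \<omega> * avg (y w) n \<omega>)))) p n \<omega>)" for n \<omega>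
    unfolding contraction
    by (rule sum.reindex_bij_witness[where i = "\<lambda>(k, l, m, q, r, s, t, u, v, w). (k, l, m, r, u, s, t, q, v, w)"
          and j = "\<lambda>(k, l, m, r, u, s, t, q, v, w). (k, l, m, q, r, s, t, u, v, w)"])
      (auto simp: h_sym mult_ac)
qed (simp only: split_paired_all prod.case, rule second_order_mean_avg4,
    (rule centred_y centred_z centred_w)+, simp add: joint_simps wick_def Lm_swap algebra_simps)

lemma mean_e_C0_eee: "second_order_mean (\<lambda>n \<omega>. e i n \<omega> * (\<Sum>l\<in>UNIV. (\<Sum>m\<in>UNIV. (\<Sum>t\<in>UNIV. C0 j l m t * (e l n \<omega> * (e m n \<omega> * e t n \<omega>))))))
  (1/6 * (\<Sum>(k, l, m, s, t, u, v, w)\<in>UNIV. h i k * h l s * h m u * h t v * h w j * Lm [[l, m, t, w]] *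
    (Lm [[k], [s]] * Lm [[u], [v]] + Lm [[k], [u]] * Lm [[s], [v]] + Lm [[k], [v]] * Lm [[s], [u]])))"
proof (rule second_order_mean_contraction)
  show "e i n \<omega> * (\<Sum>l\<in>UNIV. (\<Sum>m\<in>UNIV. (\<Sum>t\<in>UNIV. C0 j l m t * (e l n \<omega> * (e m n \<omega> * e t n \<omega>))))) =
      (\<Sum>p\<in>UNIV. (\<lambda>(k, l, m, s, t, u, v, w) n \<omega>. 1/6 * (h i k * h l s * h m u * h t v * h w j * Lm [[l, m, t, w]]) *
        (avg (y k) n \<omega> * (avg (y s) n \<omega> * (avg (y u) n \<omega> * avg (y v) n \<omega>)))) p n \<omega>)" for n \<omega>
    unfolding contraction
    by (rule sum.reindex_bij_witness[where i = "\<lambda>(k, l, m, s, t, u, v, w). (k, l, m, t, w, s, u, v)"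
          and j = "\<lambda>(k, l, m, t, w, s, u, v). (k, l, m, s, t, u, v, w)"])
      (auto simp: h_sym mult_ac)
qed (simp only: split_paired_all prod.case, rule second_order_mean_avg4,
    (rule centred_y centred_z centred_w)+, simp add: joint_simps wick_def Lm_swap algebra_simps)

lemma mean_d2A_d2A: "second_order_mean (\<lambda>n \<omega>. d2A i n \<omega> * d2A j n \<omega>)
  (\<Sum>(k, l, m, s, t, u)\<in>UNIV. h i k * h j s * h l t * h m u *
    (Lm [[k, l], [s, m]] * Lm [[t], [u]] - (- Lm [[k, l]]) * (- Lm [[s, m]]) * Lm [[t], [u]] + Lm [[k, l], [t]] * Lm [[s, m], [u]] + Lm [[k, l], [u]] * Lm [[s, m], [t]]))"
proof (rule second_order_mean_contraction[where r = 1, simplified])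
  show "d2A i n \<omega> * d2A j n \<omega> =
      (\<Sum>p\<in>UNIV. (\<lambda>(k, l, m, s, t, u) n \<omega>. (h i k * h j s * h l t * h m u) *
        (avg (z k l) n \<omega> * (avg (z s m) n \<omega> * (avg (y t) n \<omega> * avg (y u) n \<omega>)))) p n \<omega>)" for n \<omega>
    unfolding contraction
    by (rule sum.reindex_bij_witness[where i = "\<lambda>(k, l, m, s, t, u). ((l, k, t), m, s, u)"
          and j = "\<lambda>((l, k, t), m, s, u). (k, l, m, s, t, u)"])
      (auto simp: h_sym mult_ac)
qed (simp only: split_paired_all prod.case, rule second_order_mean_avg4,
    (rule centred_y centred_z centred_w)+, simp add: joint_simps wick_def Lm_swap algebra_simps)

lemma mean_d2A_d2B: "second_order_mean (\<lambda>n \<omega>. d2A i n \<omega> * d2B j n \<omega>)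
  (1/2 * (\<Sum>(k, l, m, s, t, u, v, w)\<in>UNIV. h i k * h l u * h s v * h t w * h j m * Lm [[s, t, m]] *
    (Lm [[k, l], [u]] * Lm [[v], [w]] + Lm [[k, l], [v]] * Lm [[u], [w]] + Lm [[k, l], [w]] * Lm [[u], [v]])))"
proof (rule second_order_mean_contraction)
  show "d2A i n \<omega> * d2B j n \<omega> =
      (\<Sum>p\<in>UNIV. (\<lambda>(k, l, m, s, t, u, v, w) n \<omega>. 1/2 * (h i k * h l u * h s v * h t w * h j m * Lm [[s, t, m]]) *
        (avg (z k l) n \<omega> * (avg (y u) n \<omega> * (avg (y v) n \<omega> * avg (y w) n \<omega>)))) p n \<omega>)" for n \<omega>
    unfolding contraction
    by (rule sum.reindex_bij_witness[where i = "\<lambda>(k, l, m, s, t, u, v, w). ((l, k, u), s, t, m, v, w)"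
          and j = "\<lambda>((l, k, u), s, t, m, v, w). (k, l, m, s, t, u, v, w)"])
      (auto simp: h_sym mult_ac)
qed (simp only: split_paired_all prod.case, rule second_order_mean_avg4,
    (rule centred_y centred_z centred_w)+, simp add: joint_simps wick_def Lm_swap algebra_simps)

lemma mean_d2B_d2B: "second_order_mean (\<lambda>n \<omega>. d2B i n \<omega> * d2B j n \<omega>)
  (1/4 * (\<Sum>(k, l, m, q, r, s, t, u, v, w)\<in>UNIV. h l k * h m u * h s v * h t w * h i r * h j q * Lm [[l, m, r]] * Lm [[s, t, q]] *
    (Lm [[k], [u]] * Lm [[v], [w]] + Lm [[k], [v]] * Lm [[u], [w]] + Lm [[k], [w]] * Lm [[u], [v]])))"
proof (rule second_order_mean_contraction)
  show "d2B i n \<omega> * d2B j n \<omega> =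
      (\<Sum>p\<in>UNIV. (\<lambda>(k, l, m, q, r, s, t, u, v, w) n \<omega>. 1/4 * (h l k * h m u * h s v * h t w * h i r * h j q * Lm [[l, m, r]] * Lm [[s, t, q]]) *
        (avg (y k) n \<omega> * (avg (y u) n \<omega> * (avg (y v) n \<omega> * avg (y w) n \<omega>)))) p n \<omega>)" for n \<omega>
    unfolding contraction
    by (rule sum.reindex_bij_witness[where i = "\<lambda>(k, l, m, q, r, s, t, u, v, w). ((l, m, r, k, u), s, t, q, v, w)"
          and j = "\<lambda>((l, m, r, k, u), s, t, q, v, w). (k, l, m, q, r, s, t, u, v, w)"])
      (auto simp: h_sym mult_ac)
qed (simp only: split_paired_all prod.case, rule second_order_mean_avg4,
    (rule centred_y centred_z centred_w)+, simp add: joint_simps wick_def Lm_swap algebra_simps)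

lemma mean_eee: "second_order_mean (\<lambda>n \<omega>. e i n \<omega> * (e j n \<omega> * e k n \<omega>))
  (\<Sum>(s, t, u)\<in>UNIV. h i s * h j t * h k u *
    Lm [[s], [t], [u]])"
proof (rule second_order_mean_contraction[where r = 1, simplified])
  show "e i n \<omega> * (e j n \<omega> * e k n \<omega>) =
      (\<Sum>p\<in>UNIV. (\<lambda>(s, t, u) n \<omega>. (h i s * h j t * h k u) *
        (avg (y s) n \<omega> * (avg (y t) n \<omega> * avg (y u) n \<omega>))) p n \<omega>)" for n \<omega>
    unfolding contraction
    by (rule sum.reindex_bij_witness[where i = "\<lambda>(s, t, u). (s, t, u)"
          and j = "\<lambda>(s, t, u). (s, t, u)"])
      (auto simp: h_sym mult_ac)
qed (simp only: split_paired_all prod.case, rule second_order_mean_avg3,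
    (rule centred_y centred_z centred_w)+, simp add: joint_simps wick_def Lm_swap algebra_simps)

lemma mean_d2A_ee: "second_order_mean (\<lambda>n \<omega>. d2A i n \<omega> * (e j n \<omega> * e k n \<omega>))
  (\<Sum>(s, t, u, v, w)\<in>UNIV. h i t * h s u * h j v * h k w *
    (Lm [[s, t], [u]] * Lm [[v], [w]] + Lm [[s, t], [v]] * Lm [[u], [w]] + Lm [[s, t], [w]] * Lm [[u], [v]]))"
proof (rule second_order_mean_contraction[where r = 1, simplified])
  show "d2A i n \<omega> * (e j n \<omega> * e k n \<omega>) =
      (\<Sum>p\<in>UNIV. (\<lambda>(s, t, u, v, w) n \<omega>. (h i t * h s u * h j v * h k w) *
        (avg (z t s) n \<omega> * (avg (y u) n \<omega> * (avg (y v) n \<omega> * avg (y w) n \<omega>)))) p n \<omega>)" for n \<omega>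
    unfolding contraction
    by (rule sum.reindex_bij_witness[where i = "\<lambda>(s, t, u, v, w). ((s, t, u), v, w)"
          and j = "\<lambda>((s, t, u), v, w). (s, t, u, v, w)"])
      (auto simp: h_sym mult_ac)
qed (simp only: split_paired_all prod.case, rule second_order_mean_avg4,
    (rule centred_y centred_z centred_w)+, simp add: joint_simps wick_def Lm_swap algebra_simps)

lemma mean_d2B_ee: "second_order_mean (\<lambda>n \<omega>. d2B i n \<omega> * (e j n \<omega> * e k n \<omega>))
  (1/2 * (\<Sum>(l, m, s, t, u, v, w)\<in>UNIV. h s u * h t v * h j w * h k m * h i l * Lm [[s, t, l]] *
    (Lm [[u], [v]] * Lm [[w], [m]] + Lm [[u], [w]] * Lm [[v], [m]] + Lm [[u], [m]] * Lm [[v], [w]])))"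
proof (rule second_order_mean_contraction)
  show "d2B i n \<omega> * (e j n \<omega> * e k n \<omega>) =
      (\<Sum>p\<in>UNIV. (\<lambda>(l, m, s, t, u, v, w) n \<omega>. 1/2 * (h s u * h t v * h j w * h k m * h i l * Lm [[s, t, l]]) *
        (avg (y u) n \<omega> * (avg (y v) n \<omega> * (avg (y w) n \<omega> * avg (y m) n \<omega>)))) p n \<omega>)" for n \<omega>
    unfolding contraction
    by (rule sum.reindex_bij_witness[where i = "\<lambda>(l, m, s, t, u, v, w). ((s, t, l, u, v), w, m)"
          and j = "\<lambda>((s, t, l, u, v), w, m). (l, m, s, t, u, v, w)"])
      (auto simp: h_sym mult_ac)
qed (simp only: split_paired_all prod.case, rule second_order_mean_avg4,
    (rule centred_y centred_z centred_w)+, simp add: joint_simps wick_def Lm_swap algebra_simps)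

lemma mean_eeee: "second_order_mean (\<lambda>n \<omega>. e i n \<omega> * (e j n \<omega> * (e k n \<omega> * e l n \<omega>)))
  (\<Sum>(s, t, u, v)\<in>UNIV. h i s * h j t * h k u * h l v *
    (Lm [[s], [t]] * Lm [[u], [v]] + Lm [[s], [u]] * Lm [[t], [v]] + Lm [[s], [v]] * Lm [[t], [u]]))"
proof (rule second_order_mean_contraction[where r = 1, simplified])
  show "e i n \<omega> * (e j n \<omega> * (e k n \<omega> * e l n \<omega>)) =
      (\<Sum>p\<in>UNIV. (\<lambda>(s, t, u, v) n \<omega>. (h i s * h j t * h k u * h l v) *
        (avg (y s) n \<omega> * (avg (y t) n \<omega> * (avg (y u) n \<omega> * avg (y v) n \<omega>)))) p n \<omega>)" for n \<omega>
    unfolding contraction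
    by (rule sum.reindex_bij_witness[where i = "\<lambda>(s, t, u, v). (s, t, u, v)"
          and j = "\<lambda>(s, t, u, v). (s, t, u, v)"])
      (auto simp: h_sym mult_ac)
qed (simp only: split_paired_all prod.case, rule second_order_mean_avg4,
    (rule centred_y centred_z centred_w)+, simp add: joint_simps wick_def Lm_swap algebra_simps)

end

context log_likelihood_moments begin

section \<open>The moments of the estimation error\<close>

lemma hom_e: "hom 1 (e s)"
  unfolding e_def[abs_def] by (intro hom_sum hom_cmult hom_avg centred_y)

lemma hom_A: "hom 1 (A s j)"
  unfolding A_def[abs_def] by (intro hom_sum hom_cmult hom_avg centred_z)

lemma hom_B: "hom 1 (B s j k)"
  unfolding B_def[abs_def] by (intro hom_sum hom_cmult hom_avg centred_w)

lemma hom_C: "hom 1 (C s j k l)"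
  unfolding C_def[abs_def] by (intro hom_sum hom_cmult hom_avg centred_v)

lemma B0_sym: "B0 s j k = B0 s k j"
  unfolding B0_def using Lm_perm[of "[[j, k, _]]" "[[k, j, _]]"] by simp

text \<open>The two mixed terms of a square coincide.  Occurring twice, they absorb one factor \<open>1/2\<close> of the
  Taylor expansion.\<close>

lemma B0_symmetric_sum:
  fixes u u' :: "'p \<Rightarrow> real"
  shows "(\<Sum>j\<in>UNIV. \<Sum>k\<in>UNIV. B0 s j k * (u j * u' k + u' j * u k)) =
    (\<Sum>j\<in>UNIV. \<Sum>k\<in>UNIV. B0 s j k * (u j * u' k)) + (\<Sum>j\<in>UNIV. \<Sum>k\<in>UNIV. B0 s j k * (u j * u' k))"
proof -
  have "(\<Sum>j\<in>UNIV. \<Sum>k\<in>UNIV. B0 s j k * (u' j * u k)) = (\<Sum>j\<in>UNIV. \<Sum>k\<in>UNIV. B0 s j k * (u j * u' k))"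
    by (subst sum.swap) (simp add: B0_sym[of s] mult.commute)
  then show ?thesis by (simp add: distrib_left sum.distrib)
qed

lemma mean_ee:
  assumes "n > 0"
  shows "(\<integral>\<omega>. e i n \<omega> * e j n \<omega> \<partial>P) = (\<Sum>(a, b)\<in>UNIV. h i a * h j b * Lm [[a], [b]]) / real n"
proof -
  have "e i n \<omega> * e j n \<omega> = (\<Sum>p\<in>UNIV. (h i (fst p) * h j (snd p)) * (avg (y (fst p)) n \<omega> * avg (y (snd p)) n \<omega>))" for \<omega>
    unfolding e_def sum_times_sum by (simp add: mult_ac)
  then show ?thesis
    using expectation_sum_avg2[of UNIV "\<lambda>p. y (fst p)" "\<lambda>p. y (snd p)" n "\<lambda>p. h i (fst p) * h j (snd p)"] assms
    by (simp add: centred_y joint_simps case_prod_unfold)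
qed

lemma integrable_ee: "integrable P (\<lambda>\<omega>. e i n \<omega> * e j n \<omega>)"
  unfolding e_def
  by (intro all_moments_integrable all_moments_mult all_moments_sum all_moments_cmult all_moments_avg
      centred_all_moments centred_y)

context
  fixes d D D0
  assumes expansion: "likelihood_expansion P N X e A B C D B0 C0 D0 d"
begin

interpretation E: likelihood_expansion P N X e A B C D B0 C0 D0 d by (rule expansion)

lemma d2_split: "E.d2 s n \<omega> = d2A s n \<omega> + d2B s n \<omega>"
  by (simp add: E.d2_def d2A_def d2B_def)

lemma d3_split: "E.d3 s n \<omega> = (\<Sum>j\<in>UNIV. A s j n \<omega> * d2A j n \<omega>) + (\<Sum>j\<in>UNIV. A s j n \<omega> * d2B j n \<omega>)
  + (\<Sum>j\<in>UNIV. \<Sum>k\<in>UNIV. B s j k n \<omega> * (e j n \<omega> * e k n \<omega>))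
  + ((\<Sum>j\<in>UNIV. \<Sum>k\<in>UNIV. B0 s j k * (e j n \<omega> * d2A k n \<omega>)) + (\<Sum>j\<in>UNIV. \<Sum>k\<in>UNIV. B0 s j k * (e j n \<omega> * d2A k n \<omega>)))
  + ((\<Sum>j\<in>UNIV. \<Sum>k\<in>UNIV. B0 s j k * (e j n \<omega> * d2B k n \<omega>)) + (\<Sum>j\<in>UNIV. \<Sum>k\<in>UNIV. B0 s j k * (e j n \<omega> * d2B k n \<omega>)))
  + (\<Sum>j\<in>UNIV. \<Sum>k\<in>UNIV. \<Sum>l\<in>UNIV. C0 s j k l * (e j n \<omega> * (e k n \<omega> * e l n \<omega>)))"
  unfolding E.d3_def B0_symmetric_sum unfolding d2_split distrib_left sum.distrib by linarith

lemma second_order_mean_cong: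
  "second_order_mean Y b \<Longrightarrow> (\<And>n \<omega>. Z n \<omega> = Y n \<omega>) \<Longrightarrow> c = b \<Longrightarrow> second_order_mean Z c"
  by (metis ext)

lemmas mean_e_d2_parts = second_order_mean_add[OF mean_e_d2A[of i j] mean_e_d2B[of i j]] for i j

lemmas mean_e_d3_parts = second_order_mean_add[OF second_order_mean_add[OF second_order_mean_add[OF
    second_order_mean_add[OF second_order_mean_add[OF mean_e_A_d2A[of i j] mean_e_A_d2B[of i j]] mean_e_B_ee[of i j]]
    second_order_mean_add[OF mean_e_B0_e_d2A[of i j] mean_e_B0_e_d2A[of i j]]]
    second_order_mean_add[OF mean_e_B0_e_d2B[of i j] mean_e_B0_e_d2B[of i j]]] mean_e_C0_eee[of i j]] for i j

text \<open>The product \<open>e e\<close> is set apart because its mean is of order \<open>n\<^sup>-\<^sup>1\<close>.  Products of different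
  parts of the two expansions occur with \<open>i\<close> and \<open>j\<close> in either order, which is why most
  coefficients come in pairs.\<close>

lemma mean_dd: "second_order_mean (\<lambda>n \<omega>. d i n \<omega> * d j n \<omega> - e i n \<omega> * e j n \<omega>) (second_moment_coef Lm h i j)"
    apply (rule second_order_mean_cong[OF second_order_mean_add[OF second_order_mean_add[OF second_order_mean_add[OF
      second_order_mean_add[OF mean_e_d2_parts[of i j] mean_e_d2_parts[of j i]]
      second_order_mean_add[OF mean_e_d3_parts[of i j] mean_e_d3_parts[of j i]]]
      second_order_mean_add[OF second_order_mean_add[OF mean_d2A_d2A[of i j] mean_d2A_d2B[of i j]]
        second_order_mean_add[OF mean_d2A_d2B[of j i] mean_d2B_d2B[of i j]]]]
      E.second_moment_expansion[of i j]]])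
    subgoal by (simp add: d2_split d3_split algebra_simps)
    subgoal unfolding second_moment_coef_def Let_def by linarith
    done

lemma mean_ddd: "second_order_mean (\<lambda>n \<omega>. d i n \<omega> * (d j n \<omega> * d k n \<omega>)) (third_moment_coef Lm h i j k)"
  apply (rule second_order_mean_cong[OF second_order_mean_add[OF second_order_mean_add[OF mean_eee[of i j k]
      second_order_mean_add[OF second_order_mean_add[OF second_order_mean_add[OF mean_d2A_ee[of i j k] mean_d2A_ee[of j i k]] mean_d2A_ee[of k i j]]
        second_order_mean_add[OF second_order_mean_add[OF mean_d2B_ee[of i j k] mean_d2B_ee[of j i k]] mean_d2B_ee[of k i j]]]]
      E.third_moment_expansion[of i j k]]])
  subgoal by (simp add: d2_split E.triple4_def algebra_simps)
  subgoal unfolding third_moment_coef_def Let_def by linarith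
  done

lemma mean_dddd: "second_order_mean (\<lambda>n \<omega>. d i n \<omega> * (d j n \<omega> * (d k n \<omega> * d l n \<omega>))) (fourth_moment_coef Lm h i j k l)"
  by (rule second_order_mean_cong[OF second_order_mean_add[OF mean_eeee[of i j k l]
      E.fourth_moment_expansion[of i j k l]]])
    (simp_all add: fourth_moment_coef_def Let_def)

lemma moments_of_estimation_error:
  shows "(\<lambda>n. (\<integral>\<omega>. d i n \<omega> * d j n \<omega> \<partial>P) - ((\<Sum>(a, b)\<in>UNIV. h i a * h j b * Lm [[a], [b]]) / real n
      + second_moment_coef Lm h i j / (real n)\<^sup>2)) \<in> O(\<lambda>n. 1 / real n ^ 3)"
    and "(\<lambda>n. (\<integral>\<omega>. d i n \<omega> * (d j n \<omega> * d k n \<omega>) \<partial>P) - third_moment_coef Lm h i j k / (real n)\<^sup>2) \<in> O(\<lambda>n. 1 / real n ^ 3)"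
    and "(\<lambda>n. (\<integral>\<omega>. d i n \<omega> * (d j n \<omega> * (d k n \<omega> * d l n \<omega>)) \<partial>P) - fourth_moment_coef Lm h i j k l / (real n)\<^sup>2) \<in> O(\<lambda>n. 1 / real n ^ 3)"
    and "(\<lambda>n. (\<integral>\<omega>. d i n \<omega> * (d j n \<omega> * (d k n \<omega> * (d l n \<omega> * d m n \<omega>))) \<partial>P)) \<in> O(\<lambda>n. 1 / real n ^ 3)"
proof -
  have int: "\<forall>\<^sub>F n in sequentially. integrable P (\<lambda>\<omega>. d i n \<omega> * d j n \<omega> - e i n \<omega> * e j n \<omega>)"
    and O: "(\<lambda>n. (\<integral>\<omega>. d i n \<omega> * d j n \<omega> - e i n \<omega> * e j n \<omega> \<partial>P) - second_moment_coef Lm h i j / (real n)\<^sup>2) \<in> O(\<lambda>n. 1 / real n ^ 3)"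
    using mean_dd[of i j] unfolding second_order_mean_def by simp_all
  have ev: "\<forall>\<^sub>F n in sequentially. (\<integral>\<omega>. d i n \<omega> * d j n \<omega> \<partial>P) - ((\<Sum>(a, b)\<in>UNIV. h i a * h j b * Lm [[a], [b]]) / real n
      + second_moment_coef Lm h i j / (real n)\<^sup>2) =
      (\<integral>\<omega>. d i n \<omega> * d j n \<omega> - e i n \<omega> * e j n \<omega> \<partial>P) - second_moment_coef Lm h i j / (real n)\<^sup>2"
    using int eventually_gt_at_top[of 0]
  proof eventually_elim
    case (elim n)
    have "(\<integral>\<omega>. (d i n \<omega> * d j n \<omega> - e i n \<omega> * e j n \<omega>) + e i n \<omega> * e j n \<omega> \<partial>P) =
        (\<integral>\<omega>. d i n \<omega> * d j n \<omega> - e i n \<omega> * e j n \<omega> \<partial>P) + (\<integral>\<omega>. e i n \<omega> * e j n \<omega> \<partial>P)"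
      by (rule Bochner_Integration.integral_add[OF elim(1) integrable_ee])
    then show ?case using mean_ee[OF elim(2), of i j] by simp
  qed
  show "(\<lambda>n. (\<integral>\<omega>. d i n \<omega> * d j n \<omega> \<partial>P) - ((\<Sum>(a, b)\<in>UNIV. h i a * h j b * Lm [[a], [b]]) / real n
      + second_moment_coef Lm h i j / (real n)\<^sup>2)) \<in> O(\<lambda>n. 1 / real n ^ 3)"
    by (subst landau_o.big.in_cong[OF ev]) (rule O)
qed (use mean_ddd[of i j k] mean_dddd[of i j k l] E.fifth_moment_negligible[of i j k l m] in
    \<open>simp_all add: second_order_mean_def\<close>)

end
end

section \<open>The maximum likelihood estimator\<close>

text \<open>The difference of two consecutive sums is a single observation up to a constant, so moments of
  the sums for large \<open>n\<close> are moments of one observation.  The constants \<open>c n\<close> absorb the centring.\<close>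

lemma (in iid_sample_space) all_moments_if_sums:
  assumes y: "y \<in> borel_measurable N"
    and int: "\<And>q. \<forall>\<^sub>F n in sequentially. integrable P (\<lambda>\<omega>. (obs_sum y n \<omega> + c n) ^ (2 * q))"
  shows "all_moments N y"
proof -
  have "integrable N (\<lambda>x. \<bar>y x\<bar> ^ q)" for q
  proof -
    have "\<forall>\<^sub>F n in sequentially. integrable P (\<lambda>\<omega>. (obs_sum y n \<omega> + c n) ^ (2 * q)) \<and>
        integrable P (\<lambda>\<omega>. (obs_sum y (Suc n) \<omega> + c (Suc n)) ^ (2 * q))"
      by (rule eventually_conj[OF int eventually_sequentially_Suc[THEN iffD2, OF int]])
    then obtain n where n: "integrable P (\<lambda>\<omega>. (obs_sum y n \<omega> + c n) ^ (2 * q))"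
        "integrable P (\<lambda>\<omega>. (obs_sum y (Suc n) \<omega> + c (Suc n)) ^ (2 * q))"
      using eventually_happens'[OF sequentially_bot] by blast
    define u where "u \<omega> = obs_sum y (Suc n) \<omega> + c (Suc n)" for \<omega>
    define u' where "u' \<omega> = obs_sum y n \<omega> + c n" for \<omega>
    define k where "k = c n - c (Suc n)"
    have yX: "y (X n \<omega>) = u \<omega> + (- u' \<omega> + k)" for \<omega>
      by (simp add: u_def u'_def k_def obs_sum_def)
    define b where "b \<omega> = 1 + 2 ^ (2 * q) * (u \<omega> ^ (2 * q) + 2 ^ (2 * q) * (u' \<omega> ^ (2 * q) + k ^ (2 * q)))" for \<omega>
    have le: "\<bar>y (X n \<omega>)\<bar> ^ q \<le> b \<omega>" for \<omega>
    proof -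
      have 1: "\<bar>y (X n \<omega>)\<bar> ^ q \<le> \<bar>y (X n \<omega>)\<bar> ^ (2 * q) + 1"
        using power_mult_le[of "y (X n \<omega>)" 1 q] by simp
      have "\<bar>y (X n \<omega>)\<bar> ^ (2 * q) \<le> (\<bar>u \<omega>\<bar> + \<bar>- u' \<omega> + k\<bar>) ^ (2 * q)"
        unfolding yX by (intro power_mono abs_triangle_ineq) simp
      with power_add_le[of "\<bar>u \<omega>\<bar>" "\<bar>- u' \<omega> + k\<bar>" "2 * q"]
      have 2: "\<bar>y (X n \<omega>)\<bar> ^ (2 * q) \<le> 2 ^ (2 * q) * (\<bar>u \<omega>\<bar> ^ (2 * q) + \<bar>- u' \<omega> + k\<bar> ^ (2 * q))"
        by linarith
      have "\<bar>- u' \<omega> + k\<bar> ^ (2 * q) \<le> (\<bar>- u' \<omega>\<bar> + \<bar>k\<bar>) ^ (2 * q)"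
        by (intro power_mono abs_triangle_ineq) simp
      with power_add_le[of "\<bar>- u' \<omega>\<bar>" "\<bar>k\<bar>" "2 * q"]
      have "\<bar>- u' \<omega> + k\<bar> ^ (2 * q) \<le> 2 ^ (2 * q) * (\<bar>- u' \<omega>\<bar> ^ (2 * q) + \<bar>k\<bar> ^ (2 * q))"
        by linarith
      then have "2 ^ (2 * q) * (\<bar>u \<omega>\<bar> ^ (2 * q) + \<bar>- u' \<omega> + k\<bar> ^ (2 * q)) \<le>
          2 ^ (2 * q) * (\<bar>u \<omega>\<bar> ^ (2 * q) + 2 ^ (2 * q) * (\<bar>- u' \<omega>\<bar> ^ (2 * q) + \<bar>k\<bar> ^ (2 * q)))"
        by (intro mult_left_mono add_left_mono) simp_all
      with 1 2
      have "\<bar>y (X n \<omega>)\<bar> ^ q \<le> 1 + 2 ^ (2 * q) * (\<bar>u \<omega>\<bar> ^ (2 * q) + 2 ^ (2 * q) * (\<bar>- u' \<omega>\<bar> ^ (2 * q) + \<bar>k\<bar> ^ (2 * q)))"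
        by linarith
      then show ?thesis by (simp add: b_def power_even_abs)
    qed
    have "integrable P (\<lambda>\<omega>. \<bar>y (X n \<omega>)\<bar> ^ q)"
    proof (rule Bochner_Integration.integrable_bound)
      show "integrable P b"
        using n unfolding b_def u_def u'_def by simp
      show "(\<lambda>\<omega>. \<bar>y (X n \<omega>)\<bar> ^ q) \<in> borel_measurable P"
        using y by measurable
      have "norm (\<bar>y (X n \<omega>)\<bar> ^ q) \<le> norm (b \<omega>)" for \<omega>
        using le[of \<omega>] by simp
      then show "AE \<omega> in P. norm (\<bar>y (X n \<omega>)\<bar> ^ q) \<le> norm (b \<omega>)" by simp
    qed
    then show ?thesis using integrable_X[of "\<lambda>x. \<bar>y x\<bar> ^ q" n] y by simp
  qed
  then show ?thesis using y by (simp add: all_moments_def)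
qed

lemma integrable_cmult_cancel: "integrable M (\<lambda>x. c * u x) \<Longrightarrow> c \<noteq> 0 \<Longrightarrow> integrable M u" for c :: real
  by simp

lemma sum_move:
  fixes a :: "'a::finite \<Rightarrow> real" and F :: "'a \<Rightarrow> 'b::finite \<Rightarrow> real"
  shows "(\<Sum>i\<in>UNIV. a i * (\<Sum>j\<in>UNIV. F i j)) = (\<Sum>j\<in>UNIV. \<Sum>i\<in>UNIV. a i * F i j)"
  unfolding sum_distrib_left by (rule sum.swap)

lemma sum_pairs: "(\<Sum>(a, b)\<in>(UNIV :: ('a::finite \<times> 'b::finite) set). F a b) = (\<Sum>a\<in>UNIV. \<Sum>b\<in>UNIV. (F a b :: real))"
  by (simp add: sum.cartesian_product flip: UNIV_Times_UNIV)

lemma sum_triples: "(\<Sum>(a, b, c)\<in>(UNIV :: ('a::finite \<times> 'b::finite \<times> 'c::finite) set). F a b c) =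
    (\<Sum>a\<in>UNIV. \<Sum>b\<in>UNIV. \<Sum>c\<in>UNIV. (F a b c :: real))"
  using sum_pairs[of "\<lambda>a (b, c). F a b c"] by (simp add: sum_pairs)

lemma sum_quadruples: "(\<Sum>(a, b, c, d)\<in>(UNIV :: ('a::finite \<times> 'b::finite \<times> 'c::finite \<times> 'd::finite) set). F a b c d) =
    (\<Sum>a\<in>UNIV. \<Sum>b\<in>UNIV. \<Sum>c\<in>UNIV. \<Sum>d\<in>UNIV. (F a b c d :: real))"
  using sum_pairs[of "\<lambda>a (b, c, d). F a b c d"] by (simp add: sum_triples)

locale misspecified_mle =
  fixes \<mu> :: "'x measure" and P :: "'w measure" and \<Theta> :: "(real ^ 'p::finite) set"
    and f :: "real ^ 'p \<Rightarrow> 'x \<Rightarrow> real" and g :: "'x \<Rightarrow> real" and \<theta>s :: "real ^ 'p"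
    and X :: "nat \<Rightarrow> 'w \<Rightarrow> 'x" and \<theta>hat :: "nat \<Rightarrow> 'w \<Rightarrow> real ^ 'p"
    and \<theta>til :: "nat \<Rightarrow> 'w \<Rightarrow> 'p \<Rightarrow> 'p \<Rightarrow> 'p \<Rightarrow> 'p \<Rightarrow> 'p \<Rightarrow> real ^ 'p" and Gt :: "real ^ 'p ^ 'p"
  assumes model: "smooth_model \<mu> \<Theta> f"
    and truth: "prob_density \<mu> g"
    and projection: "information_projection \<mu> g \<Theta> f \<theta>s"
    and sample: "iid_sample P \<mu> g X"
    and mle: "is_mle P X \<Theta> f \<theta>hat"
    and Gt_def: "Gt = Gtilde \<mu> g f \<theta>s"
    and Gt_inv: "invertible Gt"
    and taylor: "taylor_points P X \<Theta> f \<theta>s \<theta>hat \<theta>til"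
    and moments: "moments_bounded P X f \<theta>s \<theta>hat \<theta>til Gt"
    and remainder: "remainder_stable P \<mu> g X f \<theta>s \<theta>til Gt"
begin

abbreviation N where "N \<equiv> density \<mu> (\<lambda>x. ennreal (g x))"

definition ld :: "'p list \<Rightarrow> 'x \<Rightarrow> real" where
  "ld I x = pderivs I (\<lambda>\<theta>. ln (f \<theta> x)) \<theta>s"

definition h :: "'p \<Rightarrow> 'p \<Rightarrow> real" where "h i j = matrix_inv Gt $ i $ j"

lemma open_\<Theta>: "open \<Theta>" using model by (simp add: smooth_model_def)

lemma \<theta>s_in: "\<theta>s \<in> \<Theta>"
  using projection by (auto simp: information_projection_def is_arg_min_def)

lemma smooth_log: "x \<in> space \<mu> \<Longrightarrow> smooth_in \<Theta> (\<lambda>\<theta>. ln (f \<theta> x))"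
  using model by (intro smooth_in_ln) (auto simp: smooth_model_def)

lemma measurable_ld: "ld I \<in> borel_measurable \<mu>"
  unfolding ld_def[abs_def]
proof (rule measurable_pderivs[OF open_\<Theta> smooth_log _ \<theta>s_in])
  fix \<theta> assume "\<theta> \<in> \<Theta>"
  then have "f \<theta> \<in> borel_measurable \<mu>" using model by (simp add: smooth_model_def prob_density_def)
  then show "(\<lambda>x. ln (f \<theta> x)) \<in> borel_measurable \<mu>" by measurable
qed

lemma g_meas: "g \<in> borel_measurable \<mu>" and g_nonneg: "x \<in> space \<mu> \<Longrightarrow> 0 \<le> g x"
  using truth by (auto simp: prob_density_def)

lemma integral_N: "u \<in> borel_measurable \<mu> \<Longrightarrow> (\<integral>x. u x \<partial>N) = (\<integral>x. g x * (u x :: real) \<partial>\<mu>)"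
  using g_nonneg by (subst integral_density) (auto simp: g_meas)

lemma measurable_prod_ld: "(\<lambda>x. \<Prod>I\<leftarrow>Is. ld I x) \<in> borel_measurable \<mu>"
  by (induction Is) (auto intro: borel_measurable_times measurable_ld)

lemma Lmom_eq: "Lmom \<mu> g f \<theta>s Is = (\<integral>x. (\<Prod>I\<leftarrow>Is. ld I x) \<partial>N)"
  unfolding integral_N[OF measurable_prod_ld] by (simp add: Lmom_def ld_def)

lemma ld_perm: "mset I = mset J \<Longrightarrow> x \<in> space \<mu> \<Longrightarrow> ld I x = ld J x"
  unfolding ld_def by (rule pderivs_perm[OF open_\<Theta> smooth_log \<theta>s_in])

lemma iid: "iid_sample_space P N X"
proof -
  interpret prob_space P using sample by (simp add: iid_sample_def)
  have m: "measurable P N = measurable P \<mu>" by (rule measurable_cong_sets) simp_all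
  have d: "distr P \<mu> (X a) = N" for a
    using sample by (simp add: iid_sample_def distributed_distr_eq_density)
  have "distr P N (X a) = N" for a
    using d[of a] distr_cong[of P P N \<mu> "X a" "X a"] by simp
  moreover have "indep_vars (\<lambda>_. N) X UNIV"
    using sample by (simp add: iid_sample_def indep_vars_def m)
  ultimately show ?thesis by unfold_locales
qed

sublocale iid_sample_space P N X by (rule iid)

lemma X_space: "\<omega> \<in> space P \<Longrightarrow> X a \<omega> \<in> space \<mu>"
  using measurable_space[OF measurable_X[of a]] by simp

lemma Gt_entry: "Gt $ i $ j = - Lmom \<mu> g f \<theta>s [[i, j]]"
  by (simp add: Gt_def Gtilde_def)

lemma Gt_sym: "Gt $ i $ j = Gt $ j $ i"
  unfolding Gt_entry Lmom_eq
  by (simp, intro Bochner_Integration.integral_cong refl ld_perm) auto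

lemma inverse: "matrix_inv Gt ** Gt = mat 1" "Gt ** matrix_inv Gt = mat 1"
  using someI_ex[OF Gt_inv[unfolded invertible_def]] unfolding matrix_inv_def by blast+

lemma h_Gt: "(\<Sum>s\<in>UNIV. h i s * Gt $ s $ k) = (if i = k then 1 else 0)"
  using arg_cong[OF inverse(1), of "\<lambda>A. A $ i $ k"]
  by (simp add: matrix_matrix_mult_def h_def mat_def)

lemma h_sym: "h i j = h j i"
proof -
  have t: "transpose Gt = Gt" by (simp add: transpose_def vec_eq_iff Gt_sym)
  have "transpose (matrix_inv Gt) ** Gt = transpose (Gt ** matrix_inv Gt)"
    by (simp add: matrix_transpose_mul t)
  then have "transpose (matrix_inv Gt) ** Gt = mat 1" by (simp add: inverse transpose_mat)
  then have "transpose (matrix_inv Gt) ** (Gt ** matrix_inv Gt) = matrix_inv Gt"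
    unfolding matrix_mul_assoc by simp
  then have "transpose (matrix_inv Gt) = matrix_inv Gt" by (simp add: inverse)
  from arg_cong[OF this, of "\<lambda>A. A $ i $ j"] show ?thesis by (simp add: h_def transpose_def)
qed

lemma pderivs_mean_score:
  assumes "\<omega> \<in> space P"
  shows "pderivs js (mean_score f X n \<omega> i) \<theta>s = avg (ld (js @ [i])) n \<omega>"
proof -
  have score: "mean_score f X n \<omega> i = (\<lambda>\<theta>. 1 / real n * (\<Sum>a<n. pderivs [i] (\<lambda>\<theta>'. ln (f \<theta>' (X a \<omega>))) \<theta>))"
    by (simp add: mean_score_def fun_eq_iff)
  have "pderivs js (mean_score f X n \<omega> i) \<theta>s =
      1 / real n * (\<Sum>a<n. pderivs js (pderivs [i] (\<lambda>\<theta>'. ln (f \<theta>' (X a \<omega>)))) \<theta>s)"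
    unfolding score
    by (rule pderivs_linear_comb[OF open_\<Theta> finite_lessThan smooth_in_pderivs[OF smooth_log[OF X_space[OF assms]]] \<theta>s_in])
  then show ?thesis by (simp add: avg_def obs_sum_def ld_def pderivs_append)
qed

abbreviation val where "val n \<omega> v \<equiv> mvar_val P X f \<theta>s \<theta>hat \<theta>til Gt n \<omega> v"

lemma moments_val: "\<exists>K. \<forall>\<^sub>F n in sequentially. integrable P (\<lambda>\<omega>. val n \<omega> v ^ q) \<and> (\<integral>\<omega>. val n \<omega> v ^ q \<partial>P) \<le> K"
proof -
  obtain K where "\<forall>\<^sub>F n in sequentially. integrable P (\<lambda>\<omega>. \<Prod>v\<leftarrow>replicate q v. val n \<omega> v)
      \<and> \<bar>\<integral>\<omega>. (\<Prod>v\<leftarrow>replicate q v. val n \<omega> v) \<partial>P\<bar> \<le> K"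
    using moments unfolding moments_bounded_def by blast
  then have "\<forall>\<^sub>F n in sequentially. integrable P (\<lambda>\<omega>. val n \<omega> v ^ q) \<and> (\<integral>\<omega>. val n \<omega> v ^ q \<partial>P) \<le> K"
    by eventually_elim (simp add: map_replicate prod_list_replicate abs_le_iff)
  then show ?thesis by blast
qed

lemma integrable_val: "\<forall>\<^sub>F n in sequentially. integrable P (\<lambda>\<omega>. val n \<omega> v ^ q)"
  using moments_val[of v q] by (auto elim: eventually_mono)

text \<open>The moment hypothesis concerns contractions with the inverse matrix \<open>h\<close>; contracting once more,
  with \<open>Gt\<close>, recovers the derivatives.\<close>

lemma all_moments_from_contractions:
  fixes v :: "'p \<Rightarrow> 'p mvar"
  assumes "\<kappa> \<noteq> 0" and v: "\<And>s n \<omega>. \<omega> \<in> space P \<Longrightarrow>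
    val n \<omega> (v s) = sqrt (real n) * (\<kappa> * (\<Sum>i\<in>UNIV. h i s * (avg (ld (js @ [i])) n \<omega> + c n i)))"
  shows "all_moments N (ld (js @ [k]))"
proof -
  have int: "\<forall>\<^sub>F n in sequentially. integrable P
     (\<lambda>\<omega>. (sqrt (real n) * (\<kappa> * (\<Sum>i\<in>UNIV. h i s * (avg (ld (js @ [i])) n \<omega> + c n i)))) ^ (2 * q))" for s q
    using integrable_val[of "v s" "2 * q"]
  proof eventually_elim
    case (elim n)
    then show ?case by (subst (asm) Bochner_Integration.integrable_cong[OF refl]) (simp_all only: v)
  qed
  define Y where "Y s x = (\<Sum>i\<in>UNIV. h i s * ld (js @ [i]) x)" for s x
  have Y: "all_moments N (Y s)" for s
  proof (rule all_moments_if_sums)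
    show "Y s \<in> borel_measurable N"
      unfolding Y_def[abs_def] using measurable_ld by simp
    fix q
    show "\<forall>\<^sub>F n in sequentially. integrable P (\<lambda>\<omega>. (obs_sum (Y s) n \<omega> + real n * (\<Sum>i\<in>UNIV. h i s * c n i)) ^ (2 * q))"
      using int[of s q] eventually_gt_at_top[of 0]
    proof eventually_elim
      case (elim n)
      have "sqrt (real n) * (\<kappa> * (\<Sum>i\<in>UNIV. h i s * (avg (ld (js @ [i])) n \<omega> + c n i))) =
         (sqrt (real n) * \<kappa> / real n) * (obs_sum (Y s) n \<omega> + real n * (\<Sum>i\<in>UNIV. h i s * c n i))" for \<omega>
      proof -
        have "obs_sum (Y s) n \<omega> = (\<Sum>i\<in>UNIV. h i s * obs_sum (ld (js @ [i])) n \<omega>)"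
          unfolding obs_sum_def Y_def by (subst sum.swap) (simp add: sum_distrib_left)
        also have "\<dots> = real n * (\<Sum>i\<in>UNIV. h i s * avg (ld (js @ [i])) n \<omega>)"
          using elim(2) by (simp add: avg_def sum_distrib_left)
        finally show ?thesis using elim(2)
          by (simp add: distrib_left sum.distrib)
      qed
      then have "integrable P (\<lambda>\<omega>. (sqrt (real n) * \<kappa> / real n) ^ (2 * q) *
          (obs_sum (Y s) n \<omega> + real n * (\<Sum>i\<in>UNIV. h i s * c n i)) ^ (2 * q))"
        using elim(1) by (simp only: power_mult_distrib)
      moreover have "(sqrt (real n) * \<kappa> / real n) ^ (2 * q) \<noteq> 0" using elim(2) assms(1) by simp
      ultimately show ?case by (rule integrable_cmult_cancel)
    qed
  qed
  have "ld (js @ [k]) x = (\<Sum>s\<in>UNIV. Gt $ s $ k * Y s x)" for x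
  proof -
    have "(\<Sum>s\<in>UNIV. Gt $ s $ k * Y s x) = (\<Sum>i\<in>UNIV. ld (js @ [i]) x * (\<Sum>s\<in>UNIV. h i s * Gt $ s $ k))"
      unfolding Y_def sum_distrib_left by (subst sum.swap) (simp add: mult_ac)
    also have "\<dots> = ld (js @ [k]) x"
      unfolding h_Gt by (simp add: if_distrib cong: if_cong)
    finally show ?thesis by simp
  qed
  then have "ld (js @ [k]) = (\<lambda>x. \<Sum>s\<in>UNIV. Gt $ s $ k * Y s x)" by (simp add: fun_eq_iff)
  then show ?thesis
    by (simp only:) (intro prob_space.all_moments_sum[OF prob_space_N] prob_space.all_moments_cmult[OF prob_space_N Y])
qed

lemma ld_moments:
  assumes "0 < length I" "length I \<le> 4" shows "all_moments N (ld I)"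
proof -
  obtain js k where I: "I = js @ [k]" using assms(1) by (cases I rule: rev_cases) auto
  then consider "js = []" | a where "js = [a]" | a b where "js = [a, b]" | a b c where "js = [a, b, c]"
    using assms(2) by (cases js; cases "tl js"; cases "tl (tl js)"; auto)
  then show ?thesis
  proof cases
    case 1
    show ?thesis unfolding I
      by (rule all_moments_from_contractions[of 1 E_var _ "\<lambda>_ _. 0"])
        (simp_all add: pderivs_mean_score[of _ "[]", simplified] h_def[symmetric] h_sym[of "_ :: 'p"] 1)
  next
    case (2 a)
    show ?thesis unfolding I
      by (rule all_moments_from_contractions[of 1 "\<lambda>s. A_var s a" _ "\<lambda>_ i. Gt $ i $ a"])
        (simp_all add: pderivs_mean_score h_def[symmetric] 2)
  next
    case (3 a b)
    show ?thesis unfolding I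
      by (rule all_moments_from_contractions[of "1/2" "\<lambda>s. B_var s a b" _
            "\<lambda>n i. - (\<integral>\<omega>'. pderivs [a, b] (mean_score f X n \<omega>' i) \<theta>s \<partial>P)"])
        (simp_all add: centred_score_deriv_def pderivs_mean_score h_def[symmetric] 3)
  next
    case (4 a b c)
    show ?thesis unfolding I
      by (rule all_moments_from_contractions[of "1/6" "\<lambda>s. C_var s a b c" _
            "\<lambda>n i. - (\<integral>\<omega>'. pderivs [a, b, c] (mean_score f X n \<omega>' i) \<theta>s \<partial>P)"])
        (simp_all add: centred_score_deriv_def pderivs_mean_score h_def[symmetric] 4)
  qed
qed

lemma score_mean: "(\<integral>x. ld [i] x \<partial>N) = 0"
  using projection unfolding integral_N[OF measurable_ld]
  by (auto simp: information_projection_def ld_def has_bochner_integral_iff)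

sublocale log_likelihood_moments P N X ld h
  by unfold_locales (auto intro: ld_moments score_mean ld_perm h_sym)

lemma Lm_eq: "Lm = Lmom \<mu> g f \<theta>s"
  by (simp add: fun_eq_iff Lm_def Lmom_eq)

definition d :: "'p \<Rightarrow> nat \<Rightarrow> 'w \<Rightarrow> real" where "d s n \<omega> = \<theta>hat n \<omega> $ s - \<theta>s $ s"

definition D :: "'p \<Rightarrow> 'p \<Rightarrow> 'p \<Rightarrow> 'p \<Rightarrow> 'p \<Rightarrow> nat \<Rightarrow> 'w \<Rightarrow> real" where
  "D s j k l m n \<omega> = remainder_D X f \<theta>til Gt n \<omega> s j k l m"

definition D0 :: "'p \<Rightarrow> 'p \<Rightarrow> 'p \<Rightarrow> 'p \<Rightarrow> 'p \<Rightarrow> real" where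
  "D0 s j k l m = 1/24 * (\<Sum>i\<in>UNIV. matrix_inv Gt $ i $ s * Lmom \<mu> g f \<theta>s [[j, k, l, m, i]])"

lemma order_d: "moment_order 1 (d s)"
proof (rule moment_order_even)
  have "(\<lambda>x :: real ^ 'p. x $ s) \<in> borel_measurable borel"
    by (intro borel_measurable_continuous_onI continuous_intros)
  moreover have "\<theta>hat n \<in> borel_measurable P" for n using mle by (simp add: is_mle_def)
  ultimately have "(\<lambda>\<omega>. \<theta>hat n \<omega> $ s) \<in> borel_measurable P" for n
    by (rule measurable_compose[rotated])
  then show "\<forall>\<^sub>F n in sequentially. d s n \<in> borel_measurable P"
    unfolding d_def[abs_def] by simp
  fix q
  show "bounded_mean (\<lambda>n \<omega>. (sqrt (real n) ^ 1 * d s n \<omega>) ^ (2 * q))"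
    using moments_val[of "Theta_var s" "2 * q"] by (simp add: bounded_mean_def d_def)
qed

lemma order_D: "moment_order 0 (D s j k l m)"
proof (rule moment_order_even)
  have "\<forall>\<^sub>F n in sequentially. integrable P (\<lambda>\<omega>. val n \<omega> (D_var s j k l m) ^ 1)" by (rule integrable_val)
  then show "\<forall>\<^sub>F n in sequentially. D s j k l m n \<in> borel_measurable P"
    by eventually_elim (simp add: D_def[abs_def] borel_measurable_integrable)
  fix q
  show "bounded_mean (\<lambda>n \<omega>. (sqrt (real n) ^ 0 * D s j k l m n \<omega>) ^ (2 * q))"
    using moments_val[of "D_var s j k l m" "2 * q"] by (simp add: bounded_mean_def D_def)
qed

lemma order_D_dev: "bounded_mean (\<lambda>n \<omega>. (sqrt (real n) * (D s j k l m n \<omega> - D0 s j k l m))\<^sup>2)"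
  using remainder unfolding remainder_stable_def bounded_mean_def D_def D0_def Let_def by blast

text \<open>At the estimator the score vanishes, so its Taylor polynomial and remainder sum to zero.  The mean
  of the linear coefficient is \<open>- Gt\<close>, whence the contraction with \<open>h\<close> isolates \<open>d\<close>; the other
  coefficients are split into their means and centred averages.\<close>

lemma likelihood_equation:
  "\<forall>\<^sub>F n in sequentially. AE \<omega> in P. \<forall>s. d s n \<omega> = e s n \<omega>
      + (\<Sum>j\<in>UNIV. A s j n \<omega> * d j n \<omega>)
      + (\<Sum>j\<in>UNIV. \<Sum>k\<in>UNIV. (B s j k n \<omega> + B0 s j k) * (d j n \<omega> * d k n \<omega>))
      + (\<Sum>j\<in>UNIV. \<Sum>k\<in>UNIV. \<Sum>l\<in>UNIV. (C s j k l n \<omega> + C0 s j k l) * (d j n \<omega> * (d k n \<omega> * d l n \<omega>)))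
      + (\<Sum>j\<in>UNIV. \<Sum>k\<in>UNIV. \<Sum>l\<in>UNIV. \<Sum>m\<in>UNIV.
          D s j k l m n \<omega> * (d j n \<omega> * (d k n \<omega> * (d l n \<omega> * d m n \<omega>))))"
proof -
  have "\<forall>\<^sub>F n in sequentially. AE \<omega> in P. \<forall>i. (\<Sum>a<n. pderivs [i] (\<lambda>\<theta>. ln (f \<theta> (X a \<omega>))) (\<theta>hat n \<omega>)) = 0"
    using mle unfolding is_mle_def by (auto elim!: eventually_mono)
  then show ?thesis
    using taylor[unfolded taylor_points_def] eventually_gt_at_top[of 0]
  proof eventually_elim
    case (elim n)
    have avg_shift: "avg (\<lambda>x. u x - c) n \<omega> = avg u n \<omega> - c" for u c \<omega>
      using elim(3) by (simp add: avg_def obs_sum_def sum_subtractf diff_divide_distrib)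
    show ?case
      using elim(1,2) AE_space
    proof eventually_elim
      case (elim \<omega>)
      define r where "r i j k l m = pderivs [j, k, l, m] (mean_score f X n \<omega> i) (\<theta>til n \<omega> i j k l m)" for i j k l m
      have zero: "0 = avg (ld [i]) n \<omega> + (\<Sum>j\<in>UNIV. avg (ld [j, i]) n \<omega> * d j n \<omega>)
          + 1/2 * (\<Sum>j\<in>UNIV. \<Sum>k\<in>UNIV. avg (ld [j, k, i]) n \<omega> * d j n \<omega> * d k n \<omega>)
          + 1/6 * (\<Sum>j\<in>UNIV. \<Sum>k\<in>UNIV. \<Sum>l\<in>UNIV. avg (ld [j, k, l, i]) n \<omega> * d j n \<omega> * d k n \<omega> * d l n \<omega>)
          + 1/24 * (\<Sum>j\<in>UNIV. \<Sum>k\<in>UNIV. \<Sum>l\<in>UNIV. \<Sum>m\<in>UNIV. r i j k l m * d j n \<omega> * d k n \<omega> * d l n \<omega> * d m n \<omega>)" for i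
      proof -
        have "mean_score f X n \<omega> i (\<theta>hat n \<omega>) = 0" using elim(1) by (simp add: mean_score_def)
        then show ?thesis
          using conjunct2[OF elim(2)[rule_format, of i]] pderivs_mean_score[OF elim(3), of _ n i]
            pderivs_mean_score[OF elim(3), of "[]" n i]
          by (simp add: Let_def sum_pairs sum_triples sum_quadruples d_def r_def)
      qed
      have w: "avg (ld [j, k, i]) n \<omega> = avg (w i j k) n \<omega> + Lm [[j, k, i]]" for i j k
        by (simp add: w_def[abs_def] avg_shift)
      have v: "avg (ld [j, k, l, i]) n \<omega> = avg (v i j k l) n \<omega> + Lm [[j, k, l, i]]" for i j k l
        by (simp add: v_def[abs_def] avg_shift)
      have z: "avg (ld [j, i]) n \<omega> = avg (z i j) n \<omega> - Gt $ i $ j" for i j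
        by (simp add: z_def[abs_def] avg_shift Gt_entry Lm_eq)
      show ?case
      proof
        fix s
        have 1: "(\<Sum>i\<in>UNIV. h i s * avg (ld [i]) n \<omega>) = e s n \<omega>"
          by (simp add: e_def h_sym)
        have "(\<Sum>i\<in>UNIV. h i s * (\<Sum>j\<in>UNIV. avg (ld [j, i]) n \<omega> * d j n \<omega>)) =
            (\<Sum>j\<in>UNIV. \<Sum>i\<in>UNIV. h i s * avg (ld [j, i]) n \<omega> * d j n \<omega>)"
          unfolding sum_distrib_left by (subst sum.swap) (simp add: mult_ac)
        also have "\<dots> = (\<Sum>j\<in>UNIV. A s j n \<omega> * d j n \<omega> - (\<Sum>i\<in>UNIV. h s i * Gt $ i $ j) * d j n \<omega>)"
        proof (rule sum.cong)
          fix j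
          show "(\<Sum>i\<in>UNIV. h i s * avg (ld [j, i]) n \<omega> * d j n \<omega>) =
              A s j n \<omega> * d j n \<omega> - (\<Sum>i\<in>UNIV. h s i * Gt $ i $ j) * d j n \<omega>"
            unfolding z A_def sum_distrib_right sum_subtractf[symmetric] h_sym[of s]
            by (simp add: algebra_simps)
        qed simp
        also have "\<dots> = (\<Sum>j\<in>UNIV. A s j n \<omega> * d j n \<omega>) - d s n \<omega>"
          by (simp add: h_Gt sum_subtractf if_distrib[of "\<lambda>x. x * _"] cong: if_cong)
        finally have 2: "(\<Sum>i\<in>UNIV. h i s * (\<Sum>j\<in>UNIV. avg (ld [j, i]) n \<omega> * d j n \<omega>)) =
            (\<Sum>j\<in>UNIV. A s j n \<omega> * d j n \<omega>) - d s n \<omega>" .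
        have 3: "(\<Sum>i\<in>UNIV. h i s * (1/2 * (\<Sum>j\<in>UNIV. \<Sum>k\<in>UNIV. avg (ld [j, k, i]) n \<omega> * d j n \<omega> * d k n \<omega>))) = (\<Sum>j\<in>UNIV. \<Sum>k\<in>UNIV. (B s j k n \<omega> + B0 s j k) * (d j n \<omega> * d k n \<omega>))"
        proof -
          have "(\<Sum>i\<in>UNIV. h i s * (1/2 * (avg (ld [j, k, i]) n \<omega> * d j n \<omega> * d k n \<omega>))) = (B s j k n \<omega> + B0 s j k) * (d j n \<omega> * d k n \<omega>)" for j k
            unfolding w B_def B0_def sum.distrib[symmetric] sum_distrib_right by (simp add: algebra_simps)
          then show ?thesis unfolding sum_distrib_left[of "1/2"] sum_move by simp
        qed
        have 4: "(\<Sum>i\<in>UNIV. h i s * (1/6 * (\<Sum>j\<in>UNIV. \<Sum>k\<in>UNIV. \<Sum>l\<in>UNIV. avg (ld [j, k, l, i]) n \<omega> * d j n \<omega> * d k n \<omega> * d l n \<omega>))) = (\<Sum>j\<in>UNIV. \<Sum>k\<in>UNIV. \<Sum>l\<in>UNIV. (C s j k l n \<omega> + C0 s j k l) * (d j n \<omega> * (d k n \<omega> * d l n \<omega>)))"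
        proof -
          have "(\<Sum>i\<in>UNIV. h i s * (1/6 * (avg (ld [j, k, l, i]) n \<omega> * d j n \<omega> * d k n \<omega> * d l n \<omega>))) = (C s j k l n \<omega> + C0 s j k l) * (d j n \<omega> * (d k n \<omega> * d l n \<omega>))" for j k l
            unfolding v C_def C0_def sum.distrib[symmetric] sum_distrib_right by (simp add: algebra_simps)
          then show ?thesis unfolding sum_distrib_left[of "1/6"] sum_move by simp
        qed
        have 5: "(\<Sum>i\<in>UNIV. h i s * (1/24 * (\<Sum>j\<in>UNIV. \<Sum>k\<in>UNIV. \<Sum>l\<in>UNIV. \<Sum>m\<in>UNIV. r i j k l m * d j n \<omega> * d k n \<omega> * d l n \<omega> * d m n \<omega>))) = (\<Sum>j\<in>UNIV. \<Sum>k\<in>UNIV. \<Sum>l\<in>UNIV. \<Sum>m\<in>UNIV. D s j k l m n \<omega> * (d j n \<omega> * (d k n \<omega> * (d l n \<omega> * d m n \<omega>))))"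
        proof -
          have "(\<Sum>i\<in>UNIV. h i s * (1/24 * (r i j k l m * d j n \<omega> * d k n \<omega> * d l n \<omega> * d m n \<omega>))) = D s j k l m n \<omega> * (d j n \<omega> * (d k n \<omega> * (d l n \<omega> * d m n \<omega>)))" for j k l m
            unfolding D_def remainder_D_def sum_distrib_left sum_distrib_right by (simp add: r_def h_def mult_ac)
          then show ?thesis unfolding sum_distrib_left[of "1/24"] sum_move by simp
        qed
        have "(\<Sum>i\<in>UNIV. h i s * (avg (ld [i]) n \<omega> + (\<Sum>j\<in>UNIV. avg (ld [j, i]) n \<omega> * d j n \<omega>)
          + 1/2 * (\<Sum>j\<in>UNIV. \<Sum>k\<in>UNIV. avg (ld [j, k, i]) n \<omega> * d j n \<omega> * d k n \<omega>)
          + 1/6 * (\<Sum>j\<in>UNIV. \<Sum>k\<in>UNIV. \<Sum>l\<in>UNIV. avg (ld [j, k, l, i]) n \<omega> * d j n \<omega> * d k n \<omega> * d l n \<omega>)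
          + 1/24 * (\<Sum>j\<in>UNIV. \<Sum>k\<in>UNIV. \<Sum>l\<in>UNIV. \<Sum>m\<in>UNIV. r i j k l m * d j n \<omega> * d k n \<omega> * d l n \<omega> * d m n \<omega>))) = 0"
          unfolding zero[symmetric] by simp
        then show "d s n \<omega> = e s n \<omega>
          + (\<Sum>j\<in>UNIV. A s j n \<omega> * d j n \<omega>)
          + (\<Sum>j\<in>UNIV. \<Sum>k\<in>UNIV. (B s j k n \<omega> + B0 s j k) * (d j n \<omega> * d k n \<omega>))
          + (\<Sum>j\<in>UNIV. \<Sum>k\<in>UNIV. \<Sum>l\<in>UNIV. (C s j k l n \<omega> + C0 s j k l) * (d j n \<omega> * (d k n \<omega> * d l n \<omega>)))
          + (\<Sum>j\<in>UNIV. \<Sum>k\<in>UNIV. \<Sum>l\<in>UNIV. \<Sum>m\<in>UNIV. D s j k l m n \<omega> * (d j n \<omega> * (d k n \<omega> * (d l n \<omega> * d m n \<omega>))))"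
          unfolding distrib_left sum.distrib 1 2 3 4 5 by linarith
      qed
    qed
  qed
qed

lemma likelihood_expansion: "likelihood_expansion P N X e A B C D B0 C0 D0 d"
  by (intro likelihood_expansion.intro iid likelihood_expansion_axioms.intro
      hom_e hom_A hom_B hom_C order_d order_D order_D_dev likelihood_equation)

lemmas error_moments = moments_of_estimation_error[OF likelihood_expansion, unfolded Lm_eq d_def]

end

section \<open>The risk\<close>

lemma bigo_cmult: "u \<in> O[F](v) \<Longrightarrow> (\<lambda>x. c * u x) \<in> O[F](v)" for c :: real
  by (cases "c = 0") simp_all

lemma sum_lists_3: "(\<Sum>is | length is = 3. F is) = (\<Sum>(i, j, k)\<in>(UNIV :: ('a::finite \<times> 'a \<times> 'a) set). (F [i, j, k] :: real))"
  by (rule sum.reindex_bij_witness[where i = "\<lambda>(i, j, k). [i, j, k]" and j = "\<lambda>is. (is ! 0, is ! 1, is ! 2)"])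
    (auto simp: length_Suc_conv numeral_eq_Suc)

lemma sum_lists_4: "(\<Sum>is | length is = 4. F is) =
    (\<Sum>(i, j, k, l)\<in>(UNIV :: ('a::finite \<times> 'a \<times> 'a \<times> 'a) set). (F [i, j, k, l] :: real))"
  by (rule sum.reindex_bij_witness[where i = "\<lambda>(i, j, k, l). [i, j, k, l]" and j = "\<lambda>is. (is ! 0, is ! 1, is ! 2, is ! 3)"])
    (auto simp: length_Suc_conv numeral_eq_Suc)

text \<open>The leading coefficient is a trace in matrix notation, while the moments produce a double
  contraction.\<close>

lemma trace_product_symmetric:
  fixes H G K :: "real ^ 'p::finite ^ 'p"
  assumes "\<And>i j. H $ i $ j = H $ j $ i" "\<And>i j. G $ i $ j = G $ j $ i"
  shows "trace (H ** G ** H ** K) = (\<Sum>(i, j)\<in>UNIV. K $ i $ j * (\<Sum>(a, b)\<in>UNIV. H $ i $ a * H $ j $ b * G $ a $ b))"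
proof -
  have "(H ** G ** H) $ j $ i = (\<Sum>a\<in>UNIV. \<Sum>b\<in>UNIV. H $ i $ a * H $ j $ b * G $ a $ b)" for i j
  proof -
    have "(H ** G ** H) $ j $ i = (\<Sum>a\<in>UNIV. (\<Sum>b\<in>UNIV. H $ j $ b * G $ b $ a) * H $ a $ i)"
      by (simp add: matrix_matrix_mult_def)
    also have "\<dots> = (\<Sum>a\<in>UNIV. \<Sum>b\<in>UNIV. H $ i $ a * H $ j $ b * G $ a $ b)"
      unfolding sum_distrib_right using assms by (intro sum.cong refl) (simp add: mult_ac)
    finally show ?thesis .
  qed
  then have "trace (H ** G ** H ** K) = (\<Sum>j\<in>UNIV. \<Sum>i\<in>UNIV. (\<Sum>a\<in>UNIV. \<Sum>b\<in>UNIV. H $ i $ a * H $ j $ b * G $ a $ b) * K $ i $ j)"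
    by (simp add: trace_def matrix_matrix_mult_def[of "H ** G ** H"])
  also have "\<dots> = (\<Sum>i\<in>UNIV. \<Sum>j\<in>UNIV. (\<Sum>a\<in>UNIV. \<Sum>b\<in>UNIV. H $ i $ a * H $ j $ b * G $ a $ b) * K $ i $ j)"
    by (rule sum.swap)
  finally show ?thesis by (simp add: sum_pairs mult.commute)
qed

theorem theorem1:
  fixes \<mu> :: "'x measure" and P :: "'w measure"
    and \<Theta> :: "(real ^ 'p::finite) set"
    and f :: "real ^ 'p \<Rightarrow> 'x \<Rightarrow> real" and g :: "'x \<Rightarrow> real"
    and \<theta>s :: "real ^ 'p"
    and X :: "nat \<Rightarrow> 'w \<Rightarrow> 'x" and \<theta>hat :: "nat \<Rightarrow> 'w \<Rightarrow> real ^ 'p"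
    and \<theta>til :: "nat \<Rightarrow> 'w \<Rightarrow> 'p \<Rightarrow> 'p \<Rightarrow> 'p \<Rightarrow> 'p \<Rightarrow> 'p \<Rightarrow> real ^ 'p"
    and G Gt Gs :: "real ^ 'p ^ 'p"
    and L :: "'p list list \<Rightarrow> real" and \<tau> :: "'p list \<Rightarrow> real"
    and gi :: "'p \<Rightarrow> 'p \<Rightarrow> real"
  assumes model: "smooth_model \<mu> \<Theta> f"
    and truth: "prob_density \<mu> g"
    and projection: "information_projection \<mu> g \<Theta> f \<theta>s"
    and sample: "iid_sample P \<mu> g X"
    and mle: "is_mle P X \<Theta> f \<theta>hat"
    and G_def: "G = Gmat \<mu> g f \<theta>s"
    and Gt_def: "Gt = Gtilde \<mu> g f \<theta>s"
    and Gs_def: "Gs = Gstar \<mu> f \<theta>s"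
    and gi_def: "gi = (\<lambda>i j. matrix_inv Gt $ i $ j)"
    and L_def: "L = Lmom \<mu> g f \<theta>s"
    and \<tau>_def: "\<tau> = (\<lambda>is. Lmom \<mu> (f \<theta>s) f \<theta>s [is])"
    and Gt_inv: "invertible Gt"
    and diff_int: "diff_under_integral \<mu> \<Theta> f"
    and expansion: "risk_expandable P \<mu> f \<theta>s \<theta>hat"
    and taylor: "taylor_points P X \<Theta> f \<theta>s \<theta>hat \<theta>til"
    and moments: "moments_bounded P X f \<theta>s \<theta>hat \<theta>til Gt"
    and remainder: "remainder_stable P \<mu> g X f \<theta>s \<theta>til Gt"
  shows "(\<lambda>n. mle_risk P \<mu> f \<theta>s \<theta>hat n -
            (1 / (2 * real n) * trace (matrix_inv Gt ** G ** matrix_inv Gt ** Gs)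
             + 1 / (real n)\<^sup>2 *
                ((\<Sum>(i,j)\<in>UNIV. 1/2 * Gs $ i $ j * second_moment_coef L gi i j)
                 - (\<Sum>(i,j,k)\<in>UNIV. 1/6 * \<tau> [i,j,k] * third_moment_coef L gi i j k)
                 - (\<Sum>(i,j,k,l)\<in>UNIV. 1/24 * \<tau> [i,j,k,l] * fourth_moment_coef L gi i j k l))))
         \<in> O(\<lambda>n. 1 / (real n) ^ 3)"
proof -
  interpret mle: misspecified_mle \<mu> P \<Theta> f g \<theta>s X \<theta>hat \<theta>til Gt
    by unfold_locales (fact model truth projection sample mle Gt_def Gt_inv taylor moments remainder)+
  have h: "mle.h = gi" by (simp add: gi_def mle.h_def fun_eq_iff)
  let ?O = "O(\<lambda>n. 1 / (real n) ^ 3) :: (nat \<Rightarrow> real) set"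
  define E2 where "E2 i j n = (\<integral>\<omega>. (\<theta>hat n \<omega> $ i - \<theta>s $ i) * (\<theta>hat n \<omega> $ j - \<theta>s $ j) \<partial>P)" for i j n
  define E3 where "E3 i j k n = (\<integral>\<omega>. (\<theta>hat n \<omega> $ i - \<theta>s $ i) * ((\<theta>hat n \<omega> $ j - \<theta>s $ j) * (\<theta>hat n \<omega> $ k - \<theta>s $ k)) \<partial>P)" for i j k n
  define E4 where "E4 i j k l n = (\<integral>\<omega>. (\<theta>hat n \<omega> $ i - \<theta>s $ i) * ((\<theta>hat n \<omega> $ j - \<theta>s $ j) *
      ((\<theta>hat n \<omega> $ k - \<theta>s $ k) * (\<theta>hat n \<omega> $ l - \<theta>s $ l))) \<partial>P)" for i j k l n
  define V where "V i j = (\<Sum>(a, b)\<in>UNIV. gi i a * gi j b * L [[a], [b]])" for i j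
  note errors = mle.error_moments[unfolded h, folded L_def]
  have E2: "(\<lambda>n. E2 i j n - (V i j / real n + second_moment_coef L gi i j / (real n)\<^sup>2)) \<in> ?O" for i j
    unfolding E2_def V_def by (rule errors(1))
  have E3: "(\<lambda>n. E3 i j k n - third_moment_coef L gi i j k / (real n)\<^sup>2) \<in> ?O" for i j k
    unfolding E3_def by (rule errors(2))
  have E4: "(\<lambda>n. E4 i j k l n - fourth_moment_coef L gi i j k l / (real n)\<^sup>2) \<in> ?O" for i j k l
    unfolding E4_def by (rule errors(3))
  have tr: "trace (matrix_inv Gt ** G ** matrix_inv Gt ** Gs) = (\<Sum>(i,j)\<in>UNIV. Gs $ i $ j * V i j)"
    using trace_product_symmetric[of "matrix_inv Gt" G Gs] mle.h_sym
    by (simp add: mle.h_def V_def gi_def G_def Gmat_def L_def Lmom_def mult_ac)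
  let ?rt = "risk_term P \<mu> f \<theta>s \<theta>hat"
  have rt3: "?rt 3 n = (\<Sum>(i,j,k)\<in>UNIV. 1/6 * \<tau> [i,j,k] * E3 i j k n)" for n
    unfolding risk_term_def sum_lists_3 by (simp add: E3_def \<tau>_def fact_numeral sum_distrib_left case_prod_unfold)
  have rt4: "?rt 4 n = (\<Sum>(i,j,k,l)\<in>UNIV. 1/24 * \<tau> [i,j,k,l] * E4 i j k l n)" for n
    unfolding risk_term_def sum_lists_4 by (simp add: E4_def \<tau>_def fact_numeral sum_distrib_left case_prod_unfold)
  \<comment> \<open>Truncation after degree four would leave an error of order \<open>n\<^bsup>-5/2\<^esup>\<close> only.\<close>
  have rt5: "?rt 5 \<in> ?O"
    unfolding risk_term_def
  proof (intro bigo_cmult big_sum_in_bigo)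
    fix "is" :: "'p list" assume "is \<in> {is. length is = 5}"
    then obtain i j k l m where "is": "is = [i, j, k, l, m]" by (auto simp: length_Suc_conv numeral_eq_Suc)
    show "(\<lambda>n. \<integral>\<omega>. (\<Prod>i\<leftarrow>is. \<theta>hat n \<omega> $ i - \<theta>s $ i) \<partial>P) \<in> ?O"
      using errors(4)[of i j k l m] by (simp add: "is")
  qed
  define R where "R n = mle_risk P \<mu> f \<theta>s \<theta>hat n - (1/2 * (\<Sum>(i,j)\<in>UNIV. Gs $ i $ j * E2 i j n) - (\<Sum>t=3..5. ?rt t n))" for n
  have "R \<in> O(\<lambda>n. real n powr (- (real 5 + 1) / 2))"
    using expansion unfolding risk_expandable_def R_def E2_def Gs_def by (elim conjE allE[of _ 5]) simp
  moreover have "\<forall>\<^sub>F n in sequentially. real n powr (- (real 5 + 1) / 2) = 1 / (real n) ^ 3"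
    using eventually_gt_at_top[of 0]
    by eventually_elim (simp add: powr_minus_divide powr_numeral)
  ultimately have R: "R \<in> ?O" by (simp add: landau_o.big.cong)
  have "{3..5} = {3, 4, 5::nat}" by auto
  then have sum_rt: "(\<Sum>t=3..5. ?rt t n) = ?rt 3 n + ?rt 4 n + ?rt 5 n" for n by simp
  let ?d2 = "\<lambda>i j n. E2 i j n - (V i j / real n + second_moment_coef L gi i j / (real n)\<^sup>2)"
  let ?d3 = "\<lambda>i j k n. E3 i j k n - third_moment_coef L gi i j k / (real n)\<^sup>2"
  let ?d4 = "\<lambda>i j k l n. E4 i j k l n - fourth_moment_coef L gi i j k l / (real n)\<^sup>2"
  have S2: "(\<lambda>n. \<Sum>p\<in>UNIV. 1/2 * Gs $ fst p $ snd p * ?d2 (fst p) (snd p) n) \<in> ?O"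
    by (intro big_sum_in_bigo bigo_cmult E2)
  have S3: "(\<lambda>n. \<Sum>(i,j,k)\<in>UNIV. 1/6 * \<tau> [i,j,k] * ?d3 i j k n) \<in> ?O"
    unfolding case_prod_unfold by (intro big_sum_in_bigo bigo_cmult E3)
  have S4: "(\<lambda>n. \<Sum>(i,j,k,l)\<in>UNIV. 1/24 * \<tau> [i,j,k,l] * ?d4 i j k l n) \<in> ?O"
    unfolding case_prod_unfold by (intro big_sum_in_bigo bigo_cmult E4)
  have "mle_risk P \<mu> f \<theta>s \<theta>hat n -
            (1 / (2 * real n) * trace (matrix_inv Gt ** G ** matrix_inv Gt ** Gs)
             + 1 / (real n)\<^sup>2 *
                ((\<Sum>(i,j)\<in>UNIV. 1/2 * Gs $ i $ j * second_moment_coef L gi i j)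
                 - (\<Sum>(i,j,k)\<in>UNIV. 1/6 * \<tau> [i,j,k] * third_moment_coef L gi i j k)
                 - (\<Sum>(i,j,k,l)\<in>UNIV. 1/24 * \<tau> [i,j,k,l] * fourth_moment_coef L gi i j k l)))
     = R n + (\<Sum>p\<in>UNIV. 1/2 * Gs $ fst p $ snd p * ?d2 (fst p) (snd p) n)
       - (\<Sum>(i,j,k)\<in>UNIV. 1/6 * \<tau> [i,j,k] * ?d3 i j k n)
       - (\<Sum>(i,j,k,l)\<in>UNIV. 1/24 * \<tau> [i,j,k,l] * ?d4 i j k l n) - ?rt 5 n" for n
    unfolding R_def sum_rt rt3 rt4 tr
    by (simp add: case_prod_unfold right_diff_distrib distrib_left sum.distrib sum_subtractf sum_distrib_left
        sum_divide_distrib mult_ac)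
  then show ?thesis
    using sum_in_bigo(2)[OF sum_in_bigo(2)[OF sum_in_bigo(2)[OF sum_in_bigo(1)[OF R S2] S3] S4] rt5] by simp
qed

end
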